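(* The bilinear form $\ell_h\colon \mathbb{P}^k(\mathcal{F}_h^{\mathrm{B}})\times\mathbb{P}^k(\mathcal{F}_h^{\mathrm{B}})\to\mathbb{R}$ defined, for all $\mu,\eta\in\mathbb{P}^k(\mathcal{F}_h^{\mathrm{B}})$, by $$\ell_h(\mu,\eta) := -a_h(\mathring{\underline{\psi}}_h^{\mu},\underline{\mathcal{H}}_h\eta) + (\mathring{\underline{\omega}}_h^{\mu},\underline{\mathcal{H}}_h\eta)^{\star},$$ where $(\mathring{\underline{\omega}}_h^{\mu},\mathring{\underline{\psi}}_h^{\mu})\in\underline{U}_{h,\mu}\times\underline{U}_{h,0}$ is the solution of $$a_h(\mathring{\underline{\omega}}_h^{\mu},\underline{v}_h)=0 \quad\text{and}\quad a_h(\mathring{\underline{\psi}}_h^{\mu},\underline{v}_h)=(\mathring{\underline{\omega}}_h^{\mu},\underline{v}_h)^{\star}\qquad\forall \underline{v}_h\in\underline{U}_{h,0},$$ is symmetric and positive-definite.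
   Context: **Mesh.** $\Omega\subset\mathbb{R}^d$, $d\in\{2,3\}$, is an open, bounded, polyhedral domain. $(\mathcal{T}_h,\mathcal{F}_h)$ is a polytopal mesh of $\Omega$: $\mathcal{T}_h$ is a finite set of nonempty, pairwise disjoint, open polytopes (elements) with $\bigcup_{T\in\mathcal{T}_h}\overline{T}=\overline{\Omega}$; $\mathcal{F}_h$ is a finite set of pairwise disjoint faces, each being a nonempty, open, connected subset of a hyperplane whose relative boundary has zero $(d-1)$-dimensional measure; each $F\in\mathcal{F}_h$ is either an interior face (there are two distinct elements $T_1,T_2$ with $F\subset\partial T_1\cap\partial T_2$) or a boundary face (there is one element $T$ with $F\subset\partial T\cap\partial\Omega$); and $\bigcup_{T}\partial T=\bigcup_{F}\overline{F}$. $\mathcal{F}_h^{\mathrm{B}}$ is the set of boundary faces, $\mathcal{F}_T$ is the set of faces contained in $\partial T$, $\mathcal{T}_h^{\mathrm{B}}$ is the set of elements located at the boundary of the domain (having at least one face in $\mathcal{F}_h^{\mathrm{B}}$), $h_F$ is the diameter of $F$, and $\mathbf{n}_{\partial T}$ is the unit normal to $\partial T$ pointing out of $T$. $(\cdot,\cdot)$, $(\cdot,\cdot)_T$, $\langle\cdot,\cdot\rangle_F$ are the $L^2$-inner products on $\Omega$, $T$, $F$ (also for vector-valued functions), and $\langle\cdot,\cdot\rangle_{\mathcal{F}_T}:=\sum_{F\in\mathcal{F}_T}\langle\cdot,\cdot\rangle_F$. **Spaces.** For $m\in\mathbb{N}_0$ and $X$ an element or face, $\mathbb{P}^m(X)$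 is the space of restrictions to $X$ of $d$-variate polynomials of total degree $\le m$, and $\pi_X^m\colon L^2(X)\to\mathbb{P}^m(X)$ is the $L^2$-orthogonal projector. $\mathbb{P}^m(\mathcal{T}_h)$, $\mathbb{P}^m(\mathcal{F}_h)$, $\mathbb{P}^m(\mathcal{F}_T)$, $\mathbb{P}^m(\mathcal{F}_h^{\mathrm{B}})$ are the broken polynomial spaces, i.e. families of polynomials in $\mathbb{P}^m(X)$, one for each $X$ in the indicated set. Fix $k\in\mathbb{N}_0$, $l\in\{k,k+1\}$. Set $\underline{U}_h:=\{\underline{v}_h=(v_{\mathcal{T}_h},v_{\mathcal{F}_h})\in\mathbb{P}^l(\mathcal{T}_h)\times\mathbb{P}^k(\mathcal{F}_h)\}$ and $\underline{U}_T:=\{\underline{v}_T=(v_T,v_{\mathcal{F}_T})\in\mathbb{P}^l(T)\times\mathbb{P}^k(\mathcal{F}_T)\}$; $\underline{v}_T$ denotes the restriction of $\underline{v}_h$ to $T$ and its faces. For $\mu\in\mathbb{P}^k(\mathcal{F}_h^{\mathrm{B}})$, $\underline{U}_{h,\mu}:=\{\underline{v}_h\in\underline{U}_h : v_F=\mu_F\ \forall F\in\mathcal{F}_h^{\mathrm{B}}\}$; in particular $\underline{U}_{h,0}$ has zero boundary face unknowns. **Bilinear form $a_h$.** The reconstruction $p_T^{k+1}\colon\underline{U}_T\to\mathbb{P}^{k+1}(T)$ is defined by $(\nabla p_T^{k+1}\underline{v}_T,\nabla w)_T=-(v_T,\Delta w)_T+\langle v_{\mathcal{F}_T},\nabla w\cdot\mathbf{n}_{\partial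 T}\rangle_{\mathcal{F}_T}$ for all $w\in\mathbb{P}^{k+1}(T)$ and $(p_T^{k+1}\underline{v}_T,1)_T=(v_T,1)_T$. Set $\delta_T\underline{v}_T:=\pi_T^l(p_T^{k+1}\underline{v}_T-v_T)$ and $\delta_{TF}\underline{v}_T:=\pi_F^k(p_T^{k+1}\underline{v}_T-v_F)$ for $F\in\mathcal{F}_T$. The stabilization is $s_T(\underline{v}_T,\underline{w}_T):=\sum_{F\in\mathcal{F}_T}h_F^{-1}\mathfrak{s}_{TF}(\underline{v}_T,\underline{w}_T)$ with $\mathfrak{s}_{TF}(\underline{v}_T,\underline{w}_T):=\langle(\delta_{TF}-\delta_T)\underline{v}_T,(\delta_{TF}-\delta_T)\underline{w}_T\rangle_F$, or alternatively, if $l=k+1$, $\mathfrak{s}_{TF}(\underline{v}_T,\underline{w}_T):=\langle\pi_F^k(v_T-v_F),\pi_F^k(w_T-w_F)\rangle_F$. Then $a_T(\underline{v}_T,\underline{w}_T):=(\nabla p_T^{k+1}\underline{v}_T,\nabla p_T^{k+1}\underline{w}_T)_T+s_T(\underline{v}_T,\underline{w}_T)$ and $a_h(\underline{v}_h,\underline{w}_h):=\sum_{T\in\mathcal{T}_h}a_T(\underline{v}_T,\underline{w}_T)$. **Lifting $\underline{\mathcal{H}}_h$.** For each $T$, $\Theta_T\colon\mathbb{P}^k(\mathcal{F}_T)\to\mathbb{P}^l(T)$ is the linear operator such that $\Theta_T v_{\mathcal{F}_T}$ is the unique solution of $a_T((\Theta_T v_{\mathcal{F}_T},0),(w_T,0))=-a_T((0,v_{\mathcal{F}_T}),(w_T,0))$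 for all $w_T\in\mathbb{P}^l(T)$; $\Theta_{\mathcal{T}_h}\colon\mathbb{P}^k(\mathcal{F}_h)\to\mathbb{P}^l(\mathcal{T}_h)$ is defined by $(\Theta_{\mathcal{T}_h}v_{\mathcal{F}_h})_{|T}:=\Theta_T v_{\mathcal{F}_T}$. For $\eta\in\mathbb{P}^k(\mathcal{F}_h^{\mathrm{B}})$, $\mathcal{H}_{\mathcal{F}_h}\eta\in\mathbb{P}^k(\mathcal{F}_h)$ equals $\eta_F$ on $F\in\mathcal{F}_h^{\mathrm{B}}$ and $0$ on all other faces; $\mathcal{H}_{\mathcal{T}_h}\eta:=\Theta_{\mathcal{T}_h}\mathcal{H}_{\mathcal{F}_h}\eta$; and $\underline{\mathcal{H}}_h\eta:=(\mathcal{H}_{\mathcal{T}_h}\eta,\mathcal{H}_{\mathcal{F}_h}\eta)\in\underline{U}_h$. **Form $(\cdot,\cdot)^\star$.** For $\underline{v}_h,\underline{w}_h\in\underline{U}_h$, $$(\underline{v}_h,\underline{w}_h)^{\star}:=(v_{\mathcal{T}_h},w_{\mathcal{T}_h})+\sum_{T\in\mathcal{T}_h^{\mathrm{B}}}\sum_{F\in\mathcal{F}_T}h_F\,\langle\pi_F^k(v_T-v_F),\pi_F^k(w_T-w_F)\rangle_F.$$ *)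

theory Defs
  imports "HOL-Analysis.Analysis"
begin

section \<open>Polynomials and differential operators\<close>

definition multi_indices :: "nat \<Rightarrow> ('a::euclidean_space \<Rightarrow> nat) set" where
  "multi_indices m = {\<alpha> \<in> Basis \<rightarrow>\<^sub>E {..m}. (\<Sum>i\<in>Basis. \<alpha> i) \<le> m}"

definition polys :: "nat \<Rightarrow> ('a::euclidean_space \<Rightarrow> real) set" where
  "polys m = {p. \<exists>c. p = (\<lambda>x. \<Sum>\<alpha>\<in>multi_indices m. c \<alpha> * (\<Prod>i\<in>Basis. (x \<bullet> i) ^ \<alpha> i))}"

text \<open>Polynomials on an element \<open>T\<close> are identified with their unique polynomial extension, so
  that they have traces on the faces; this is harmless because \<open>T\<close> is nonempty and open. On a face
  this identification is not possible (polynomials may vanish on a hyperplane), so there the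
  restriction is taken, extended by zero.\<close>

definition polys_on :: "nat \<Rightarrow> 'a::euclidean_space set \<Rightarrow> ('a \<Rightarrow> real) set" where
  "polys_on m F = {q. \<exists>p\<in>polys m. q = (\<lambda>x. if x \<in> F then p x else 0)}"

text \<open>Families \<open>(v X)\<close>, \<open>X \<in> S\<close>, with \<open>v X \<in> V X\<close>; the values at other indices are set to zero, so
  that equality of families is equality of functions.\<close>

definition broken :: "'i set \<Rightarrow> ('i \<Rightarrow> ('a \<Rightarrow> real) set) \<Rightarrow> ('i \<Rightarrow> 'a \<Rightarrow> real) set" where
  "broken S V = {v. (\<forall>X\<in>S. v X \<in> V X) \<and> (\<forall>X. X \<notin> S \<longrightarrow> v X = (\<lambda>_. 0))}"

definition bilinear_form_on ::
  "('i \<Rightarrow> 'a \<Rightarrow> real) set \<Rightarrow> (('i \<Rightarrow> 'a \<Rightarrow> real) \<Rightarrow> ('i \<Rightarrow> 'a \<Rightarrow> real) \<Rightarrow> real) \<Rightarrow> bool" where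
  "bilinear_form_on V B \<longleftrightarrow>
     (\<forall>u\<in>V. \<forall>v\<in>V. \<forall>w\<in>V. \<forall>c.
        B (\<lambda>X x. c * u X x + v X x) w = c * B u w + B v w \<and>
        B w (\<lambda>X x. c * u X x + v X x) = c * B w u + B w v)"

definition grad :: "('a::euclidean_space \<Rightarrow> real) \<Rightarrow> 'a \<Rightarrow> 'a" where
  "grad f x = (\<Sum>i\<in>Basis. frechet_derivative f (at x) i *\<^sub>R i)"

definition laplacian :: "('a::euclidean_space \<Rightarrow> real) \<Rightarrow> 'a \<Rightarrow> real" where
  "laplacian f x = (\<Sum>i\<in>Basis. frechet_derivative (\<lambda>y. frechet_derivative f (at y) i) (at x) i)"


section \<open>Surface measure\<close>

text \<open>The \<open>(d-1)\<close>-dimensional Lebesgue measure on the hyperplane \<open>{x. n \<bullet> x = b}\<close>, where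
  \<open>norm n = 1\<close>: by Fubini, a set \<open>A\<close> in the hyperplane has the same measure as the prism of height
  one over \<open>A\<close>. The slab is centered to make the definition invariant under
  \<open>(n, b) \<mapsto> (- n, - b)\<close>.\<close>

definition hyperplane_lborel :: "'a::euclidean_space \<Rightarrow> real \<Rightarrow> 'a measure" where
  "hyperplane_lborel n b =
     distr (restrict_space lborel {x. \<bar>n \<bullet> x - b\<bar> \<le> 1/2}) borel (\<lambda>x. x - (n \<bullet> x - b) *\<^sub>R n)"

text \<open>The same for the hyperplane carrying \<open>F\<close>. If \<open>F\<close> is nonempty and open in a hyperplane, then
  \<open>(n, b)\<close> is determined up to a common sign.\<close>

definition face_lborel :: "'a::euclidean_space set \<Rightarrow> 'a measure" where
  "face_lborel F =
     (case (SOME (n, b). norm n = 1 \<and> F \<subseteq> {x. n \<bullet> x = b}) of (n, b) \<Rightarrow> hyperplane_lborel n b)"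

definition elem_ip :: "'a::euclidean_space set \<Rightarrow> ('a \<Rightarrow> real) \<Rightarrow> ('a \<Rightarrow> real) \<Rightarrow> real" where
  "elem_ip T f g = (LINT x:T|lborel. f x * g x)"

definition elem_vec_ip :: "'a::euclidean_space set \<Rightarrow> ('a \<Rightarrow> 'a) \<Rightarrow> ('a \<Rightarrow> 'a) \<Rightarrow> real" where
  "elem_vec_ip T f g = (LINT x:T|lborel. f x \<bullet> g x)"

definition face_ip :: "'a::euclidean_space set \<Rightarrow> ('a \<Rightarrow> real) \<Rightarrow> ('a \<Rightarrow> real) \<Rightarrow> real" where
  "face_ip F f g = (LINT x:F|face_lborel F. f x * g x)"

definition elem_proj :: "nat \<Rightarrow> 'a::euclidean_space set \<Rightarrow> ('a \<Rightarrow> real) \<Rightarrow> ('a \<Rightarrow> real)" where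
  "elem_proj m T f = (THE p. p \<in> polys m \<and> (\<forall>q\<in>polys m. elem_ip T p q = elem_ip T f q))"

definition face_proj :: "nat \<Rightarrow> 'a::euclidean_space set \<Rightarrow> ('a \<Rightarrow> real) \<Rightarrow> ('a \<Rightarrow> real)" where
  "face_proj m F f = (THE p. p \<in> polys_on m F \<and> (\<forall>q\<in>polys_on m F. face_ip F p q = face_ip F f q))"


section \<open>Polytopal meshes\<close>

text \<open>Open polytopes need not be convex (\<open>polytope\<close> is the convex notion). Being the interior of a
  closed set, such a set has no slits.\<close>

definition open_polytope :: "'a::euclidean_space set \<Rightarrow> bool" where
  "open_polytope P \<longleftrightarrow> P \<noteq> {} \<and> (\<exists>\<K>. finite \<K> \<and> (\<forall>K\<in>\<K>. polytope K) \<and> P = interior (\<Union>\<K>))"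

definition mesh_face :: "'a::euclidean_space set \<Rightarrow> bool" where
  "mesh_face F \<longleftrightarrow> F \<noteq> {} \<and> connected F \<and>
     (\<exists>a b. a \<noteq> 0 \<and> openin (top_of_set {x. a \<bullet> x = b}) F) \<and>
     emeasure (face_lborel F) (rel_frontier F) = 0"

text \<open>\<open>n\<close> is the (constant) unit normal to \<open>\<partial>T\<close> on \<open>F\<close> pointing out of \<open>T\<close>. Exceptional points of
  surface measure zero are allowed, for example where a vertex of an element touches \<open>F\<close>.\<close>

definition outward_normal :: "'a::euclidean_space set \<Rightarrow> 'a set \<Rightarrow> 'a \<Rightarrow> bool" where
  "outward_normal T F n \<longleftrightarrow> norm n = 1 \<and> (\<exists>b. F \<subseteq> {x. n \<bullet> x = b}) \<and>
     (AE x in face_lborel F. x \<in> F \<longrightarrow>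
        (\<forall>\<^sub>F t in at_right 0. x - t *\<^sub>R n \<in> T \<and> x + t *\<^sub>R n \<notin> T))"

definition unit_normal :: "'a::euclidean_space set \<Rightarrow> 'a set \<Rightarrow> 'a" where
  "unit_normal T F = (THE n. outward_normal T F n)"

text \<open>The last condition makes explicit that every face of an element \<open>T\<close> has a unit normal pointing
  out of \<open>T\<close>. It excludes polytopes touching themselves so that \<open>T\<close> lies on one side of one part of
  \<open>F\<close> and on the other side of another part of \<open>F\<close>.\<close>

definition polytopal_mesh ::
  "'a::euclidean_space set \<Rightarrow> 'a set set \<Rightarrow> 'a set set \<Rightarrow> bool" where
  "polytopal_mesh \<Omega> Th Fh \<longleftrightarrow>
     finite Th \<and> (\<forall>T\<in>Th. open_polytope T) \<and> disjoint Th \<and>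
     (\<Union>T\<in>Th. closure T) = closure \<Omega> \<and>
     finite Fh \<and> (\<forall>F\<in>Fh. mesh_face F) \<and> disjoint Fh \<and>
     (\<forall>F\<in>Fh. (\<exists>T1\<in>Th. \<exists>T2\<in>Th. T1 \<noteq> T2 \<and> F \<subseteq> frontier T1 \<inter> frontier T2) \<or>
             (\<exists>T\<in>Th. F \<subseteq> frontier T \<inter> frontier \<Omega>)) \<and>
     (\<Union>T\<in>Th. frontier T) = (\<Union>F\<in>Fh. closure F) \<and>
     (\<forall>T\<in>Th. \<forall>F\<in>Fh. F \<subseteq> frontier T \<longrightarrow> (\<exists>n. outward_normal T F n))"


section \<open>The hybrid high-order discretization\<close>

datatype stabilization = Reconstruction_Stab | Projection_Stab

locale hho =
  fixes \<Omega> :: "'a::euclidean_space set"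
    and Th Fh :: "'a set set"
    and k l :: nat
    and stab :: stabilization
begin

definition boundary_faces :: "'a set set" where
  "boundary_faces = {F \<in> Fh. \<exists>T\<in>Th. F \<subseteq> frontier T \<inter> frontier \<Omega>}"

definition elem_faces :: "'a set \<Rightarrow> 'a set set" where
  "elem_faces T = {F \<in> Fh. F \<subseteq> frontier T}"

definition boundary_elems :: "'a set set" where
  "boundary_elems = {T \<in> Th. elem_faces T \<inter> boundary_faces \<noteq> {}}"

definition Uh :: "(('a set \<Rightarrow> 'a \<Rightarrow> real) \<times> ('a set \<Rightarrow> 'a \<Rightarrow> real)) set" where
  "Uh = broken Th (\<lambda>_. polys l) \<times> broken Fh (polys_on k)"

definition Pk_boundary :: "('a set \<Rightarrow> 'a \<Rightarrow> real) set" where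
  "Pk_boundary = broken boundary_faces (polys_on k)"

definition Uh_bc ::
  "('a set \<Rightarrow> 'a \<Rightarrow> real) \<Rightarrow> (('a set \<Rightarrow> 'a \<Rightarrow> real) \<times> ('a set \<Rightarrow> 'a \<Rightarrow> real)) set" where
  "Uh_bc \<mu> = {v \<in> Uh. \<forall>F\<in>boundary_faces. snd v F = \<mu> F}"

text \<open>In the local definitions, \<open>v\<close> and \<open>w\<close> are pairs of an element polynomial and a family of
  polynomials on the faces of \<open>T\<close>.\<close>

definition restr_faces :: "'a set \<Rightarrow> ('a set \<Rightarrow> 'a \<Rightarrow> real) \<Rightarrow> ('a set \<Rightarrow> 'a \<Rightarrow> real)" where
  "restr_faces T v = (\<lambda>F. if F \<in> elem_faces T then v F else (\<lambda>_. 0))"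

definition restr ::
  "'a set \<Rightarrow> ('a set \<Rightarrow> 'a \<Rightarrow> real) \<times> ('a set \<Rightarrow> 'a \<Rightarrow> real)
    \<Rightarrow> ('a \<Rightarrow> real) \<times> ('a set \<Rightarrow> 'a \<Rightarrow> real)" where
  "restr T v = (fst v T, restr_faces T (snd v))"

definition recon :: "'a set \<Rightarrow> ('a \<Rightarrow> real) \<times> ('a set \<Rightarrow> 'a \<Rightarrow> real) \<Rightarrow> 'a \<Rightarrow> real" where
  "recon T v = (THE p. p \<in> polys (k + 1) \<and>
     (\<forall>w\<in>polys (k + 1). elem_vec_ip T (grad p) (grad w) =
        - elem_ip T (fst v) (laplacian w)
        + (\<Sum>F\<in>elem_faces T. face_ip F (snd v F) (\<lambda>x. grad w x \<bullet> unit_normal T F))) \<and>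
     elem_ip T p (\<lambda>_. 1) = elem_ip T (fst v) (\<lambda>_. 1))"

definition delta_elem :: "'a set \<Rightarrow> ('a \<Rightarrow> real) \<times> ('a set \<Rightarrow> 'a \<Rightarrow> real) \<Rightarrow> 'a \<Rightarrow> real" where
  "delta_elem T v = elem_proj l T (\<lambda>x. recon T v x - fst v x)"

definition delta_face ::
  "'a set \<Rightarrow> 'a set \<Rightarrow> ('a \<Rightarrow> real) \<times> ('a set \<Rightarrow> 'a \<Rightarrow> real) \<Rightarrow> 'a \<Rightarrow> real" where
  "delta_face T F v = face_proj k F (\<lambda>x. recon T v x - snd v F x)"

definition s_face ::
  "'a set \<Rightarrow> 'a set \<Rightarrow> ('a \<Rightarrow> real) \<times> ('a set \<Rightarrow> 'a \<Rightarrow> real)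
    \<Rightarrow> ('a \<Rightarrow> real) \<times> ('a set \<Rightarrow> 'a \<Rightarrow> real) \<Rightarrow> real" where
  "s_face T F v w = (case stab of
     Reconstruction_Stab \<Rightarrow> face_ip F (\<lambda>x. delta_face T F v x - delta_elem T v x)
                                     (\<lambda>x. delta_face T F w x - delta_elem T w x)
   | Projection_Stab \<Rightarrow> face_ip F (face_proj k F (\<lambda>x. fst v x - snd v F x))
                                 (face_proj k F (\<lambda>x. fst w x - snd w F x)))"

definition s_elem ::
  "'a set \<Rightarrow> ('a \<Rightarrow> real) \<times> ('a set \<Rightarrow> 'a \<Rightarrow> real)
    \<Rightarrow> ('a \<Rightarrow> real) \<times> ('a set \<Rightarrow> 'a \<Rightarrow> real) \<Rightarrow> real" where
  "s_elem T v w = (\<Sum>F\<in>elem_faces T. inverse (diameter F) * s_face T F v w)"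

definition a_elem ::
  "'a set \<Rightarrow> ('a \<Rightarrow> real) \<times> ('a set \<Rightarrow> 'a \<Rightarrow> real)
    \<Rightarrow> ('a \<Rightarrow> real) \<times> ('a set \<Rightarrow> 'a \<Rightarrow> real) \<Rightarrow> real" where
  "a_elem T v w = elem_vec_ip T (grad (recon T v)) (grad (recon T w)) + s_elem T v w"

definition a_h ::
  "('a set \<Rightarrow> 'a \<Rightarrow> real) \<times> ('a set \<Rightarrow> 'a \<Rightarrow> real)
    \<Rightarrow> ('a set \<Rightarrow> 'a \<Rightarrow> real) \<times> ('a set \<Rightarrow> 'a \<Rightarrow> real) \<Rightarrow> real" where
  "a_h v w = (\<Sum>T\<in>Th. a_elem T (restr T v) (restr T w))"

definition Theta_elem :: "'a set \<Rightarrow> ('a set \<Rightarrow> 'a \<Rightarrow> real) \<Rightarrow> 'a \<Rightarrow> real" where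
  "Theta_elem T vF = (THE \<theta>. \<theta> \<in> polys l \<and>
     (\<forall>w\<in>polys l. a_elem T (\<theta>, \<lambda>_ _. 0) (w, \<lambda>_ _. 0) = - a_elem T (\<lambda>_. 0, vF) (w, \<lambda>_ _. 0)))"

definition Theta :: "('a set \<Rightarrow> 'a \<Rightarrow> real) \<Rightarrow> ('a set \<Rightarrow> 'a \<Rightarrow> real)" where
  "Theta vF = (\<lambda>T. if T \<in> Th then Theta_elem T (restr_faces T vF) else (\<lambda>_. 0))"

definition lift_faces :: "('a set \<Rightarrow> 'a \<Rightarrow> real) \<Rightarrow> ('a set \<Rightarrow> 'a \<Rightarrow> real)" where
  "lift_faces \<eta> = (\<lambda>F. if F \<in> boundary_faces then \<eta> F else (\<lambda>_. 0))"

definition lift_h ::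
  "('a set \<Rightarrow> 'a \<Rightarrow> real) \<Rightarrow> ('a set \<Rightarrow> 'a \<Rightarrow> real) \<times> ('a set \<Rightarrow> 'a \<Rightarrow> real)" where
  "lift_h \<eta> = (Theta (lift_faces \<eta>), lift_faces \<eta>)"

definition piecewise :: "('a set \<Rightarrow> 'a \<Rightarrow> real) \<Rightarrow> 'a \<Rightarrow> real" where
  "piecewise v x = (\<Sum>T\<in>Th. indicator T x * v T x)"

definition star_form ::
  "('a set \<Rightarrow> 'a \<Rightarrow> real) \<times> ('a set \<Rightarrow> 'a \<Rightarrow> real)
    \<Rightarrow> ('a set \<Rightarrow> 'a \<Rightarrow> real) \<times> ('a set \<Rightarrow> 'a \<Rightarrow> real) \<Rightarrow> real" where
  "star_form v w = elem_ip \<Omega> (piecewise (fst v)) (piecewise (fst w)) +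
     (\<Sum>T\<in>boundary_elems. \<Sum>F\<in>elem_faces T. diameter F *
        face_ip F (face_proj k F (\<lambda>x. fst v T x - snd v F x))
                  (face_proj k F (\<lambda>x. fst w T x - snd w F x)))"

definition is_solution ::
  "('a set \<Rightarrow> 'a \<Rightarrow> real)
    \<Rightarrow> (('a set \<Rightarrow> 'a \<Rightarrow> real) \<times> ('a set \<Rightarrow> 'a \<Rightarrow> real))
       \<times> (('a set \<Rightarrow> 'a \<Rightarrow> real) \<times> ('a set \<Rightarrow> 'a \<Rightarrow> real)) \<Rightarrow> bool" where
  "is_solution \<mu> = (\<lambda>(\<omega>, \<psi>). \<omega> \<in> Uh_bc \<mu> \<and> \<psi> \<in> Uh_bc (\<lambda>_ _. 0) \<and>
     (\<forall>v\<in>Uh_bc (\<lambda>_ _. 0). a_h \<omega> v = 0 \<and> a_h \<psi> v = star_form \<omega> v))"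

definition omega where "omega \<mu> = fst (THE s. is_solution \<mu> s)"

definition psi where "psi \<mu> = snd (THE s. is_solution \<mu> s)"

definition ell :: "('a set \<Rightarrow> 'a \<Rightarrow> real) \<Rightarrow> ('a set \<Rightarrow> 'a \<Rightarrow> real) \<Rightarrow> real" where
  "ell \<mu> \<eta> = - a_h (psi \<mu>) (lift_h \<eta>) + star_form (omega \<mu>) (lift_h \<eta>)"

end

end

theory Submission
  imports Defs "HOL-Library.Function_Algebras"
begin

text \<open>Since \<open>\<omega>\<^sup>\<eta> - H \<eta>\<close> has zero boundary values, the equations for \<open>\<psi>\<^sup>\<mu>\<close> and \<open>\<omega>\<^sup>\<eta>\<close> turn
  \<open>\<ell>(\<mu>, \<eta>)\<close> into \<open>(\<omega>\<^sup>\<mu>, \<omega>\<^sup>\<eta>)\<^sup>\<star>\<close>, which is symmetric and positive semidefinite; it vanishes for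
  \<open>\<eta> = \<mu>\<close> only if \<open>\<omega>\<^sup>\<mu>\<close> is zero on the elements, and then the face terms force \<open>\<mu> = 0\<close>.

  Well-posedness rests on the definiteness of \<open>a\<^sub>h\<close> on the space with zero boundary values. By Green's
  formula, \<open>a\<^sub>T(v, v) = 0\<close> forces \<open>v\<close> to be a constant \<open>c\<^sub>T\<close> on \<open>T\<close> and its faces. The divergence theorem
  applied to \<open>x \<mapsto> x\<^sub>i\<close> with weights \<open>c\<^sub>T\<^sup>2\<close> then gives \<open>\<Sum>\<^sub>T c\<^sub>T\<^sup>2 |T| = 0\<close>, because the contributions of the
  two sides of an interior face cancel.

  The divergence theorem on the elements is obtained from the fundamental theorem of calculus on
  almost all lines of a given direction, which meet the faces transversally and in points where the
  element locally is a half space.\<close>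

section \<open>Positive semidefinite forms on spaces of functions\<close>

text \<open>An element is only the interior of a finite union of convex polytopes, possibly
  non-convex or with several components, and a face is any suitable relatively open piece of a
  hyperplane. The divergence theorem is therefore obtained without charts or triangulations. The
  lines in a direction \<open>e\<close> are represented by the slab
  \<open>e \<bullet> x \<in> {0..1}\<close>, which meets each of them in length one, so that Fubini
  works without rotating coordinates. The surface measure is itself defined by a slab of height one;
  exchanging the two slabs produces the factor \<open>\<bar>n \<bullet> e\<bar>\<close>.
  Definiteness of \<open>a_h\<close> is usually shown by carrying zero from the boundary through
  neighbouring elements, for which the interior faces must be shown to connect the mesh. The
  weighted divergence identity replaces this walk by a single sum; the square of the constants makes
  its terms nonnegative. Several of the forms have kernels, so existence of solutions is derived for
  semidefinite forms and compatible functionals, and definiteness enters only where it is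
  available.\<close>

instantiation "fun" :: (type, real_vector) real_vector
begin

definition scaleR_fun :: "real \<Rightarrow> ('a \<Rightarrow> 'b) \<Rightarrow> 'a \<Rightarrow> 'b"
  where "c *\<^sub>R f = (\<lambda>x. c *\<^sub>R f x)"

instance
  by standard (auto simp: scaleR_fun_def fun_eq_iff scaleR_add_right scaleR_add_left)

end

lemma scaleR_fun_apply: "(c *\<^sub>R f) x = c *\<^sub>R f x"
  by (simp add: scaleR_fun_def)

text \<open>Functions are handled as abstract vectors; evaluation at a point is triggered on demand
  through \<open>fun_apply\<close>.\<close>

declare plus_fun_apply [simp del] zero_fun_apply [simp del]

lemmas fun_apply = plus_fun_apply zero_fun_apply minus_apply scaleR_fun_apply

text \<open>Operators defined by \<open>THE\<close> are linear only where their defining problem is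
  well posed, hence linearity relative to a carrier.\<close>

definition linear_map_on :: "'v::real_vector set \<Rightarrow> 'w::real_vector set \<Rightarrow> ('v \<Rightarrow> 'w) \<Rightarrow> bool" where
  "linear_map_on V W f \<longleftrightarrow>
     (\<forall>u\<in>V. f u \<in> W) \<and> (\<forall>u\<in>V. \<forall>v\<in>V. \<forall>c. f (c *\<^sub>R u + v) = c *\<^sub>R f u + f v)"

text \<open>Definiteness is left out because of forms with kernels, such as the gradient form, which
  vanishes on constants. It is shown separately on the subspaces where it holds.\<close>

definition psd_form :: "'v::real_vector set \<Rightarrow> ('v \<Rightarrow> 'v \<Rightarrow> real) \<Rightarrow> bool" where
  "psd_form V B \<longleftrightarrow> subspace V \<and>
     (\<forall>u\<in>V. \<forall>v\<in>V. \<forall>w\<in>V. \<forall>c. B (c *\<^sub>R u + v) w = c * B u w + B v w) \<and>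
     (\<forall>u\<in>V. \<forall>v\<in>V. B u v = B v u) \<and> (\<forall>u\<in>V. 0 \<le> B u u)"

text \<open>The spanning set may stick out of \<open>V\<close>, so the property passes to subspaces
  at once; \<open>finite_dim_span\<close> moves the generators into \<open>V\<close>.\<close>

definition finite_dim :: "'v::real_vector set \<Rightarrow> bool" where
  "finite_dim V \<longleftrightarrow> subspace V \<and> (\<exists>S. finite S \<and> V \<subseteq> span S)"

lemma subspace_comb: "subspace V \<Longrightarrow> u \<in> V \<Longrightarrow> v \<in> V \<Longrightarrow> c *\<^sub>R u + v \<in> V"
  by (simp add: subspace_add subspace_scale)

lemma subspaceI_comb:
  assumes "0 \<in> V" "\<And>u v c. u \<in> V \<Longrightarrow> v \<in> V \<Longrightarrow> c *\<^sub>R u + v \<in> V"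
  shows "subspace V"
proof (rule subspaceI)
  show "x + y \<in> V" if "x \<in> V" "y \<in> V" for x y using assms(2)[OF that, of 1] by simp
  show "c *\<^sub>R x \<in> V" if "x \<in> V" for c x using assms(2)[OF that assms(1), of c] by simp
qed (rule assms(1))

lemma linear_map_on_in: "linear_map_on V W f \<Longrightarrow> u \<in> V \<Longrightarrow> f u \<in> W"
  by (simp add: linear_map_on_def)

lemma linear_map_on_comb:
  "linear_map_on V W f \<Longrightarrow> u \<in> V \<Longrightarrow> v \<in> V \<Longrightarrow> f (c *\<^sub>R u + v) = c *\<^sub>R f u + f v"
  by (simp add: linear_map_on_def)

lemma linear_map_on_zero: "subspace V \<Longrightarrow> linear_map_on V W f \<Longrightarrow> f 0 = 0"
  using linear_map_on_comb[of V W f 0 0 1] by (simp add: subspace_0)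

lemma linear_map_on_compose:
  "linear_map_on U V f \<Longrightarrow> linear_map_on V W g \<Longrightarrow> linear_map_on U W (\<lambda>x. g (f x))"
  by (simp add: linear_map_on_def)

lemma psd_comb_left:
  "psd_form V B \<Longrightarrow> u \<in> V \<Longrightarrow> v \<in> V \<Longrightarrow> w \<in> V \<Longrightarrow> B (c *\<^sub>R u + v) w = c * B u w + B v w"
  by (simp add: psd_form_def)

lemma psd_sym: "psd_form V B \<Longrightarrow> u \<in> V \<Longrightarrow> v \<in> V \<Longrightarrow> B u v = B v u"
  by (simp add: psd_form_def)

lemma psd_nonneg: "psd_form V B \<Longrightarrow> u \<in> V \<Longrightarrow> 0 \<le> B u u"
  by (simp add: psd_form_def)

lemma psd_subspace: "psd_form V B \<Longrightarrow> subspace V"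
  by (simp add: psd_form_def)

lemma psd_comb_right:
  "psd_form V B \<Longrightarrow> u \<in> V \<Longrightarrow> v \<in> V \<Longrightarrow> w \<in> V \<Longrightarrow> B w (c *\<^sub>R u + v) = c * B w u + B w v"
  using psd_comb_left[of V B u v w c] psd_sym[of V B] psd_subspace[of V B]
  by (simp add: subspace_comb)

lemma psd_add_left: "psd_form V B \<Longrightarrow> u \<in> V \<Longrightarrow> v \<in> V \<Longrightarrow> w \<in> V \<Longrightarrow> B (u + v) w = B u w + B v w"
  using psd_comb_left[of V B u v w 1] by simp

lemma psd_diff_left: "psd_form V B \<Longrightarrow> u \<in> V \<Longrightarrow> v \<in> V \<Longrightarrow> w \<in> V \<Longrightarrow> B (u - v) w = B u w - B v w"
  using psd_comb_left[of V B v u w "-1"] by simp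

lemma psd_diff_right: "psd_form V B \<Longrightarrow> u \<in> V \<Longrightarrow> v \<in> V \<Longrightarrow> w \<in> V \<Longrightarrow> B w (u - v) = B w u - B w v"
  using psd_comb_right[of V B v u w "-1"] by simp

lemma psd_scale_left: "psd_form V B \<Longrightarrow> u \<in> V \<Longrightarrow> w \<in> V \<Longrightarrow> B (c *\<^sub>R u) w = c * B u w"
  using psd_comb_left[of V B u 0 w c] psd_comb_left[of V B 0 0 w 1] psd_subspace[of V B]
  by (simp add: subspace_0)

lemma psd_zero_left: "psd_form V B \<Longrightarrow> w \<in> V \<Longrightarrow> B 0 w = 0"
  using psd_scale_left[of V B w w 0] by simp

lemma psd_form_subset: "psd_form V B \<Longrightarrow> subspace U \<Longrightarrow> U \<subseteq> V \<Longrightarrow> psd_form U B"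
  unfolding psd_form_def by blast

lemma psd_form_pullback:
  assumes "subspace U" "linear_map_on U V f" "psd_form V B"
  shows "psd_form U (\<lambda>u v. B (f u) (f v))"
  unfolding psd_form_def
  using assms
  by (auto simp: linear_map_on_comb[OF assms(2)] linear_map_on_in[OF assms(2)] psd_comb_left
      psd_nonneg intro: psd_sym)

lemma psd_form_sum:
  assumes "subspace V" "\<And>i. i \<in> I \<Longrightarrow> psd_form V (B i)"
  shows "psd_form V (\<lambda>u v. \<Sum>i\<in>I. B i u v)"
  using assms
  by (auto simp: psd_form_def sum.distrib[symmetric] sum_distrib_left intro!: sum.cong sum_nonneg)

lemma psd_form_scale:
  "psd_form V B \<Longrightarrow> 0 \<le> c \<Longrightarrow> psd_form V (\<lambda>u v. c * B u v)"
  by (auto simp: psd_form_def algebra_simps)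

lemma psd_form_add:
  "psd_form V B \<Longrightarrow> psd_form V C \<Longrightarrow> psd_form V (\<lambda>u v. B u v + C u v)"
  by (auto simp: psd_form_def algebra_simps)

text \<open>The degenerate case of Cauchy-Schwarz: for a null vector \<open>u\<close>, the value of
  the form at \<open>t *\<^sub>R u + w\<close> is affine in \<open>t\<close> and nonnegative, so its
  slope \<open>2 * B u w\<close> is zero.\<close>

lemma psd_null:
  assumes B: "psd_form V B" and u: "u \<in> V" "B u u = 0" and w: "w \<in> V"
  shows "B u w = 0"
proof (rule ccontr)
  assume ne: "B u w \<noteq> 0"
  \<comment> \<open>Chosen so that \<open>2 * t * B u w + B w w = -1\<close>.\<close>
  define t where "t = - (B w w + 1) / (2 * B u w)"
  have "B (t *\<^sub>R u + w) (t *\<^sub>R u + w) = t * (t * B u u + B u w) + (t * B w u + B w w)"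
    using B u(1) w by (simp add: psd_comb_left psd_comb_right psd_subspace subspace_comb distrib_left)
  also have "\<dots> = 2 * t * B u w + B w w"
    using psd_sym[OF B u(1) w] u(2) by simp
  also have "\<dots> = -1"
    using ne by (simp add: t_def field_simps)
  finally show False
    using psd_nonneg[OF B, of "t *\<^sub>R u + w"] B u(1) w by (simp add: psd_subspace subspace_comb)
qed

text \<open>Induction on the spanning set: the new vector is made orthogonal to the old span, which is
  possible since it induces a functional vanishing on the null vectors.\<close>

lemma riesz_span:
  assumes "finite S" "psd_form V B" "S \<subseteq> V" "linear_map_on V UNIV L"
    and "\<And>u. u \<in> V \<Longrightarrow> B u u = 0 \<Longrightarrow> L u = (0::real)"
  shows "\<exists>u\<in>span S. \<forall>w\<in>span S. B u w = L w"
  using assms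
proof (induction S arbitrary: L rule: finite_induct)
  case empty
  then show ?case
    using linear_map_on_zero[OF psd_subspace, of V B UNIV L] psd_zero_left[of V B 0]
    by (auto simp: psd_subspace subspace_0)
next
  case (insert e S)
  note B = \<open>psd_form V B\<close> and L = \<open>linear_map_on V UNIV L\<close>
  have V: "subspace V" using B by (rule psd_subspace)
  have sub: "span S \<subseteq> V" using insert.prems V by (intro span_minimal) auto
  have e: "e \<in> V" using insert.prems by auto
  obtain u where u: "u \<in> span S" "\<And>w. w \<in> span S \<Longrightarrow> B u w = L w"
    using insert.IH[of L] insert.prems by auto
  \<comment> \<open>The induction hypothesis is used twice, for \<open>L\<close> and for
    \<open>B e\<close>, which is why the functional is generalised; \<open>p\<close> becomes the
    projection of \<open>e\<close> to the old span.\<close>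
  have "linear_map_on V UNIV (B e)"
    using B e by (auto simp: linear_map_on_def psd_comb_right)
  moreover have "B e w = 0" if "w \<in> V" "B w w = 0" for w
    using psd_null[OF B that e] psd_sym[OF B e that(1)] by simp
  ultimately obtain p where p: "p \<in> span S" "\<And>w. w \<in> span S \<Longrightarrow> B p w = B e w"
    using insert.IH[of "B e"] insert.prems by auto
  define q where "q = e - p"
  have pV: "p \<in> V" and uV: "u \<in> V" using p u sub by auto
  have qV: "q \<in> V" using e pV V by (simp add: q_def subspace_diff)
  have q0: "B q w = 0" if "w \<in> span S" for w
    using p(2)[OF that] that sub B e pV by (auto simp: q_def psd_diff_left)
  \<comment> \<open>If \<open>q\<close> is a null vector then \<open>L q = 0\<close> by assumption,
    and any coefficient would do.\<close>
  define a where "a = (if B q q = 0 then 0 else L q / B q q)"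
  have aq: "a * B q q = L q"
    using insert.prems(4)[OF qV] by (simp add: a_def)
  have "e \<in> span (insert e S)" by (simp add: span_base)
  moreover have mono: "span S \<subseteq> span (insert e S)" by (simp add: span_mono subset_insertI)
  ultimately have "a *\<^sub>R q + u \<in> span (insert e S)"
    using u(1) p(1) by (auto simp: q_def intro!: span_add span_scale span_diff)
  moreover have "B (a *\<^sub>R q + u) w = L w" if w: "w \<in> span (insert e S)" for w
  proof -
    obtain c where c: "w - c *\<^sub>R e \<in> span S"
      using w by (auto simp: span_insert)
    define z where "z = c *\<^sub>R p + (w - c *\<^sub>R e)"
    have z: "z \<in> span S" using c p(1) by (auto simp: z_def intro!: span_add span_scale)
    then have zV: "z \<in> V" using sub by auto
    have weq: "w = c *\<^sub>R q + z" by (simp add: z_def q_def algebra_simps)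
    have "B (a *\<^sub>R q + u) w = a * (c * B q q + B q z) + (c * B u q + B u z)"
      using B qV uV zV V
      by (simp add: weq psd_comb_left psd_comb_right subspace_comb)
    also have "\<dots> = c * L q + L z"
      using q0[OF z] q0[OF u(1)] psd_sym[OF B uV qV] u(2)[OF z] aq by (simp add: algebra_simps)
    also have "\<dots> = L w"
      using linear_map_on_comb[OF L qV zV] by (simp add: weq)
    finally show ?thesis .
  qed
  ultimately show ?case by blast
qed

lemma finite_dim_subspace: "finite_dim V \<Longrightarrow> subspace V"
  by (simp add: finite_dim_def)

text \<open>A maximal independent subset of \<open>V\<close> spans \<open>V\<close>, and
  independence bounds its size by that of the ambient spanning set.\<close>

lemma finite_dim_span:
  assumes "finite_dim V"
  obtains S where "finite S" "V = span S"
proof -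
  obtain T where T: "finite T" "V \<subseteq> span T" and V: "subspace V"
    using assms by (auto simp: finite_dim_def)
  obtain S where S: "S \<subseteq> V" "independent S" "V \<subseteq> span S"
    using maximal_independent_subset by blast
  moreover have "finite S" using independent_span_bound[OF T(1) S(2)] S(1) T(2) by auto
  moreover have "span S \<subseteq> V" using S V by (intro span_minimal)
  ultimately show thesis using that[of S] by blast
qed

text \<open>Solvability under the compatibility condition that \<open>L\<close> annihilates null
  vectors; it serves the reconstruction, whose form has the constants as kernel.\<close>

lemma riesz:
  assumes "finite_dim V" "psd_form V B" "linear_map_on V UNIV L"
    and "\<And>u. u \<in> V \<Longrightarrow> B u u = 0 \<Longrightarrow> L u = (0::real)"
  shows "\<exists>u\<in>V. \<forall>w\<in>V. B u w = L w"
proof -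
  obtain S where S: "finite S" "V = span S"
    using assms(1) by (rule finite_dim_span)
  then show ?thesis
    using riesz_span[of S V B L] assms by (auto simp: span_superset)
qed

lemma riesz_unique:
  assumes V: "finite_dim V" and B: "psd_form V B" and L: "linear_map_on V UNIV L"
    and def: "\<And>u. u \<in> V \<Longrightarrow> B u u = 0 \<Longrightarrow> u = 0"
  shows "\<exists>!u. u \<in> V \<and> (\<forall>w\<in>V. B u w = (L w :: real))"
proof -
  note sV = finite_dim_subspace[OF V]
  have "L u = 0" if "u \<in> V" "B u u = 0" for u
    using def[OF that] linear_map_on_zero[OF sV L] by simp
  then obtain u where u: "u \<in> V" "\<And>w. w \<in> V \<Longrightarrow> B u w = L w"
    using riesz[OF V B L] by blast
  show ?thesis
  proof (rule ex1I[of _ u])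
    fix v assume v: "v \<in> V \<and> (\<forall>w\<in>V. B v w = L w)"
    have d: "v - u \<in> V" using sV u(1) v by (simp add: subspace_diff)
    then have "B (v - u) (v - u) = 0"
      using psd_diff_left[OF B, of v u "v - u"] u v by simp
    then show "v = u" using def[OF d] by simp
  qed (use u in auto)
qed

text \<open>Projections and reconstruction are defined by \<open>THE\<close>; if solutions combine
  linearly, uniqueness makes the solution operator linear.\<close>

lemma linear_map_on_the:
  assumes V: "subspace V" and W: "subspace W"
    and ex: "\<And>u. u \<in> W \<Longrightarrow> \<exists>!p. p \<in> V \<and> P u p"
    and comb: "\<And>u v p q c. u \<in> W \<Longrightarrow> v \<in> W \<Longrightarrow> p \<in> V \<Longrightarrow> q \<in> V \<Longrightarrow> P u p \<Longrightarrow> P v q \<Longrightarrow>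
                 P (c *\<^sub>R u + v) (c *\<^sub>R p + q)"
  shows "linear_map_on W V (\<lambda>u. THE p. p \<in> V \<and> P u p)"
proof -
  let ?R = "\<lambda>u. THE p. p \<in> V \<and> P u p"
  have R: "?R u \<in> V \<and> P u (?R u)" if "u \<in> W" for u
    by (rule theI') (rule ex[OF that])
  have "?R (c *\<^sub>R u + v) = c *\<^sub>R ?R u + ?R v" if "u \<in> W" "v \<in> W" for u v c
    using ex[of "c *\<^sub>R u + v"] R[OF that(1)] R[OF that(2)] comb[OF that, of "?R u" "?R v" c] that
    by (intro the1_equality) (auto simp: subspace_comb V W)
  then show ?thesis using R by (simp add: linear_map_on_def)
qed

section \<open>Closure properties of finite-dimensional spaces\<close>

lemma finite_dim_subset: "finite_dim V \<Longrightarrow> subspace U \<Longrightarrow> U \<subseteq> V \<Longrightarrow> finite_dim U"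
  unfolding finite_dim_def by (meson order_trans)

lemma finite_dim_image:
  assumes "finite_dim V" "linear f"
  shows "finite_dim (f ` V)"
proof -
  obtain S where S: "finite S" "V = span S"
    using assms(1) by (rule finite_dim_span)
  then show ?thesis
    using assms unfolding finite_dim_def
    by (auto simp: linear_subspace_image linear_span_image intro!: exI[of _ "f ` S"])
qed

lemma finite_dim_Times:
  fixes V :: "'a::real_vector set" and W :: "'b::real_vector set"
  assumes "finite_dim V" "finite_dim W"
  shows "finite_dim (V \<times> W)"
proof -
  obtain S T where ST: "finite S" "V = span S" "finite T" "W = span T"
    using assms by (metis finite_dim_span)
  have lin: "linear (\<lambda>x::'a. (x, 0::'b))" "linear (\<lambda>y::'b. (0::'a, y))"
    by (auto intro!: linearI)
  let ?U = "(\<lambda>x. (x, 0)) ` S \<union> Pair 0 ` T"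
  have "(x, y) \<in> span ?U" if "x \<in> V" "y \<in> W" for x y
  proof -
    have "(x, 0::'b) \<in> span ((\<lambda>x. (x, 0)) ` S)" "(0::'a, y) \<in> span (Pair 0 ` T)"
      using that ST by (simp_all add: linear_span_image[OF lin(1)] linear_span_image[OF lin(2)])
    then have "(x, 0) + (0, y) \<in> span ?U"
      using span_mono[of "(\<lambda>x. (x, 0)) ` S" ?U] span_mono[of "Pair 0 ` T" ?U]
      by (intro span_add) auto
    then show ?thesis by simp
  qed
  then show ?thesis
    using assms ST(1,3) unfolding finite_dim_def
    by (intro conjI subspace_Times exI[of _ ?U]) auto
qed

lemma subspace_broken: "(\<And>X. X \<in> S \<Longrightarrow> subspace (V X)) \<Longrightarrow> subspace (broken S V)"
  by (auto simp: subspace_def broken_def zero_fun_def plus_fun_def scaleR_fun_def)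

lemma finite_dim_broken:
  fixes V :: "'i \<Rightarrow> ('a \<Rightarrow> real) set"
  assumes S: "finite S" and V: "\<And>X. X \<in> S \<Longrightarrow> finite_dim (V X)"
  shows "finite_dim (broken S V)"
proof -
  have "\<exists>G. finite G \<and> V X = span G" if "X \<in> S" for X
    by (rule finite_dim_span[OF V[OF that]]) blast
  then obtain G where G: "\<And>X. X \<in> S \<Longrightarrow> finite (G X)" "\<And>X. X \<in> S \<Longrightarrow> V X = span (G X)"
    by metis
  \<comment> \<open>The injection of a single component; a broken family is the sum of its injected
    components since it vanishes off \<open>S\<close>.\<close>
  define E where "E = (\<lambda>(X::'i) f Y. if Y = X then f else (0::'a \<Rightarrow> real))"
  have lin: "linear (E X)" for X
    by (auto intro!: linearI simp: E_def fun_eq_iff fun_apply)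
  have "v \<in> span (\<Union>X\<in>S. E X ` G X)" if v: "v \<in> broken S V" for v
  proof -
    have "v = (\<Sum>X\<in>S. E X (v X))"
    proof
      fix Y
      have "(\<Sum>X\<in>S. E X (v X)) Y = (\<Sum>X\<in>S. E X (v X) Y)"
        by (induction S rule: infinite_finite_induct) (auto simp: fun_apply)
      also have "\<dots> = (if Y \<in> S then v Y else 0)"
        using S by (simp add: E_def)
      also have "\<dots> = v Y"
        using v by (auto simp: broken_def zero_fun_def)
      finally show "v Y = (\<Sum>X\<in>S. E X (v X)) Y" ..
    qed
    also have "\<dots> \<in> span (\<Union>X\<in>S. E X ` G X)"
    proof (rule span_sum)
      fix X assume X: "X \<in> S"
      then have "E X (v X) \<in> E X ` span (G X)"
        using v G(2) by (auto simp: broken_def)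
      also have "\<dots> = span (E X ` G X)" by (simp add: linear_span_image[OF lin])
      also have "\<dots> \<subseteq> span (\<Union>X\<in>S. E X ` G X)" using X by (intro span_mono) auto
      finally show "E X (v X) \<in> span (\<Union>X\<in>S. E X ` G X)" .
    qed
    finally show ?thesis .
  qed
  then show ?thesis
    using S G V subspace_broken[of S V] unfolding finite_dim_def
    by (intro conjI exI[of _ "\<Union>X\<in>S. E X ` G X"]) auto
qed

section \<open>Polynomials\<close>

definition monomial :: "('a::euclidean_space \<Rightarrow> nat) \<Rightarrow> 'a \<Rightarrow> real" where
  "monomial \<alpha> x = (\<Prod>i\<in>Basis. (x \<bullet> i) ^ \<alpha> i)"

lemma finite_multi_indices: "finite (multi_indices m :: ('a::euclidean_space \<Rightarrow> nat) set)"
  unfolding multi_indices_def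
  by (rule finite_subset[of _ "Basis \<rightarrow>\<^sub>E {..m}"]) (auto intro!: finite_PiE)

text \<open>Turning coefficient sums into a span yields finite dimension and the induction rule
  \<open>polys_induct\<close>.\<close>

lemma polys_eq_span: "polys m = span (monomial ` multi_indices m :: ('a::euclidean_space \<Rightarrow> real) set)"
proof -
  let ?I = "multi_indices m :: ('a \<Rightarrow> nat) set"
  have *: "(\<lambda>x. \<Sum>\<alpha>\<in>A. c \<alpha> * (\<Prod>i\<in>Basis. (x \<bullet> i) ^ \<alpha> i)) = (\<Sum>\<alpha>\<in>A. c \<alpha> *\<^sub>R monomial \<alpha>)"
    for c and A :: "('a \<Rightarrow> nat) set"
    by (induction A rule: infinite_finite_induct) (auto simp: fun_eq_iff monomial_def fun_apply)
  then have eq: "polys m = {p. \<exists>c. p = (\<Sum>\<alpha>\<in>?I. c \<alpha> *\<^sub>R monomial \<alpha>)}"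
    by (simp add: polys_def)
  show ?thesis
  proof
    show "polys m \<subseteq> span (monomial ` ?I)"
      unfolding eq by (blast intro: span_sum span_scale span_base)
    show "span (monomial ` ?I) \<subseteq> polys m"
    proof (rule span_minimal)
      show "monomial ` ?I \<subseteq> polys m"
      proof (clarsimp simp: eq)
        fix \<beta> :: "'a \<Rightarrow> nat" assume "\<beta> \<in> ?I"
        then have "monomial \<beta> = (\<Sum>\<alpha>\<in>?I. (if \<alpha> = \<beta> then 1 else 0) *\<^sub>R monomial \<alpha>)"
          by (simp add: if_distrib[of "\<lambda>c. c *\<^sub>R _"] finite_multi_indices cong: if_cong)
        then show "\<exists>c. monomial \<beta> = (\<Sum>\<alpha>\<in>?I. c \<alpha> *\<^sub>R monomial \<alpha>)"
            by (rule exI[of _ "\<lambda>\<alpha>. if \<alpha> = \<beta> then 1 else 0"])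
      qed
      have "\<exists>e. (\<Sum>\<alpha>\<in>?I. c \<alpha> *\<^sub>R monomial \<alpha>) + (\<Sum>\<alpha>\<in>?I. d \<alpha> *\<^sub>R monomial \<alpha>) = (\<Sum>\<alpha>\<in>?I. e \<alpha> *\<^sub>R monomial \<alpha>)"
        for c d :: "('a \<Rightarrow> nat) \<Rightarrow> real"
        by (rule exI[of _ "\<lambda>\<alpha>. c \<alpha> + d \<alpha>"]) (simp only: scaleR_add_left sum.distrib)
      moreover have "\<exists>e. r *\<^sub>R (\<Sum>\<alpha>\<in>?I. c \<alpha> *\<^sub>R monomial \<alpha>) = (\<Sum>\<alpha>\<in>?I. e \<alpha> *\<^sub>R monomial \<alpha>)"
        for r :: real and c
        by (rule exI[of _ "\<lambda>\<alpha>. r * c \<alpha>"]) (simp add: scaleR_sum_right)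
      moreover have "\<exists>e. (0::'a \<Rightarrow> real) = (\<Sum>\<alpha>\<in>?I. e \<alpha> *\<^sub>R monomial \<alpha>)"
        by (rule exI[of _ "\<lambda>_. 0"]) simp
      ultimately show "subspace (polys m :: ('a \<Rightarrow> real) set)"
        unfolding subspace_def eq by blast
    qed
  qed
qed

lemma finite_dim_polys: "finite_dim (polys m :: ('a::euclidean_space \<Rightarrow> real) set)"
  unfolding finite_dim_def polys_eq_span
  by (auto intro!: exI[of _ "monomial ` multi_indices m"] simp: finite_multi_indices)

lemma subspace_polys: "subspace (polys m :: ('a::euclidean_space \<Rightarrow> real) set)"
  using finite_dim_polys by (rule finite_dim_subspace)

lemma polys_induct [consumes 1, case_names zero add]:
  assumes "p \<in> polys m" "P 0"
    and "\<And>\<alpha> c q. \<alpha> \<in> multi_indices m \<Longrightarrow> q \<in> polys m \<Longrightarrow> P q \<Longrightarrow> P (c *\<^sub>R monomial \<alpha> + q)"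
  shows "P p"
proof -
  have "p \<in> span (monomial ` multi_indices m)" using assms(1) by (simp add: polys_eq_span)
  then have "p \<in> polys m \<and> P p"
  proof (induction rule: span_induct_alt)
    case base
    then show ?case using assms(2) by (simp add: subspace_0 subspace_polys)
  next
    case (step c x y)
    then obtain \<alpha> where \<alpha>: "\<alpha> \<in> multi_indices m" "x = monomial \<alpha>" by blast
    then have "x \<in> polys m" unfolding polys_eq_span by (intro span_base) simp
    then show ?case
      using step assms(3)[OF \<alpha>(1), of y c] \<alpha>(2) by (simp add: subspace_comb subspace_polys)
  qed
  then show ?thesis ..
qed

lemma multi_indices_mono: "m \<le> n \<Longrightarrow> multi_indices m \<subseteq> multi_indices n"
  unfolding multi_indices_def by (force simp: PiE_iff)

lemma polys_mono: "m \<le> n \<Longrightarrow> polys m \<subseteq> polys n"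
  unfolding polys_eq_span by (intro span_mono image_mono multi_indices_mono)

lemma const_in_polys: "(\<lambda>_. c) \<in> polys m"
proof -
  \<comment> \<open>Multi-indices are extensional functions, so the zero index must be
    \<open>undefined\<close> off \<open>Basis\<close>.\<close>
  define z where "z = (\<lambda>i::'a. if i \<in> Basis then (0::nat) else undefined)"
  have "z \<in> multi_indices m" by (auto simp: z_def multi_indices_def)
  then have "c *\<^sub>R monomial z \<in> polys m"
    unfolding polys_eq_span by (intro span_scale span_base imageI)
  moreover have "c *\<^sub>R monomial z = (\<lambda>_. c)"
    by (simp add: fun_eq_iff monomial_def z_def fun_apply)
  ultimately show ?thesis by simp
qed

lemma real_polynomial_function_polys: "p \<in> polys m \<Longrightarrow> real_polynomial_function p"
proof (induction rule: polys_induct)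
  case zero
  then show ?case by (simp add: zero_fun_def real_polynomial_function.intros(2))
next
  case (add \<alpha> c q)
  have "real_polynomial_function (\<lambda>x. c * (\<Prod>i\<in>Basis. (x \<bullet> i) ^ \<alpha> i) + q x)"
    using add by (intro real_polynomial_function.intros(2-4)
        real_polynomial_function_prod real_polynomial_function_power
        real_polynomial_function.intros(1)[OF bounded_linear_inner_left]) auto
  then show ?case by (simp add: plus_fun_def scaleR_fun_def monomial_def)
qed

lemma continuous_on_polys: "p \<in> polys m \<Longrightarrow> continuous_on S p"
  using continuous_on_polymonial_function real_polynomial_function_eq real_polynomial_function_polys
  by blast

lemma differentiable_polys: "p \<in> polys m \<Longrightarrow> p differentiable (at x)"
  by (simp add: real_polynomial_function_polys differentiable_at_real_polynomial_function)

lemma real_polynomial_function_vanishing: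
  fixes q :: "real \<Rightarrow> real"
  assumes q: "real_polynomial_function q" and inf: "infinite {t. q t = 0}"
  shows "q t = 0"
proof -
  obtain a n where a: "q = (\<lambda>x. \<Sum>i\<le>n. a i * x ^ i)"
    using real_polynomial_function_imp_sum[OF q] by blast
  then have "\<forall>i\<le>n. a i = 0"
    using inf polyfun_rootbound[of n a] by auto
  then show ?thesis by (simp add: a)
qed

text \<open>Along the line from a point of \<open>T\<close> to an arbitrary \<open>y\<close>, the
  polynomial becomes univariate and vanishes near parameter 0, hence identically; its value at
  parameter 1 is \<open>p y\<close>.\<close>

lemma polys_vanishing:
  fixes p :: "'a::euclidean_space \<Rightarrow> real"
  assumes p: "p \<in> polys m" and T: "open T" "T \<noteq> {}" and 0: "\<And>x. x \<in> T \<Longrightarrow> p x = 0"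
  shows "p = 0"
proof
  fix y
  obtain x where x: "x \<in> T" using T by auto
  define g where "g t = x + t *\<^sub>R (y - x)" for t :: real
  have "polynomial_function g"
    unfolding g_def
    by (intro polynomial_function_add polynomial_function_const polynomial_function_bounded_linear
        bounded_linear_scaleR_left)
  then have q: "real_polynomial_function (\<lambda>t. p (g t))"
    using real_polynomial_function_compose[OF _ real_polynomial_function_polys[OF p]]
    by (simp add: o_def)
  have "open (g -` T)"
    using T(1) unfolding g_def by (intro open_vimage continuous_intros)
  moreover have "0 \<in> g -` T" using x by (simp add: g_def)
  ultimately have "infinite (g -` T)"
    using not_open_singleton finite_imp_not_open[of "g -` T"] by auto
  then have "infinite {t. p (g t) = 0}"
    using 0 by (auto elim!: infinite_super[rotated])
  then have "p (g 1) = 0" by (rule real_polynomial_function_vanishing[OF q])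
  then show "p y = 0 y" by (simp add: g_def fun_apply)
qed

section \<open>Partial derivatives, gradient and Laplacian of polynomials\<close>

definition partial :: "'a::euclidean_space \<Rightarrow> ('a \<Rightarrow> real) \<Rightarrow> 'a \<Rightarrow> real" where
  "partial i f x = frechet_derivative f (at x) i"

lemma partial_eqI: "(f has_derivative f') (at x) \<Longrightarrow> partial i f x = f' i"
  by (metis frechet_derivative_at partial_def)

lemma partial_comb:
  assumes "f differentiable (at x)" "g differentiable (at x)"
  shows "partial i (c *\<^sub>R f + g) x = c * partial i f x + partial i g x"
proof -
  have "((\<lambda>x. c *\<^sub>R f x + g x) has_derivative
      (\<lambda>h. c *\<^sub>R frechet_derivative f (at x) h + frechet_derivative g (at x) h)) (at x)"
    using assms by (intro derivative_intros) (simp_all add: frechet_derivative_works[symmetric])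
  then show ?thesis
    by (simp add: partial_eqI partial_def[of i f] partial_def[of i g] plus_fun_def scaleR_fun_def)
qed

lemma has_real_derivative_partial:
  assumes "f differentiable (at (x + s *\<^sub>R i))"
  shows "((\<lambda>s. f (x + s *\<^sub>R i)) has_real_derivative partial i f (x + s *\<^sub>R i)) (at s)"
proof -
  let ?f' = "frechet_derivative f (at (x + s *\<^sub>R i))"
  have f': "(f has_derivative ?f') (at (x + s *\<^sub>R i))"
    using assms by (simp add: frechet_derivative_works)
  have "((\<lambda>s. x + s *\<^sub>R i) has_derivative (\<lambda>h. h *\<^sub>R i)) (at s)"
    by (auto intro!: derivative_eq_intros)
  from has_derivative_compose[OF this f']
  have "((\<lambda>s. f (x + s *\<^sub>R i)) has_derivative (\<lambda>h. ?f' (h *\<^sub>R i))) (at s)" .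
  moreover have "?f' (h *\<^sub>R i) = partial i f (x + s *\<^sub>R i) * h" for h
    using linear_cmul[OF has_derivative_linear[OF f'], of h i] by (simp add: partial_def)
  ultimately show ?thesis by (simp add: has_field_derivative_def)
qed

text \<open>For \<open>\<alpha> i = 0\<close> the subtraction in the exponent is truncated, but then
  the factor \<open>real (\<alpha> i)\<close> vanishes.\<close>

lemma partial_monomial:
  assumes i: "i \<in> Basis"
  shows "partial i (monomial \<alpha>) x = real (\<alpha> i) * monomial (\<alpha>(i := \<alpha> i - 1)) x"
proof -
  have split: "monomial \<beta> y = (y \<bullet> i) ^ \<beta> i * (\<Prod>j\<in>Basis - {i}. (y \<bullet> j) ^ \<beta> j)" for \<beta> y
    unfolding monomial_def by (rule prod.remove) (use i in auto)
  have "monomial \<alpha> (x + s *\<^sub>R i) = (x \<bullet> i + s) ^ \<alpha> i * (\<Prod>j\<in>Basis - {i}. (x \<bullet> j) ^ \<alpha> j)" for s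
  proof -
    have "(\<Prod>j\<in>Basis - {i}. ((x + s *\<^sub>R i) \<bullet> j) ^ \<alpha> j) = (\<Prod>j\<in>Basis - {i}. (x \<bullet> j) ^ \<alpha> j)"
      using i by (intro prod.cong) (auto simp: inner_add_left inner_Basis)
    then show ?thesis using i by (simp add: split inner_add_left)
  qed
  then have "((\<lambda>s. monomial \<alpha> (x + s *\<^sub>R i)) has_real_derivative
      real (\<alpha> i) * (x \<bullet> i) ^ (\<alpha> i - 1) * (\<Prod>j\<in>Basis - {i}. (x \<bullet> j) ^ \<alpha> j)) (at 0)"
    by (auto intro!: derivative_eq_intros)
  moreover have "monomial \<alpha> differentiable (at (x + 0 *\<^sub>R i))"
    unfolding monomial_def
    by (intro differentiable_at_real_polynomial_function real_polynomial_function_prod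
        real_polynomial_function_power real_polynomial_function.intros(1)[OF bounded_linear_inner_left]) auto
  ultimately have "partial i (monomial \<alpha>) (x + 0 *\<^sub>R i) =
      real (\<alpha> i) * (x \<bullet> i) ^ (\<alpha> i - 1) * (\<Prod>j\<in>Basis - {i}. (x \<bullet> j) ^ \<alpha> j)"
    using DERIV_unique has_real_derivative_partial by blast
  also have "(\<Prod>j\<in>Basis - {i}. (x \<bullet> j) ^ \<alpha> j) = (\<Prod>j\<in>Basis - {i}. (x \<bullet> j) ^ (\<alpha>(i := \<alpha> i - 1)) j)"
    by (intro prod.cong) auto
  finally show ?thesis by (simp add: split[of _ x] mult.assoc del: fun_upd_apply) simp
qed

lemma multi_indices_decrement:
  assumes \<alpha>: "\<alpha> \<in> multi_indices (Suc m)" and i: "i \<in> Basis" "\<alpha> i \<noteq> 0"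
  shows "\<alpha>(i := \<alpha> i - 1) \<in> multi_indices m"
proof -
  have E: "\<alpha> \<in> extensional Basis" and s: "(\<Sum>j\<in>Basis. \<alpha> j) \<le> Suc m"
    using \<alpha> by (auto simp: multi_indices_def PiE_def)
  let ?\<beta> = "\<alpha>(i := \<alpha> i - 1)"
  have "(\<Sum>j\<in>Basis. \<alpha> j) = \<alpha> i + (\<Sum>j\<in>Basis - {i}. \<alpha> j)"
    by (rule sum.remove) (use i in auto)
  moreover have "(\<Sum>j\<in>Basis. ?\<beta> j) = (\<alpha> i - 1) + (\<Sum>j\<in>Basis - {i}. \<alpha> j)"
    by (subst sum.remove[of _ i]) (use i in \<open>auto intro!: sum.cong\<close>)
  ultimately have le: "(\<Sum>j\<in>Basis. ?\<beta> j) \<le> m" using s i by simp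
  moreover have "?\<beta> j \<le> m" if "j \<in> Basis" for j
    using member_le_sum[of j Basis ?\<beta>] that le by (simp del: fun_upd_apply)
  ultimately show ?thesis
    using E i by (auto simp: multi_indices_def PiE_iff extensional_def simp del: fun_upd_apply)
      (auto simp: extensional_def)
qed

lemma partial_in_polys: "p \<in> polys (Suc m) \<Longrightarrow> i \<in> Basis \<Longrightarrow> partial i p \<in> polys m"
proof (induction rule: polys_induct)
  case zero
  have "partial i (\<lambda>_. 0::real) = (\<lambda>_. 0)"
    by (rule ext, rule partial_eqI) (auto intro!: derivative_eq_intros)
  then show ?case by (simp add: zero_fun_def const_in_polys)
next
  case (add \<alpha> c q)
  have "monomial \<alpha> \<in> polys (Suc m)"
    unfolding polys_eq_span using add by (intro span_base imageI)
  then have "partial i (c *\<^sub>R monomial \<alpha> + q) = c *\<^sub>R partial i (monomial \<alpha>) + partial i q"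
    using add(2) by (intro ext) (simp add: fun_apply partial_comb differentiable_polys)
  moreover have "partial i (monomial \<alpha>) \<in> polys m"
  \<comment> \<open>If \<open>\<alpha> i = 0\<close>, the truncated decrement returns
    \<open>\<alpha>\<close> itself, possibly of degree \<open>Suc m\<close>; here the derivative is
    zero.\<close>
  proof (cases "\<alpha> i = 0")
    case True
    then have "partial i (monomial \<alpha>) = 0"
      using add by (auto simp: partial_monomial fun_eq_iff fun_apply)
    then show ?thesis by (simp add: subspace_0 subspace_polys)
  next
    case False
    then have "real (\<alpha> i) *\<^sub>R monomial (\<alpha>(i := \<alpha> i - 1)) \<in> polys m"
      unfolding polys_eq_span
      using multi_indices_decrement[OF add(1) add(4)] by (intro span_scale span_base imageI)
    moreover have "partial i (monomial \<alpha>) = real (\<alpha> i) *\<^sub>R monomial (\<alpha>(i := \<alpha> i - 1))"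
      using add(4) by (intro ext) (simp add: fun_apply partial_monomial del: fun_upd_apply)
    ultimately show ?thesis by simp
  qed
  ultimately show ?case
    using add by (simp add: subspace_comb subspace_polys)
qed

lemma grad_eq: "grad f x = (\<Sum>i\<in>Basis. partial i f x *\<^sub>R i)"
  by (simp add: grad_def partial_def)

lemma laplacian_eq: "laplacian f x = (\<Sum>i\<in>Basis. partial i (partial i f) x)"
  by (simp add: laplacian_def partial_def[abs_def])

lemma inner_grad: "grad f x \<bullet> n = (\<Sum>i\<in>Basis. partial i f x * (n \<bullet> i))"
  by (simp add: grad_eq inner_sum_left inner_commute[of n])

lemma inner_grad_grad: "grad f x \<bullet> grad g x = (\<Sum>i\<in>Basis. partial i f x * partial i g x)"
  unfolding inner_grad by (intro sum.cong) (simp_all add: grad_eq inner_sum_left inner_Basis if_distrib cong: if_cong)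

lemma sum_in_polys:
  "(\<And>i. i \<in> I \<Longrightarrow> f i \<in> polys m) \<Longrightarrow> (\<lambda>x. \<Sum>i\<in>I. f i x * c i) \<in> polys m"
proof (induction I rule: infinite_finite_induct)
  case (insert j I)
  then have "c j *\<^sub>R f j + (\<lambda>x. \<Sum>i\<in>I. f i x * c i) \<in> polys m"
    by (intro subspace_comb subspace_polys) auto
  then show ?case using insert by (simp add: plus_fun_def scaleR_fun_def mult.commute)
qed (simp_all add: const_in_polys)

lemma normal_derivative_in_polys: "p \<in> polys (Suc m) \<Longrightarrow> (\<lambda>x. grad p x \<bullet> n) \<in> polys m"
  unfolding inner_grad by (intro sum_in_polys partial_in_polys)

lemma partial_in_polys_same: "p \<in> polys m \<Longrightarrow> i \<in> Basis \<Longrightarrow> partial i p \<in> polys m"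
  using partial_in_polys polys_mono by (metis (no_types) le_add2 plus_1_eq_Suc subsetD)

lemma continuous_on_partial: "p \<in> polys m \<Longrightarrow> i \<in> Basis \<Longrightarrow> continuous_on S (partial i p)"
  by (rule continuous_on_polys) (rule partial_in_polys_same)

lemma laplacian_in_polys: "p \<in> polys m \<Longrightarrow> laplacian p \<in> polys m"
  using sum_in_polys[of Basis "\<lambda>i. partial i (partial i p)" m "\<lambda>_. 1"]
  by (simp add: laplacian_eq[abs_def] partial_in_polys_same)

lemma continuous_on_grad: "p \<in> polys m \<Longrightarrow> continuous_on S (grad p)"
  unfolding grad_eq[abs_def] by (intro continuous_intros continuous_on_partial)

lemma linear_map_on_grad:
  "linear_map_on (polys m :: ('a::euclidean_space \<Rightarrow> real) set) {f. continuous_on UNIV f} grad"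
proof -
  have "grad (c *\<^sub>R p + q) = c *\<^sub>R grad p + grad q" if "p \<in> polys m" "q \<in> polys m"
    for p q :: "'a \<Rightarrow> real" and c
    using that by (auto simp: fun_eq_iff fun_apply grad_eq partial_comb differentiable_polys
        scaleR_add_left sum.distrib scaleR_sum_right)
  then show ?thesis by (simp add: linear_map_on_def continuous_on_grad)
qed

lemma linear_map_on_laplacian:
  "linear_map_on (polys m :: ('a::euclidean_space \<Rightarrow> real) set) (polys m) laplacian"
proof -
  have "partial i (partial i (c *\<^sub>R p + q)) = c *\<^sub>R partial i (partial i p) + partial i (partial i q)"
    if "p \<in> polys m" "q \<in> polys m" "i \<in> Basis"
    for p q :: "'a \<Rightarrow> real" and c i
  proof -
    have "partial i (c *\<^sub>R p + q) = c *\<^sub>R partial i p + partial i q"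
      using that by (intro ext) (simp add: fun_apply partial_comb differentiable_polys)
    then show ?thesis
      using that
      by (intro ext) (simp add: partial_comb differentiable_polys[OF partial_in_polys_same] fun_apply)
  qed
  then have "laplacian (c *\<^sub>R p + q) = c *\<^sub>R laplacian p + laplacian q"
    if "p \<in> polys m" "q \<in> polys m"
    for p q :: "'a \<Rightarrow> real" and c
    using that by (simp add: fun_eq_iff fun_apply laplacian_eq sum.distrib sum_distrib_left)
  then show ?thesis by (simp add: linear_map_on_def laplacian_in_polys)
qed

text \<open>The partial derivatives are polynomials vanishing on \<open>T\<close>, hence everywhere.
  Constancy then follows on the whole space, which also covers elements with several
  components.\<close>

lemma polys_constant:
  fixes p :: "'a::euclidean_space \<Rightarrow> real"
  assumes p: "p \<in> polys m" and T: "open T" "T \<noteq> {}" and 0: "\<And>x. x \<in> T \<Longrightarrow> grad p x = 0"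
  shows "\<exists>c. p = (\<lambda>_. c)"
proof -
  have part: "partial i p = 0" if i: "i \<in> Basis" for i
  proof (rule polys_vanishing[OF partial_in_polys_same[OF p i] T])
    fix x assume "x \<in> T"
    have "grad p x \<bullet> i = partial i p x"
      using i by (simp add: grad_eq inner_sum_left inner_Basis if_distrib cong: if_cong)
    then show "partial i p x = 0" using 0[OF \<open>x \<in> T\<close>] by (simp add: fun_apply)
  qed
  have "(p has_derivative (\<lambda>h. 0)) (at x within UNIV)" for x
  proof -
    have d: "(p has_derivative frechet_derivative p (at x)) (at x)"
      using differentiable_polys[OF p] by (simp add: frechet_derivative_works)
    have "frechet_derivative p (at x) h = 0" for h
    proof -
      interpret linear "frechet_derivative p (at x)" using d by (rule has_derivative_linear)
      have "frechet_derivative p (at x) (\<Sum>i\<in>Basis. (h \<bullet> i) *\<^sub>R i) = 0"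
        using part by (simp only: sum scale) (simp add: partial_def[symmetric] fun_apply)
      then show ?thesis by (simp add: euclidean_representation)
    qed
    then show ?thesis using d by (metis ext)
  qed
  then have "\<exists>c. \<forall>x\<in>UNIV. p x = c"
    by (intro has_derivative_zero_constant) auto
  then show ?thesis by auto
qed

section \<open>Polynomials on faces\<close>

lemma subspace_polys_on: "subspace (polys_on m F)"
  and finite_dim_polys_on: "finite_dim (polys_on m F)"
proof -
  define R where "R f = (\<lambda>x::'a. if x \<in> F then f x else (0::real))" for f
  have "polys_on m F = R ` polys m" by (auto simp: polys_on_def R_def)
  moreover have "linear R" by (auto intro!: linearI simp: R_def fun_eq_iff fun_apply)
  ultimately show "finite_dim (polys_on m F)" by (simp add: finite_dim_image finite_dim_polys)
  then show "subspace (polys_on m F)" by (rule finite_dim_subspace)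
qed

lemma restriction_in_polys_on: "p \<in> polys m \<Longrightarrow> (\<lambda>x. if x \<in> F then p x else 0) \<in> polys_on m F"
  by (auto simp: polys_on_def)

section \<open>Integration along parallel lines\<close>

lemma nn_integral_lborel_translate:
  fixes f :: "'a::euclidean_space \<Rightarrow> ennreal"
  assumes [measurable]: "f \<in> borel_measurable borel"
  shows "(\<integral>\<^sup>+x. f (x + c) \<partial>lborel) = (\<integral>\<^sup>+x. f x \<partial>lborel)"
  using nn_integral_distr[of "(+) c" lborel borel f] by (simp add: lborel_distr_plus add.commute)

lemma nn_integral_reflect_translate:
  fixes f :: "real \<Rightarrow> ennreal"
  assumes [measurable]: "f \<in> borel_measurable borel"
  shows "(\<integral>\<^sup>+s. f (c - s) \<partial>lborel) = (\<integral>\<^sup>+s. f s \<partial>lborel)"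
  using nn_integral_real_affine[of f "-1" c] by simp

text \<open>Tonelli exchanges the integrals, the inner one is translated by
  \<open>s *\<^sub>R e\<close> for fixed \<open>s\<close>, and Tonelli exchanges them back.\<close>

lemma nn_integral_shift_along_line:
  fixes G :: "'a::euclidean_space \<Rightarrow> real \<Rightarrow> ennreal"
  assumes [measurable]: "(\<lambda>(x, s). G x s) \<in> borel_measurable borel"
  shows "(\<integral>\<^sup>+x. \<integral>\<^sup>+s. G x s \<partial>lborel \<partial>lborel) = (\<integral>\<^sup>+y. \<integral>\<^sup>+s. G (y - s *\<^sub>R e) s \<partial>lborel \<partial>lborel)"
proof -
  have G: "(\<lambda>(x, s). G x s) \<in> borel_measurable (borel \<Otimes>\<^sub>M borel)"
    using assms by (simp add: borel_prod)
  have sec: "(\<lambda>x. G x s) \<in> borel_measurable borel" for s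
    using measurable_compose[OF _ G, of "\<lambda>x. (x, s)" borel] by simp
  have [measurable]: "(\<lambda>(y, s). G (y - s *\<^sub>R e) s) \<in> borel_measurable (lborel \<Otimes>\<^sub>M lborel)"
  proof -
    have "(\<lambda>(y, s). (y - s *\<^sub>R e, s)) \<in> borel_measurable (borel :: ('a \<times> real) measure)"
      by (intro borel_measurable_continuous_onI) (auto simp: case_prod_beta intro!: continuous_intros)
    from measurable_compose[OF this assms] show ?thesis
      by (simp add: case_prod_beta lborel_prod)
  qed
  have "(\<integral>\<^sup>+x. \<integral>\<^sup>+s. G x s \<partial>lborel \<partial>lborel) = (\<integral>\<^sup>+s. \<integral>\<^sup>+x. G x s \<partial>lborel \<partial>lborel)"
    using lborel_pair.Fubini'[of G] G by simp
  also have "\<dots> = (\<integral>\<^sup>+s. \<integral>\<^sup>+y. G (y - s *\<^sub>R e) s \<partial>lborel \<partial>lborel)"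
  proof (rule nn_integral_cong)
    fix s
    show "(\<integral>\<^sup>+x. G x s \<partial>lborel) = (\<integral>\<^sup>+y. G (y - s *\<^sub>R e) s \<partial>lborel)"
      using nn_integral_lborel_translate[of "\<lambda>x. G x s" "- (s *\<^sub>R e)"] sec by simp
  qed
  also have "\<dots> = (\<integral>\<^sup>+y. \<integral>\<^sup>+s. G (y - s *\<^sub>R e) s \<partial>lborel \<partial>lborel)"
    by (rule lborel_pair.Fubini') simp
  finally show ?thesis .
qed

text \<open>Along the line, \<open>a \<bullet> (x + s *\<^sub>R e)\<close> is affine in
  \<open>s\<close> with slope \<open>a \<bullet> e\<close>. The free offset \<open>lo\<close> covers
  both the slab over \<open>{0..1}\<close> and the one centred at a hyperplane.\<close>

lemma nn_integral_slab_line: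
  fixes a e x :: "'a::euclidean_space"
  assumes "a \<bullet> e \<noteq> 0"
  shows "(\<integral>\<^sup>+s. indicator {lo..lo + 1} (a \<bullet> (x + s *\<^sub>R e)) \<partial>lborel) = ennreal (1 / \<bar>a \<bullet> e\<bar>)"
proof -
  let ?X = "\<integral>\<^sup>+s. indicator {lo..lo + 1} (a \<bullet> x + (a \<bullet> e) * s) \<partial>lborel"
  have "ennreal \<bar>a \<bullet> e\<bar> * ?X = (\<integral>\<^sup>+s. indicator {lo..lo + 1} s \<partial>lborel)"
    by (rule nn_integral_real_affine[symmetric]) (use assms in simp_all)
  also have "\<dots> = 1" by simp
  finally have "ennreal (1 / \<bar>a \<bullet> e\<bar>) * (ennreal \<bar>a \<bullet> e\<bar> * ?X) = ennreal (1 / \<bar>a \<bullet> e\<bar>)" by simp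
  moreover have "ennreal (1 / \<bar>a \<bullet> e\<bar>) * (ennreal \<bar>a \<bullet> e\<bar> * ?X) = ?X"
    using assms by (simp add: mult.assoc[symmetric] ennreal_mult[symmetric])
  ultimately show ?thesis by (simp add: inner_add_right mult.commute)
qed

text \<open>Different cross sections of one family of parallel lines can be exchanged: insert the
  line integral of \<open>w2\<close>, shift along the line until \<open>w2\<close> sits at the base
  point, and evaluate the line integral of \<open>w1\<close>.\<close>

lemma nn_integral_line_invariant:
  fixes w1 w2 h :: "'a::euclidean_space \<Rightarrow> ennreal"
  assumes [measurable]: "w1 \<in> borel_measurable borel" "w2 \<in> borel_measurable borel"
      "h \<in> borel_measurable borel"
    and h: "\<And>x s. h (x + s *\<^sub>R e) = h x"
    and w1: "\<And>x. (\<integral>\<^sup>+s. w1 (x + s *\<^sub>R e) \<partial>lborel) = c1"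
    and w2: "\<And>x. (\<integral>\<^sup>+s. w2 (x + s *\<^sub>R e) \<partial>lborel) = c2"
  shows "c2 * (\<integral>\<^sup>+x. w1 x * h x \<partial>lborel) = c1 * (\<integral>\<^sup>+x. w2 x * h x \<partial>lborel)"
proof -
  have [measurable]: "(\<lambda>(x, s). x + s *\<^sub>R e) \<in> borel_measurable (borel :: ('a \<times> real) measure)"
    by (intro borel_measurable_continuous_onI) (auto simp: case_prod_beta intro!: continuous_intros)
  have [measurable]: "(\<lambda>s. x + s *\<^sub>R e) \<in> borel_measurable borel" for x
    by (intro borel_measurable_continuous_onI) (auto intro!: continuous_intros)
  have m: "(\<lambda>(x, s). w1 x * h x * w2 (x + s *\<^sub>R e)) \<in> borel_measurable borel"
    unfolding borel_prod[symmetric] by measurable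
  have "c2 * (\<integral>\<^sup>+x. w1 x * h x \<partial>lborel) = (\<integral>\<^sup>+x. \<integral>\<^sup>+s. w1 x * h x * w2 (x + s *\<^sub>R e) \<partial>lborel \<partial>lborel)"
    by (simp add: nn_integral_cmult nn_integral_multc w2 mult.commute)
  also have "\<dots> = (\<integral>\<^sup>+y. \<integral>\<^sup>+s. w1 (y - s *\<^sub>R e) * h (y - s *\<^sub>R e) * w2 y \<partial>lborel \<partial>lborel)"
    using nn_integral_shift_along_line[OF m, of e] by simp
  also have "\<dots> = (\<integral>\<^sup>+y. w2 y * h y * (\<integral>\<^sup>+s. w1 (y - s *\<^sub>R e) \<partial>lborel) \<partial>lborel)"
  proof (rule nn_integral_cong)
    fix y
    have "h (y - s *\<^sub>R e) = h y" for s using h[of y "-s"] by simp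
    moreover have "(\<lambda>s. w1 (y - s *\<^sub>R e)) \<in> borel_measurable lborel"
      by (rule measurable_compose[of _ _ borel])
        (auto intro!: borel_measurable_continuous_onI continuous_intros)
    ultimately show "(\<integral>\<^sup>+s. w1 (y - s *\<^sub>R e) * h (y - s *\<^sub>R e) * w2 y \<partial>lborel)
        = w2 y * h y * (\<integral>\<^sup>+s. w1 (y - s *\<^sub>R e) \<partial>lborel)"
      by (simp add: nn_integral_cmult[symmetric] mult_ac)
  qed
  also have "\<dots> = (\<integral>\<^sup>+y. w2 y * h y * c1 \<partial>lborel)"
  proof (rule nn_integral_cong)
    fix y
    have "(\<integral>\<^sup>+s. w1 (y - s *\<^sub>R e) \<partial>lborel) = c1"
      using nn_integral_reflect_translate[of "\<lambda>s. w1 (y + s *\<^sub>R e)" 0] w1[of y] by simp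
    then show "w2 y * h y * (\<integral>\<^sup>+s. w1 (y - s *\<^sub>R e) \<partial>lborel) = w2 y * h y * c1" by simp
  qed
  also have "\<dots> = c1 * (\<integral>\<^sup>+y. w2 y * h y \<partial>lborel)"
    by (subst nn_integral_multc) (simp_all add: mult.commute)
  finally show ?thesis .
qed

text \<open>The slab meets every line in direction \<open>e\<close> in length one, so averaging over
  base points in the slab counts each line once. This is Fubini along \<open>e\<close> without
  moving \<open>e\<close> to a coordinate axis.\<close>

lemma nn_integral_slab_lines:
  fixes f :: "'a::euclidean_space \<Rightarrow> ennreal"
  assumes [measurable]: "f \<in> borel_measurable borel" and e: "norm e = 1"
  shows "(\<integral>\<^sup>+x. indicator {0..1} (e \<bullet> x) * (\<integral>\<^sup>+s. f (x + s *\<^sub>R e) \<partial>lborel) \<partial>lborel) = (\<integral>\<^sup>+x. f x \<partial>lborel)"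
proof -
  have [measurable]: "(\<lambda>(x, s). x + s *\<^sub>R e) \<in> borel_measurable (borel :: ('a \<times> real) measure)"
    by (intro borel_measurable_continuous_onI) (auto simp: case_prod_beta intro!: continuous_intros)
  have [measurable]: "(\<lambda>s. x + s *\<^sub>R e) \<in> borel_measurable borel" for x
    by (intro borel_measurable_continuous_onI) (auto intro!: continuous_intros)
  have m: "(\<lambda>(x, s). indicator {0..1} (e \<bullet> x) * f (x + s *\<^sub>R e)) \<in> borel_measurable borel"
    unfolding borel_prod[symmetric] by measurable
  have "(\<integral>\<^sup>+x. indicator {0..1} (e \<bullet> x) * (\<integral>\<^sup>+s. f (x + s *\<^sub>R e) \<partial>lborel) \<partial>lborel)
      = (\<integral>\<^sup>+x. \<integral>\<^sup>+s. indicator {0..1} (e \<bullet> x) * f (x + s *\<^sub>R e) \<partial>lborel \<partial>lborel)"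
    by (simp add: nn_integral_cmult)
  also have "\<dots> = (\<integral>\<^sup>+y. \<integral>\<^sup>+s. indicator {0..1} (e \<bullet> (y - s *\<^sub>R e)) * f y \<partial>lborel \<partial>lborel)"
    using nn_integral_shift_along_line[OF m, of e] by simp
  also have "\<dots> = (\<integral>\<^sup>+y. f y \<partial>lborel)"
  proof (rule nn_integral_cong)
    fix y
    have ee: "e \<bullet> (- e) = -1" using e by (simp add: dot_square_norm)
    have "(\<integral>\<^sup>+s. indicator {0..0 + 1} (e \<bullet> (y + s *\<^sub>R (- e))) \<partial>lborel) = ennreal (1 / \<bar>e \<bullet> (- e)\<bar>)"
      by (rule nn_integral_slab_line) (use e in \<open>simp add: dot_square_norm\<close>)
    then have "(\<integral>\<^sup>+s. indicator {0..1} (e \<bullet> (y - s *\<^sub>R e)) \<partial>lborel) = (1::ennreal)"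
      unfolding ee by simp
    moreover have "(\<lambda>s. indicator {0..1} (e \<bullet> (y - s *\<^sub>R e)) :: ennreal) \<in> borel_measurable lborel"
      by measurable
    ultimately show "(\<integral>\<^sup>+s. indicator {0..1} (e \<bullet> (y - s *\<^sub>R e)) * f y \<partial>lborel) = f y"
      by (simp add: nn_integral_multc)
  qed
  finally show ?thesis .
qed

text \<open>The shear \<open>x \<mapsto> x + (n \<bullet> x - b) v\<close> moves every line parallel to \<open>v\<close> along itself, by a
  constant amount.\<close>

lemma nn_integral_shear:
  fixes f :: "'a::euclidean_space \<Rightarrow> ennreal"
  assumes f [measurable]: "f \<in> borel_measurable borel" and nv: "n \<bullet> v = 0"
  shows "(\<integral>\<^sup>+x. f (x + (n \<bullet> x - b) *\<^sub>R v) \<partial>lborel) = (\<integral>\<^sup>+x. f x \<partial>lborel)"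
proof (cases "v = 0")
  case False
  define e where "e = v /\<^sub>R norm v"
  define r where "r x = (n \<bullet> x - b) * norm v" for x
  have e: "norm e = 1" and ne: "n \<bullet> e = 0" using False nv by (simp_all add: e_def)
  have r: "r (x + s *\<^sub>R e) = r x" for x s by (simp add: r_def inner_add_right ne)
  have v: "(n \<bullet> x - b) *\<^sub>R v = r x *\<^sub>R e" for x using False by (simp add: r_def e_def)
  have [measurable]: "r \<in> borel_measurable borel" unfolding r_def by measurable
  have S [measurable]: "(\<lambda>x. f (x + r x *\<^sub>R e)) \<in> borel_measurable borel" by measurable
  have "(\<integral>\<^sup>+x. f (x + r x *\<^sub>R e) \<partial>lborel)
      = (\<integral>\<^sup>+x. indicator {0..1} (e \<bullet> x) * (\<integral>\<^sup>+s. f (x + s *\<^sub>R e + r x *\<^sub>R e) \<partial>lborel) \<partial>lborel)"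
    using nn_integral_slab_lines[OF S e] by (simp add: r)
  also have "\<dots> = (\<integral>\<^sup>+x. indicator {0..1} (e \<bullet> x) * (\<integral>\<^sup>+s. f (x + s *\<^sub>R e) \<partial>lborel) \<partial>lborel)"
  proof (rule nn_integral_cong)
    fix x
    have [measurable]: "(\<lambda>s. f (x + s *\<^sub>R e)) \<in> borel_measurable borel"
      by (rule measurable_compose[OF _ f])
        (auto intro!: borel_measurable_continuous_onI continuous_intros)
    have "(\<integral>\<^sup>+s. f (x + (s + r x) *\<^sub>R e) \<partial>lborel) = (\<integral>\<^sup>+s. f (x + s *\<^sub>R e) \<partial>lborel)"
      by (rule nn_integral_lborel_translate[where f = "\<lambda>s. f (x + s *\<^sub>R e)"]) measurable
    then show "indicator {0..1} (e \<bullet> x) * (\<integral>\<^sup>+s. f (x + s *\<^sub>R e + r x *\<^sub>R e) \<partial>lborel)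
        = indicator {0..1} (e \<bullet> x) * (\<integral>\<^sup>+s. f (x + s *\<^sub>R e) \<partial>lborel)"
      by (simp add: scaleR_add_left add.assoc)
  qed
  also have "\<dots> = (\<integral>\<^sup>+x. f x \<partial>lborel)"
    by (rule nn_integral_slab_lines[OF f e])
  finally show ?thesis by (simp add: v)
qed simp

text \<open>For a unit vector \<open>e\<close>, this stands in for the measure on the set of lines
  parallel to \<open>e\<close>, each line being represented by its segment in the slab.\<close>

definition slab_measure :: "'a::euclidean_space \<Rightarrow> 'a measure" where
  "slab_measure e = restrict_space lborel {x. e \<bullet> x \<in> {0..1}}"

text \<open>The point where the line through \<open>x\<close> in direction \<open>e\<close> meets
  the hyperplane \<open>{z. n \<bullet> z = b}\<close>; for \<open>e = n\<close> it is the
  orthogonal projection.\<close>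

definition oblique_proj :: "'a::euclidean_space \<Rightarrow> real \<Rightarrow> 'a \<Rightarrow> 'a \<Rightarrow> 'a" where
  "oblique_proj n b e x = x - ((n \<bullet> x - b) / (n \<bullet> e)) *\<^sub>R e"

lemma measurable_oblique_proj [measurable]: "oblique_proj n b e \<in> borel_measurable borel"
  unfolding oblique_proj_def[abs_def] by measurable

lemma oblique_proj_invariant: "n \<bullet> e \<noteq> 0 \<Longrightarrow> oblique_proj n b e (x + s *\<^sub>R e) = oblique_proj n b e x"
  by (simp add: oblique_proj_def inner_add_right add_divide_distrib diff_divide_distrib scaleR_add_left
      scaleR_diff_left)

lemma oblique_proj_in_hyperplane: "n \<bullet> e \<noteq> 0 \<Longrightarrow> n \<bullet> oblique_proj n b e x = b"
  by (simp add: oblique_proj_def inner_diff_right)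

lemma slab_measurable [measurable]: "{x. e \<bullet> x \<in> {0..1}} \<in> sets (borel :: 'a::euclidean_space measure)"
  by measurable

lemma sets_slab_measure: "(\<lambda>x. f x) \<in> borel_measurable borel \<Longrightarrow> f \<in> borel_measurable (slab_measure e)"
  by (simp add: slab_measure_def measurable_restrict_space1)

lemma nn_integral_slab_measure:
  "f \<in> borel_measurable borel \<Longrightarrow>
    (\<integral>\<^sup>+x. f x \<partial>slab_measure e) = (\<integral>\<^sup>+x. indicator {0..1} (e \<bullet> x) * f x \<partial>lborel)"
  unfolding slab_measure_def
  by (subst nn_integral_restrict_space)
    (auto simp: indicator_def mult.commute intro!: nn_integral_cong)

lemma AE_slab_measure: "AE x in lborel. P x \<Longrightarrow> AE x in slab_measure e. P x"
  unfolding slab_measure_def by (subst AE_restrict_space_iff) auto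

lemma sigma_finite_slab_measure: "sigma_finite_measure (slab_measure e)"
  unfolding slab_measure_def by (rule sigma_finite_measure_restrict_space) (auto intro: lborel.sigma_finite_measure_axioms)

text \<open>Slab weight times a function of the projected point is the shape to which the exchange
  of cross sections applies; the upper end \<open>b - 1/2 + 1\<close> matches
  \<open>nn_integral_slab_line\<close>.\<close>

lemma emeasure_hyperplane_lborel:
  assumes n: "norm n = 1" and A [measurable]: "A \<in> sets borel"
  shows "emeasure (hyperplane_lborel n b) A =
    (\<integral>\<^sup>+x. indicator {b - 1/2..b - 1/2 + 1} (n \<bullet> x) * indicator A (oblique_proj n b n x) \<partial>lborel)"
proof -
  let ?S = "{x. \<bar>n \<bullet> x - b\<bar> \<le> 1/2}"
  have nn: "n \<bullet> n = 1" using n by (simp add: dot_square_norm)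
  have P: "oblique_proj n b n = (\<lambda>x. x - (n \<bullet> x - b) *\<^sub>R n)"
    by (simp add: oblique_proj_def nn fun_eq_iff)
  have S [measurable]: "?S \<in> sets borel" by measurable
  have P': "oblique_proj n b n \<in> measurable (restrict_space lborel ?S) borel"
    by (simp add: measurable_restrict_space1)
  have "emeasure (hyperplane_lborel n b) A = emeasure (restrict_space lborel ?S) (oblique_proj n b n -` A \<inter> ?S)"
    unfolding hyperplane_lborel_def P[symmetric]
    by (subst emeasure_distr[OF P' A]) (simp add: space_restrict_space)
  also have "\<dots> = emeasure lborel (oblique_proj n b n -` A \<inter> ?S)"
    by (rule emeasure_restrict_space) auto
  also have "\<dots> = (\<integral>\<^sup>+x. indicator (oblique_proj n b n -` A \<inter> ?S) x \<partial>lborel)"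
  proof (rule nn_integral_indicator[symmetric])
    have "oblique_proj n b n -` A \<in> sets borel"
      using measurable_sets[OF measurable_oblique_proj A] by simp
    then show "oblique_proj n b n -` A \<inter> ?S \<in> sets lborel" using S by auto
  qed
  also have "\<dots> = (\<integral>\<^sup>+x. indicator {b - 1/2..b - 1/2 + 1} (n \<bullet> x) * indicator A (oblique_proj n b n x) \<partial>lborel)"
  proof -
    have "\<bar>t - b\<bar> \<le> 1/2 \<longleftrightarrow> t \<in> {b - 1/2..b - 1/2 + 1}" for t by (auto simp: abs_if)
    then have "indicator (oblique_proj n b n -` A \<inter> ?S) x =
        (indicator {b - 1/2..b - 1/2 + 1} (n \<bullet> x) * indicator A (oblique_proj n b n x) :: ennreal)" for x
      unfolding indicator_def by (cases "\<bar>n \<bullet> x - b\<bar> \<le> 1/2") (simp_all del: atLeastAtMost_iff)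
    then show ?thesis by (simp only:)
  qed
  finally show ?thesis .
qed

lemma sets_hyperplane_lborel [simp, measurable_cong]: "sets (hyperplane_lborel n b) = sets borel"
  by (simp add: hyperplane_lborel_def)

lemma space_hyperplane_lborel [simp]: "space (hyperplane_lborel n b) = UNIV"
  by (simp add: hyperplane_lborel_def)

text \<open>The shear by \<open>n - e / (n \<bullet> e)\<close> turns the orthogonal projection into the one along \<open>e\<close>;
  passing from the slab of \<open>n\<close> to the slab of \<open>e\<close> then costs the factor \<open>\<bar>n \<bullet> e\<bar>\<close>.\<close>

lemma distr_slab_oblique_proj:
  fixes n e :: "'a::euclidean_space"
  assumes n: "norm n = 1" and e: "norm e = 1" and ne: "n \<bullet> e \<noteq> 0"
  shows "distr (slab_measure e) borel (oblique_proj n b e) = density (hyperplane_lborel n b) (\<lambda>_. ennreal \<bar>n \<bullet> e\<bar>)"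
proof (rule measure_eqI)
  fix A assume "A \<in> sets (distr (slab_measure e) borel (oblique_proj n b e))"
  then have A [measurable]: "A \<in> sets borel" by simp
  have nn: "n \<bullet> n = 1" and ee: "e \<bullet> e = 1" using n e by (simp_all add: dot_square_norm)
  let ?h = "\<lambda>x. indicator A (oblique_proj n b e x) :: ennreal"
  let ?w = "\<lambda>x. indicator {b - 1/2..b - 1/2 + 1} (n \<bullet> x) :: ennreal"
  have h [measurable]: "?h \<in> borel_measurable borel" by measurable
  have P: "oblique_proj n b e \<in> measurable (slab_measure e) borel"
    by (rule sets_slab_measure) measurable
  have "emeasure (distr (slab_measure e) borel (oblique_proj n b e)) A
      = (\<integral>\<^sup>+x. indicator A x \<partial>distr (slab_measure e) borel (oblique_proj n b e))"
    by simp
  also have "\<dots> = (\<integral>\<^sup>+x. ?h x \<partial>slab_measure e)"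
    by (rule nn_integral_distr[OF P]) measurable
  also have "\<dots> = (\<integral>\<^sup>+x. indicator {0..1} (e \<bullet> x) * ?h x \<partial>lborel)"
    by (rule nn_integral_slab_measure) measurable
  also have "\<dots> = ennreal \<bar>n \<bullet> e\<bar> * (\<integral>\<^sup>+x. ?w x * ?h x \<partial>lborel)"
  proof -
    have s1: "(\<integral>\<^sup>+s. indicator {0..0 + 1} (e \<bullet> (x + s *\<^sub>R e)) \<partial>lborel) = ennreal (1 / \<bar>e \<bullet> e\<bar>)" for x
      by (rule nn_integral_slab_line) (simp add: ee)
    have s2: "(\<integral>\<^sup>+s. ?w (x + s *\<^sub>R e) \<partial>lborel) = ennreal (1 / \<bar>n \<bullet> e\<bar>)" for x
      by (rule nn_integral_slab_line) (rule ne)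
    have "ennreal (1 / \<bar>n \<bullet> e\<bar>) * (\<integral>\<^sup>+x. indicator {0..0 + 1} (e \<bullet> x) * ?h x \<partial>lborel)
        = ennreal (1 / \<bar>e \<bullet> e\<bar>) * (\<integral>\<^sup>+x. ?w x * ?h x \<partial>lborel)"
      by (rule nn_integral_line_invariant[OF _ _ h _ s1 s2]) (use ne in \<open>simp_all add: oblique_proj_invariant\<close>)
    then have "ennreal \<bar>n \<bullet> e\<bar> * (ennreal (1 / \<bar>n \<bullet> e\<bar>) * (\<integral>\<^sup>+x. indicator {0..1} (e \<bullet> x) * ?h x \<partial>lborel))
        = ennreal \<bar>n \<bullet> e\<bar> * (\<integral>\<^sup>+x. ?w x * ?h x \<partial>lborel)"
      by (simp add: ee)
    then show ?thesis
      using ne by (simp add: mult.assoc[symmetric] ennreal_mult[symmetric])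
  qed
  also have "(\<integral>\<^sup>+x. ?w x * ?h x \<partial>lborel)
      = (\<integral>\<^sup>+x. ?w x * indicator A (oblique_proj n b n x) \<partial>lborel)"
  proof -
    define v where "v = n - (1 / (n \<bullet> e)) *\<^sub>R e"
    have nv: "n \<bullet> v = 0" using ne by (simp add: v_def inner_diff_right nn)
    have eq: "oblique_proj n b n (x + (n \<bullet> x - b) *\<^sub>R v) = oblique_proj n b e x" for x
      by (simp add: oblique_proj_def nn inner_add_right nv) (simp add: v_def scaleR_diff_right)
    have [measurable]: "(\<lambda>x. ?w x * indicator A (oblique_proj n b n x)) \<in> borel_measurable borel"
      by measurable
    show ?thesis
      using nn_integral_shear[of "\<lambda>x. ?w x * indicator A (oblique_proj n b n x)" n v b]
      by (simp add: nv eq inner_add_right)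
  qed
  also have "\<dots> = emeasure (hyperplane_lborel n b) A"
    by (rule emeasure_hyperplane_lborel[OF n A, symmetric])
  also have "ennreal \<bar>n \<bullet> e\<bar> * \<dots> = emeasure (density (hyperplane_lborel n b) (\<lambda>_. ennreal \<bar>n \<bullet> e\<bar>)) A"
    by (subst emeasure_density) (auto simp: nn_integral_cmult_indicator)
  finally show "emeasure (distr (slab_measure e) borel (oblique_proj n b e)) A
      = emeasure (density (hyperplane_lborel n b) (\<lambda>_. ennreal \<bar>n \<bullet> e\<bar>)) A" .
qed simp

lemma AE_oblique_proj_notin_null:
  assumes n: "norm n = 1" and e: "norm e = 1" and ne: "n \<bullet> e \<noteq> 0"
    and N: "N \<in> null_sets (hyperplane_lborel n b)"
  shows "AE x in lborel. oblique_proj n b e x \<notin> N"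
proof -
  have N' [measurable]: "N \<in> sets borel" using N by (auto simp: null_sets_def)
  have ee: "e \<bullet> e = 1" using e by (simp add: dot_square_norm)
  let ?h = "\<lambda>x. indicator N (oblique_proj n b e x) :: ennreal"
  have P: "oblique_proj n b e \<in> measurable (slab_measure e) borel"
    by (rule sets_slab_measure) measurable
  have "(\<integral>\<^sup>+x. ?h x \<partial>slab_measure e) = (\<integral>\<^sup>+x. indicator N x \<partial>distr (slab_measure e) borel (oblique_proj n b e))"
    by (rule nn_integral_distr[OF P, symmetric]) measurable
  also have "\<dots> = emeasure (density (hyperplane_lborel n b) (\<lambda>_. ennreal \<bar>n \<bullet> e\<bar>)) N"
    by (simp add: distr_slab_oblique_proj[OF n e ne])
  also have "\<dots> = 0"
    using N by (subst emeasure_density) (auto simp: nn_integral_cmult_indicator)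
  finally have 0: "(\<integral>\<^sup>+x. indicator {0..1} (e \<bullet> x) * ?h x \<partial>lborel) = 0"
    by (subst (asm) nn_integral_slab_measure) measurable
  have s1: "(\<integral>\<^sup>+s. indicator {0..0 + 1} (e \<bullet> (x + s *\<^sub>R e)) \<partial>lborel) = ennreal (1 / \<bar>e \<bullet> e\<bar>)" for x
      by (rule nn_integral_slab_line) (simp add: ee)
  \<comment> \<open>With the weight \<open>1\<close> each line has length
    \<open>\<infinity>\<close>, so a line-invariant set that is null in the slab is null in the
    whole space.\<close>
  have "\<infinity> * (\<integral>\<^sup>+x. indicator {0..0 + 1} (e \<bullet> x) * ?h x \<partial>lborel)
      = ennreal (1 / \<bar>e \<bullet> e\<bar>) * (\<integral>\<^sup>+x. 1 * ?h x \<partial>lborel)"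
    by (rule nn_integral_line_invariant[OF _ _ _ _ s1]) (use ne in \<open>simp_all add: oblique_proj_invariant\<close>)
  then have "(\<integral>\<^sup>+x. ?h x \<partial>lborel) = 0" using 0 ee by simp
  then have "AE x in lborel. ?h x = 0"
    by (subst (asm) nn_integral_0_iff_AE) measurable
  then show ?thesis by eventually_elim (simp add: indicator_eq_0_iff)
qed

lemma AE_notin_hyperplane:
  fixes a :: "'a::euclidean_space"
  assumes "a \<noteq> 0"
  shows "AE x in lborel. a \<bullet> x \<noteq> c"
proof -
  have "{x. a \<bullet> x = c} \<in> null_sets lebesgue"
    using negligible_hyperplane[of a c] assms by (simp add: negligible_iff_null_sets)
  moreover have "{x. a \<bullet> x = c} \<in> sets borel" by measurable
  ultimately have "{x. a \<bullet> x = c} \<in> null_sets lborel"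
    using null_sets_completion_iff[of "{x. a \<bullet> x = c}" lborel] by simp
  then show ?thesis by (rule AE_I') auto
qed

text \<open>Stated for image measures, \<open>nn_integral_slab_lines\<close> transfers to Bochner
  integrals of signed functions.\<close>

lemma distr_slab_lines:
  fixes e :: "'a::euclidean_space"
  assumes e: "norm e = 1"
  shows "distr (slab_measure e \<Otimes>\<^sub>M lborel) borel (\<lambda>(x, s). x + s *\<^sub>R e) = lborel"
    and "(\<lambda>(x, s). x + s *\<^sub>R e) \<in> measurable (slab_measure e \<Otimes>\<^sub>M lborel) borel"
proof -
  have fst: "fst \<in> borel_measurable (slab_measure e \<Otimes>\<^sub>M lborel)"
    by (rule measurable_compose[OF measurable_fst]) (rule sets_slab_measure, measurable)
  show m: "(\<lambda>(x, s). x + s *\<^sub>R e) \<in> measurable (slab_measure e \<Otimes>\<^sub>M lborel) borel"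
    unfolding case_prod_beta using fst by measurable
  show "distr (slab_measure e \<Otimes>\<^sub>M lborel) borel (\<lambda>(x, s). x + s *\<^sub>R e) = lborel"
  proof (rule measure_eqI)
    fix A assume "A \<in> sets (distr (slab_measure e \<Otimes>\<^sub>M lborel) borel (\<lambda>(x, s). x + s *\<^sub>R e))"
    then have A [measurable]: "A \<in> sets borel" by simp
    have mA: "(\<lambda>p. indicator A (case p of (x, s) \<Rightarrow> x + s *\<^sub>R e) :: ennreal)
        \<in> borel_measurable (slab_measure e \<Otimes>\<^sub>M lborel)"
      by (rule measurable_compose[OF m]) measurable
    have [measurable]: "(\<lambda>(x, s). x + s *\<^sub>R e) \<in> borel_measurable (borel :: ('a \<times> real) measure)"
      by (intro borel_measurable_continuous_onI) (auto simp: case_prod_beta intro!: continuous_intros)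
    have "(\<lambda>(x, s). indicator A (x + s *\<^sub>R e) :: ennreal) \<in> borel_measurable (borel \<Otimes>\<^sub>M lborel)"
      unfolding case_prod_beta by measurable
    then have m1: "(\<lambda>x. \<integral>\<^sup>+s. indicator A (x + s *\<^sub>R e) \<partial>lborel) \<in> borel_measurable borel"
      using lborel.borel_measurable_nn_integral_fst by fastforce
    have "emeasure (distr (slab_measure e \<Otimes>\<^sub>M lborel) borel (\<lambda>(x, s). x + s *\<^sub>R e)) A
        = (\<integral>\<^sup>+p. indicator A p \<partial>distr (slab_measure e \<Otimes>\<^sub>M lborel) borel (\<lambda>(x, s). x + s *\<^sub>R e))"
      by simp
    also have "\<dots> = (\<integral>\<^sup>+p. indicator A (case p of (x, s) \<Rightarrow> x + s *\<^sub>R e) \<partial>(slab_measure e \<Otimes>\<^sub>M lborel))"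
      by (rule nn_integral_distr[OF m]) measurable
    also have "\<dots> = (\<integral>\<^sup>+x. \<integral>\<^sup>+s. indicator A (x + s *\<^sub>R e) \<partial>lborel \<partial>slab_measure e)"
      by (subst lborel.nn_integral_fst[OF mA, symmetric]) simp
    also have "\<dots> = (\<integral>\<^sup>+x. indicator A x \<partial>lborel)"
      by (subst nn_integral_slab_measure[OF m1]) (rule nn_integral_slab_lines[OF _ e], measurable)
    finally show "emeasure (distr (slab_measure e \<Otimes>\<^sub>M lborel) borel (\<lambda>(x, s). x + s *\<^sub>R e)) A
        = emeasure lborel A" by simp
  qed simp
qed

lemma measurable_slab_lines:
  fixes f :: "'a::euclidean_space \<Rightarrow> real"
  assumes e: "norm e = 1" and f: "f \<in> borel_measurable borel"
  shows "(\<lambda>x. \<integral>s. f (x + s *\<^sub>R e) \<partial>lborel) \<in> borel_measurable (slab_measure e)"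
proof -
  have "(\<lambda>p. f (case p of (x, s) \<Rightarrow> x + s *\<^sub>R e)) \<in> borel_measurable (slab_measure e \<Otimes>\<^sub>M lborel)"
    by (rule measurable_compose[OF distr_slab_lines(2)[OF e] f])
  then have "(\<lambda>(x, s). f (x + s *\<^sub>R e)) \<in> borel_measurable (slab_measure e \<Otimes>\<^sub>M lborel)"
    by (simp add: case_prod_beta)
  then show ?thesis by (rule lborel.borel_measurable_lebesgue_integral)
qed

lemma integral_slab_lines:
  fixes f :: "'a::euclidean_space \<Rightarrow> real"
  assumes e: "norm e = 1" and f: "integrable lborel f"
  shows "(\<integral>x. f x \<partial>lborel) = (\<integral>x. (\<integral>s. f (x + s *\<^sub>R e) \<partial>lborel) \<partial>slab_measure e)"
proof -
  let ?M = "slab_measure e \<Otimes>\<^sub>M lborel" and ?T = "\<lambda>(x, s). x + s *\<^sub>R e"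
  interpret slab: sigma_finite_measure "slab_measure e" by (rule sigma_finite_slab_measure)
  interpret P: pair_sigma_finite "slab_measure e" lborel ..
  have fm: "f \<in> borel_measurable borel" using f by (auto dest: borel_measurable_integrable)
  have "integrable (distr ?M borel ?T) f" using f by (simp add: distr_slab_lines[OF e])
  then have int: "integrable ?M (\<lambda>p. f (?T p))"
    by (subst (asm) integrable_distr_eq) (auto intro: fm distr_slab_lines(2)[OF e])
  have "(\<integral>x. f x \<partial>lborel) = (\<integral>p. f (?T p) \<partial>?M)"
    by (subst distr_slab_lines(1)[OF e, symmetric], subst integral_distr)
      (auto intro: fm distr_slab_lines(2)[OF e])
  also have "\<dots> = (\<integral>x. (\<integral>s. f (x + s *\<^sub>R e) \<partial>lborel) \<partial>slab_measure e)"
    using P.integral_fst'[OF int] by simp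
  finally show ?thesis .
qed

text \<open>The factor \<open>\<bar>n \<bullet> e\<bar>\<close> is the ratio of the area of the
  shadow in direction \<open>e\<close> to the area of a piece of the hyperplane.\<close>

lemma integral_oblique_proj:
  fixes g :: "'a::euclidean_space \<Rightarrow> real"
  assumes n: "norm n = 1" and e: "norm e = 1" and ne: "n \<bullet> e \<noteq> 0" and g: "g \<in> borel_measurable borel"
  shows "(\<integral>x. g (oblique_proj n b e x) \<partial>slab_measure e) = \<bar>n \<bullet> e\<bar> * (\<integral>x. g x \<partial>hyperplane_lborel n b)"
    and "integrable (hyperplane_lborel n b) g \<Longrightarrow>
      integrable (slab_measure e) (\<lambda>x. g (oblique_proj n b e x))"
proof -
  have P: "oblique_proj n b e \<in> measurable (slab_measure e) borel"
    by (rule sets_slab_measure) measurable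
  have g' [measurable]: "g \<in> borel_measurable (hyperplane_lborel n b)" using g by simp
  have "(\<integral>x. g (oblique_proj n b e x) \<partial>slab_measure e)
      = (\<integral>x. g x \<partial>distr (slab_measure e) borel (oblique_proj n b e))"
    by (rule integral_distr[OF P g, symmetric])
  also have "\<dots> = \<bar>n \<bullet> e\<bar> * (\<integral>x. g x \<partial>hyperplane_lborel n b)"
    unfolding distr_slab_oblique_proj[OF n e ne] by (subst integral_density) (auto intro: g')
  finally show "(\<integral>x. g (oblique_proj n b e x) \<partial>slab_measure e)
      = \<bar>n \<bullet> e\<bar> * (\<integral>x. g x \<partial>hyperplane_lborel n b)" .
  assume int: "integrable (hyperplane_lborel n b) g"
  have "integrable (distr (slab_measure e) borel (oblique_proj n b e)) g"
    unfolding distr_slab_oblique_proj[OF n e ne]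
    by (subst integrable_density) (auto intro: g' int)
  then show "integrable (slab_measure e) (\<lambda>x. g (oblique_proj n b e x))"
    by (subst (asm) integrable_distr_eq[OF P g])
qed

section \<open>Piecewise constant functions on a line\<close>

text \<open>Subtracting \<open>J i\<close> times the indicator of \<open>{..<d i}\<close> cancels
  every jump. The remainder is constant on a punctured neighbourhood of each point, so its punctured
  limits \<open>k\<close> are locally constant, hence constant, and zero since \<open>g\<close>
  vanishes far away. The values of \<open>g\<close> at the jumps stay uncontrolled; they sit on a
  null set.\<close>

lemma integral_piecewise_constant:
  fixes g \<psi> \<psi>' :: "real \<Rightarrow> real" and d :: "'i \<Rightarrow> real"
  assumes I: "finite I" "inj_on d I"
    and reg: "\<And>s. s \<notin> d ` I \<Longrightarrow> \<forall>\<^sub>F t in at s. g t = g s"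
    and jump: "\<And>i. i \<in> I \<Longrightarrow> \<exists>\<alpha> \<beta>. \<alpha> - \<beta> = J i \<and>
                 (\<forall>\<^sub>F t in at_left (d i). g t = \<alpha>) \<and> (\<forall>\<^sub>F t in at_right (d i). g t = \<beta>)"
    and bd: "\<And>s. g s \<noteq> 0 \<Longrightarrow> \<bar>s\<bar> \<le> R"
    and \<psi>: "\<And>s. (\<psi> has_real_derivative \<psi>' s) (at s)" "continuous_on UNIV \<psi>'"
  shows "(\<integral>s. g s * \<psi>' s \<partial>lborel) = (\<Sum>i\<in>I. J i * \<psi> (d i))"
proof -
  let ?u = "\<lambda>i t. indicator {..<d i} t :: real"
  define h where "h t = g t - (\<Sum>i\<in>I. J i * ?u i t)" for t
  have E: "\<forall>\<^sub>F t in at s. \<forall>i\<in>I. d i \<noteq> s \<longrightarrow> ?u i t = ?u i s" for s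
  proof (rule eventually_ball_finite[OF I(1)], intro ballI)
    fix i assume "i \<in> I"
    show "\<forall>\<^sub>F t in at s. d i \<noteq> s \<longrightarrow> ?u i t = ?u i s"
    proof (cases "s < d i")
      case True
      then have "\<forall>\<^sub>F t in at s. t < d i" by (rule order_tendstoD(2)[OF tendsto_ident_at])
      then show ?thesis by eventually_elim (use True in simp)
    next
      case False
      show ?thesis
      proof (cases "d i = s")
        case False
        with \<open>\<not> s < d i\<close> have "d i < s" by simp
        then have "\<forall>\<^sub>F t in at s. d i < t" by (rule order_tendstoD(1)[OF tendsto_ident_at])
        then show ?thesis by eventually_elim (use \<open>d i < s\<close> in simp)
      qed simp
    qed
  qed
  have reg': "\<forall>\<^sub>F t in at s. h t = h s" if s: "s \<notin> d ` I" for s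
    using E[of s] reg[OF s]
  proof eventually_elim
    case (elim t)
    then have "(\<Sum>i\<in>I. J i * ?u i t) = (\<Sum>i\<in>I. J i * ?u i s)"
      using s by (intro sum.cong) auto
    then show ?case using elim by (simp add: h_def)
  qed
  have "\<exists>c. \<forall>\<^sub>F t in at s. h t = c" for s
  proof (cases "s \<in> d ` I")
    case True
    then obtain j where j: "j \<in> I" "s = d j" by auto
    obtain \<alpha> \<beta> where ab: "\<alpha> - \<beta> = J j" "\<forall>\<^sub>F t in at_left s. g t = \<alpha>" "\<forall>\<^sub>F t in at_right s. g t = \<beta>"
      using jump[OF j(1)] j(2) by auto
    define c where "c = \<beta> - (\<Sum>i\<in>I - {j}. J i * ?u i s)"
    have h: "h t = g t - J j * ?u j t - (\<Sum>i\<in>I - {j}. J i * ?u i s)"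
      if "\<forall>i\<in>I. d i \<noteq> s \<longrightarrow> ?u i t = ?u i s" for t
    proof -
      have "(\<Sum>i\<in>I - {j}. J i * ?u i t) = (\<Sum>i\<in>I - {j}. J i * ?u i s)"
        using that I(2) j by (intro sum.cong) (auto simp: inj_on_def)
      then show ?thesis
        unfolding h_def sum.remove[OF I(1) j(1)] by (simp only:)
    qed
    have lt: "\<forall>\<^sub>F t in at_left s. t < s" by (simp add: eventually_at_filter)
    have El: "\<forall>\<^sub>F t in at_left s. \<forall>i\<in>I. d i \<noteq> s \<longrightarrow> ?u i t = ?u i s"
      and Er: "\<forall>\<^sub>F t in at_right s. \<forall>i\<in>I. d i \<noteq> s \<longrightarrow> ?u i t = ?u i s"
      using E[of s] by (simp_all add: eventually_at_split)
    have "\<forall>\<^sub>F t in at_left s. h t = c"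
      using ab(2) El lt
    proof eventually_elim
      case (elim t)
      then show ?case using h[of t] ab(1) j(2) by (simp add: c_def)
    qed
    moreover have "\<forall>\<^sub>F t in at_right s. h t = c"
      using ab(3) Er eventually_at_right_less[of s]
    proof eventually_elim
      case (elim t)
      then show ?case using h[of t] ab(1) j(2) by (simp add: c_def)
    qed
    ultimately show ?thesis by (auto simp: eventually_at_split)
  next
    case False
    then show ?thesis using reg' by blast
  qed
  then obtain k where k: "\<And>s. \<forall>\<^sub>F t in at s. h t = k s" by metis
  have k_unique: "k s = c" if "\<forall>\<^sub>F t in at s. h t = c" for s c
  proof -
    have "\<forall>\<^sub>F t in at s. k s = c" using k[of s] that by eventually_elim simp
    then show ?thesis by simp
  qed
  have k_const: "k a = k b" for a b
  proof (rule connected_local_const[where A = UNIV and f = k])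
    show "\<forall>a\<in>UNIV. \<forall>\<^sub>F b in at a within UNIV. k a = k b"
    proof
      fix a
      obtain S where S: "open S" "a \<in> S" "\<And>t. t \<in> S \<Longrightarrow> t \<noteq> a \<Longrightarrow> h t = k a"
        using k[of a] unfolding eventually_at_topological by auto
      have "k t = k a" if "t \<in> S" "t \<noteq> a" for t
      proof (rule k_unique)
        have "open (S - {a})" using S(1) by (rule open_delete)
        then show "\<forall>\<^sub>F u in at t. h u = k a"
          unfolding eventually_at_topological using that S(3) by (intro exI[of _ "S - {a}"]) auto
      qed
      then show "\<forall>\<^sub>F b in at a within UNIV. k a = k b"
        unfolding eventually_at_topological using S(1,2) by (intro exI[of _ S]) auto
    qed
  qed (simp_all add: connected_UNIV)
  \<comment> \<open>Beyond \<open>M\<close> lie neither jumps nor points where \<open>g\<close> is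
    nonzero; the absolute value of \<open>R\<close> makes \<open>M\<close> nonnegative.\<close>
  define M where "M = max \<bar>R\<bar> (\<Sum>i\<in>I. \<bar>d i\<bar>)"
  have dM: "\<bar>d i\<bar> \<le> M" if "i \<in> I" for i
    using member_le_sum[of i I "\<lambda>i. \<bar>d i\<bar>"] that I(1) by (simp add: M_def)
  have gM: "g t = 0" if "M < \<bar>t\<bar>" for t
    using bd[of t] that by (force simp: M_def)
  have "\<forall>\<^sub>F t in at (M + 1). M < t" by (rule order_tendstoD(1)[OF tendsto_ident_at]) simp
  then have "\<forall>\<^sub>F t in at (M + 1). h t = 0"
  proof eventually_elim
    case (elim t)
    then have "?u i t = 0" if "i \<in> I" for i using dM[OF that] by (simp add: indicator_def)
    then show ?case using elim gM[of t] by (simp add: h_def)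
  qed
  then have k0: "k s = 0" for s using k_unique[where s = "M + 1" and c = 0] k_const[of s "M + 1"] by simp
  have g: "g t = (\<Sum>i\<in>I. J i * ?u i t)" if "t \<notin> d ` I" for t
    using k_unique[OF reg'[OF that]] k0[of t] by (simp add: h_def)
  \<comment> \<open>To the left of all jumps every indicator is one while \<open>g\<close> vanishes.
    This makes the contributions of the lower limit \<open>- M\<close> cancel below.\<close>
  have J0: "(\<Sum>i\<in>I. J i) = 0"
  proof -
    have lt: "- M - 1 < d i" if "i \<in> I" for i using dM[OF that] by simp
    then have "- M - 1 \<notin> d ` I" by force
    then have "(\<Sum>i\<in>I. J i * ?u i (- M - 1)) = g (- M - 1)" using g by simp
    moreover have "(\<Sum>i\<in>I. J i * ?u i (- M - 1)) = (\<Sum>i\<in>I. J i)"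
      using lt by (intro sum.cong) auto
    moreover have "M \<ge> 0" by (simp add: M_def)
    ultimately show ?thesis using gM[of "- M - 1"] by simp
  qed
  have cont: "isCont \<psi>' s" for s using \<psi>(2) by (simp add: continuous_on_eq_continuous_at)
  have FTC: "has_bochner_integral lborel (\<lambda>s. \<psi>' s * indicator {- M..d i} s) (\<psi> (d i) - \<psi> (- M))"
    if "i \<in> I" for i
    using dM[OF that] by (intro has_bochner_integral_FTC_Icc_real \<psi>(1) cont) simp
  have "AE s in lborel. s \<notin> d ` I \<union> {- M}"
    using I(1) by (intro AE_not_in finite_imp_null_set_lborel) simp
  then have "AE s in lborel. g s * \<psi>' s = (\<Sum>i\<in>I. J i * (\<psi>' s * indicator {- M..d i} s))"
  proof eventually_elim
    case (elim s)
    show ?case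
    proof (cases "- M \<le> s")
      case True
      then have "indicator {- M..d i} s = ?u i s" if "i \<in> I" for i
        using elim that by (auto simp: indicator_def order_less_le)
      then show ?thesis using g[of s] elim by (simp add: sum_distrib_left mult_ac)
    next
      case False
      then have "M < \<bar>s\<bar>" by simp
      then show ?thesis using gM[of s] False by simp
    qed
  qed
  moreover have int: "integrable lborel (\<lambda>s. \<Sum>i\<in>I. J i * (\<psi>' s * indicator {- M..d i} s))"
    using FTC by (intro Bochner_Integration.integrable_sum integrable_mult_right)
      (auto simp: has_bochner_integral_iff)
  moreover have "(\<lambda>s. g s * \<psi>' s) \<in> borel_measurable lborel"
  proof -
    have "(\<lambda>t. \<Sum>i\<in>I. J i * ?u i t) \<in> borel_measurable borel" by measurable
    then have "g \<in> borel_measurable borel"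
      by (rule measurable_discrete_difference[where X = "d ` I"])
        (use I(1) g in \<open>auto intro: countable_finite\<close>)
    moreover have "\<psi>' \<in> borel_measurable borel"
      using \<psi>(2) by (rule borel_measurable_continuous_onI)
    ultimately show ?thesis by simp
  qed
  ultimately have "(\<integral>s. g s * \<psi>' s \<partial>lborel)
      = (\<integral>s. (\<Sum>i\<in>I. J i * (\<psi>' s * indicator {- M..d i} s)) \<partial>lborel)"
    by (intro integral_cong_AE) auto
  also have "\<dots> = (\<Sum>i\<in>I. J i * (\<psi> (d i) - \<psi> (- M)))"
    using FTC by (subst Bochner_Integration.integral_sum) (auto simp: has_bochner_integral_iff)
  also have "\<dots> = (\<Sum>i\<in>I. J i * \<psi> (d i)) - (\<Sum>i\<in>I. J i) * \<psi> (- M)"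
    by (simp add: right_diff_distrib sum_subtractf sum_distrib_right)
  finally show ?thesis by (simp add: J0)
qed

section \<open>Local structure of open polytopes\<close>

text \<open>The pairs in \<open>H\<close> stand for the hyperplanes \<open>{z. a \<bullet> z = c}\<close>.\<close>

definition generic_point :: "('a::euclidean_space \<times> real) set \<Rightarrow> 'a \<Rightarrow> 'a \<Rightarrow> bool" where
  "generic_point H n y \<longleftrightarrow> (\<forall>(a, c)\<in>H. a \<bullet> y = c \<longrightarrow> (\<forall>z. n \<bullet> z = n \<bullet> y \<longrightarrow> a \<bullet> z = c))"

definition local_side :: "'a::euclidean_space set \<Rightarrow> 'a \<Rightarrow> 'a \<Rightarrow> bool" where
  "local_side T n y \<longleftrightarrow> (\<exists>\<epsilon>>0. \<forall>z\<in>ball y \<epsilon>. (n \<bullet> z < n \<bullet> y \<longrightarrow> z \<in> T) \<and> (n \<bullet> z > n \<bullet> y \<longrightarrow> z \<notin> T))"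

text \<open>Every member of \<open>H\<close> through a generic point contains the hyperplane with
  normal \<open>n\<close>, so near that point only the side of the latter matters. The property is
  monotone in \<open>H\<close>, so one finite set can serve all elements.\<close>

definition resolves :: "('a::euclidean_space \<times> real) set \<Rightarrow> 'a set \<Rightarrow> bool" where
  "resolves H T \<longleftrightarrow> (\<forall>y\<in>frontier T. \<forall>n. n \<noteq> 0 \<longrightarrow> generic_point H n y \<longrightarrow>
     local_side T n y \<or> local_side T (- n) y)"

lemma resolves_mono: "resolves H T \<Longrightarrow> H \<subseteq> H' \<Longrightarrow> resolves H' T"
  unfolding resolves_def generic_point_def by blast

lemma parallel_normals:
  fixes a n :: "'a::real_inner"
  assumes n: "n \<noteq> 0" and orth: "\<And>v. n \<bullet> v = 0 \<Longrightarrow> a \<bullet> v = 0"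
  shows "a = ((a \<bullet> n) / (n \<bullet> n)) *\<^sub>R n"
proof -
  define v where "v = a - ((a \<bullet> n) / (n \<bullet> n)) *\<^sub>R n"
  have "n \<bullet> v = 0" using n by (simp add: v_def inner_diff_right inner_commute)
  then have "v \<bullet> v = 0" using orth[of v] by (simp add: v_def inner_diff_left)
  then show ?thesis by (simp add: v_def)
qed

lemma generic_pointD:
  "generic_point H n y \<Longrightarrow> (a, c) \<in> H \<Longrightarrow> a \<bullet> y = c \<Longrightarrow> n \<bullet> z = n \<bullet> y \<Longrightarrow> a \<bullet> z = c"
  unfolding generic_point_def by blast

lemma generic_point_minus: "generic_point H (- n) y \<longleftrightarrow> generic_point H n y"
  by (simp add: generic_point_def)

text \<open>The part of \<open>U\<close> outside \<open>C\<close> would be an open subset of a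
  hyperplane, which has empty interior.\<close>

lemma dense_complement_hyperplane:
  fixes n :: "'a::euclidean_space"
  assumes n: "n \<noteq> 0" and C: "closed C" and U: "open U" "\<And>z. z \<in> U \<Longrightarrow> n \<bullet> z \<noteq> b \<Longrightarrow> z \<in> C"
  shows "U \<subseteq> C"
proof -
  have "open (U - C)" using U(1) C by (rule open_Diff)
  moreover have "U - C \<subseteq> {z. n \<bullet> z = b}" using U(2) by auto
  ultimately have "U - C \<subseteq> interior {z. n \<bullet> z = b}" by (rule interior_maximal[rotated])
  then show ?thesis using n by simp
qed

lemma polyhedron_halfspaces:
  assumes "polyhedron K"
  shows "\<exists>A. finite A \<and> K = {z. \<forall>(a, c)\<in>A. a \<bullet> z \<le> c}"
proof -
  obtain F where "finite F \<and> K = \<Inter>F \<and> (\<forall>h\<in>F. \<exists>a b. a \<noteq> 0 \<and> h = {x. a \<bullet> x \<le> b})"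
    using assms unfolding polyhedron_def ..
  then have F: "finite F" "K = \<Inter>F" and hF: "\<forall>h\<in>F. \<exists>a b. a \<noteq> 0 \<and> h = {x. a \<bullet> x \<le> b}"
    by simp_all
  have "\<forall>h\<in>F. \<exists>ab. h = {x. fst ab \<bullet> x \<le> snd ab}"
  proof
    fix h assume "h \<in> F"
    with hF have "\<exists>a b. a \<noteq> 0 \<and> h = {x. a \<bullet> x \<le> b}" ..
    then obtain a b where "a \<noteq> 0 \<and> h = {x. a \<bullet> x \<le> b}" by (elim exE)
    then show "\<exists>ab. h = {x. fst ab \<bullet> x \<le> snd ab}"
      by (intro exI[of _ "(a, b)"]) simp
  qed
  from bchoice[OF this] obtain r where r: "\<And>h. h \<in> F \<Longrightarrow> h = {x. fst (r h) \<bullet> x \<le> snd (r h)}"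
    by (elim exE) (rule that, rule bspec)
  have "z \<in> h \<longleftrightarrow> fst (r h) \<bullet> z \<le> snd (r h)" if "h \<in> F" for h z
    using r[OF that] by (metis mem_Collect_eq)
  then have "K = {z. \<forall>(a, c)\<in>r ` F. a \<bullet> z \<le> c}"
    unfolding F(2) case_prod_beta by auto
  then show ?thesis using F(1) by (intro exI[of _ "r ` F"]) simp
qed

text \<open>\<open>H\<close> collects the bounding hyperplanes of the convex pieces. Near a generic
  \<open>y\<close>, each defining inequality is constant or depends only on the sign of
  \<open>n \<bullet> z - n \<bullet> y\<close>, so each open half ball lies inside the union of the
  pieces or misses it. If both lie inside, \<open>y\<close> is interior, because \<open>T\<close> is
  the interior of a closed set; if both miss it, \<open>y\<close> is outside the closure of
  \<open>T\<close>.\<close>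

lemma open_polytope_resolved:
  fixes T :: "'a::euclidean_space set"
  assumes "open_polytope T"
  shows "\<exists>H. finite H \<and> resolves H T"
proof -
  obtain \<K> where K: "finite \<K>" "\<And>K. K \<in> \<K> \<Longrightarrow> polytope K" "T = interior (\<Union>\<K>)"
    using assms by (auto simp: open_polytope_def)
  have "\<forall>K\<in>\<K>. \<exists>A. finite A \<and> K = {z. \<forall>(a, c)\<in>A. a \<bullet> z \<le> c}"
    using K(2) by (intro ballI polyhedron_halfspaces polytope_imp_polyhedron)
  from bchoice[OF this] obtain A where "\<forall>K\<in>\<K>. finite (A K) \<and> K = {z. \<forall>(a, c)\<in>A K. a \<bullet> z \<le> c}" ..
  then have A: "\<And>K. K \<in> \<K> \<Longrightarrow> finite (A K)" "\<And>K. K \<in> \<K> \<Longrightarrow> K = {z. \<forall>(a, c)\<in>A K. a \<bullet> z \<le> c}"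
    by blast+
  define H where "H = (\<Union>K\<in>\<K>. A K)"
  have finH: "finite H" using K(1) A(1) by (simp add: H_def)
  have closed: "closed (\<Union>\<K>)" using K by (intro closed_Union) (auto intro: polytope_imp_closed)
  have openT: "open T" by (simp add: K(3))
  have same: "z \<in> \<Union>\<K> \<longleftrightarrow> z' \<in> \<Union>\<K>" if "\<And>a c. (a, c) \<in> H \<Longrightarrow> (a \<bullet> z \<le> c) = (a \<bullet> z' \<le> c)" for z z'
  proof -
    have "z \<in> K \<longleftrightarrow> z' \<in> K" if "K \<in> \<K>" for K
    proof -
      have "(a \<bullet> z \<le> c) = (a \<bullet> z' \<le> c)" if "(a, c) \<in> A K" for a c
        using \<open>\<And>a c. (a, c) \<in> H \<Longrightarrow> (a \<bullet> z \<le> c) = (a \<bullet> z' \<le> c)\<close> that \<open>K \<in> \<K>\<close>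
        unfolding H_def by blast
      then have "(\<forall>(a, c)\<in>A K. a \<bullet> z \<le> c) = (\<forall>(a, c)\<in>A K. a \<bullet> z' \<le> c)" by auto
      then show ?thesis by (subst (1 2) A(2)[OF that]) simp
    qed
    then show ?thesis by blast
  qed
  have sides: "local_side T n y \<or> local_side T (- n) y"
    if y: "y \<in> frontier T" and n: "n \<noteq> 0" and gen: "generic_point H n y" for y n
  proof -
    have "\<forall>\<^sub>F z in nhds y. \<forall>p\<in>H. fst p \<bullet> y \<noteq> snd p \<longrightarrow> (fst p \<bullet> z \<le> snd p) = (fst p \<bullet> y \<le> snd p)"
    proof (rule eventually_ball_finite[OF finH], intro ballI)
      fix p assume "p \<in> H"
      have lim: "((\<lambda>z. fst p \<bullet> z) \<longlongrightarrow> fst p \<bullet> y) (nhds y)"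
        by (intro tendsto_intros filterlim_ident)
      show "\<forall>\<^sub>F z in nhds y. fst p \<bullet> y \<noteq> snd p \<longrightarrow> (fst p \<bullet> z \<le> snd p) = (fst p \<bullet> y \<le> snd p)"
      proof (cases "fst p \<bullet> y" "snd p" rule: linorder_cases)
        case less
        from order_tendstoD(2)[OF lim less] show ?thesis by eventually_elim (use less in simp)
      next
        case greater
        from order_tendstoD(1)[OF lim greater] show ?thesis by eventually_elim (use greater in simp)
      qed simp
    qed
    then obtain \<epsilon> where \<epsilon>: "\<epsilon> > 0"
        "\<And>z a c. z \<in> ball y \<epsilon> \<Longrightarrow> (a, c) \<in> H \<Longrightarrow> a \<bullet> y \<noteq> c \<Longrightarrow> (a \<bullet> z \<le> c) = (a \<bullet> y \<le> c)"
      unfolding eventually_nhds_metric by (fastforce simp: dist_commute)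
    have const: "z \<in> \<Union>\<K> \<longleftrightarrow> z' \<in> \<Union>\<K>"
      if z: "z \<in> ball y \<epsilon>" "z' \<in> ball y \<epsilon>"
        and side: "(n \<bullet> z < n \<bullet> y \<and> n \<bullet> z' < n \<bullet> y) \<or> (n \<bullet> z > n \<bullet> y \<and> n \<bullet> z' > n \<bullet> y)" for z z'
    proof (rule same)
      fix a c assume ac: "(a, c) \<in> H"
      show "(a \<bullet> z \<le> c) = (a \<bullet> z' \<le> c)"
      proof (cases "a \<bullet> y = c")
        case False
        then show ?thesis using \<epsilon>(2)[OF z(1) ac] \<epsilon>(2)[OF z(2) ac] by simp
      next
        case True
        have "a \<bullet> v = 0" if "n \<bullet> v = 0" for v
        proof -
          have "a \<bullet> (y + v) = c"
            by (rule generic_pointD[OF gen ac True]) (simp add: inner_add_right that)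
          then show ?thesis using True by (simp add: inner_add_right)
        qed
        then have r: "a = ((a \<bullet> n) / (n \<bullet> n)) *\<^sub>R n" by (rule parallel_normals[OF n])
        define q where "q = (a \<bullet> n) / (n \<bullet> n)"
        have q: "a \<bullet> w = q * (n \<bullet> w)" for w
          unfolding q_def using arg_cong[OF r, of "\<lambda>v. v \<bullet> w"] inner_scaleR_left[of "(a \<bullet> n) / (n \<bullet> n)" n w] by (rule trans)
        have "q * (n \<bullet> w - n \<bullet> y) = a \<bullet> w - c" for w
          unfolding right_diff_distrib q[symmetric] True ..
        then have le: "a \<bullet> w \<le> c \<longleftrightarrow> q * (n \<bullet> w - n \<bullet> y) \<le> 0" for w by simp
        show ?thesis unfolding le mult_le_0_iff using side by auto
      qed
    qed
    define B where "B m = {z \<in> ball y \<epsilon>. m \<bullet> z < m \<bullet> y}" for m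
    have B: "B m \<subseteq> T \<or> B m \<inter> \<Union>\<K> = {}" if "m = n \<or> m = - n" for m
    proof (cases "B m \<inter> \<Union>\<K> = {}")
      case False
      then obtain w where w: "w \<in> B m" "w \<in> \<Union>\<K>" by blast
      have "B m \<subseteq> \<Union>\<K>"
      proof
        fix z assume "z \<in> B m"
        then have "z \<in> \<Union>\<K> \<longleftrightarrow> w \<in> \<Union>\<K>"
          using w(1) that by (intro const) (auto simp: B_def)
        then show "z \<in> \<Union>\<K>" using w(2) by simp
      qed
      moreover have "open (B m)"
      proof -
        have "B m = ball y \<epsilon> \<inter> {z. m \<bullet> z < m \<bullet> y}" by (auto simp: B_def)
        then show ?thesis by (simp add: open_Int open_halfspace_lt)
      qed
      ultimately show ?thesis unfolding K(3) by (simp add: interior_maximal)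
    qed simp
    have TK: "T \<subseteq> \<Union>\<K>" unfolding K(3) by (rule interior_subset)
    have "\<not> (B n \<subseteq> T \<and> B (- n) \<subseteq> T)"
    proof
      assume both: "B n \<subseteq> T \<and> B (- n) \<subseteq> T"
      have "ball y \<epsilon> \<subseteq> \<Union>\<K>"
      proof (rule dense_complement_hyperplane[OF n closed open_ball])
        fix z assume "z \<in> ball y \<epsilon>" "n \<bullet> z \<noteq> n \<bullet> y"
        then have "z \<in> B n \<or> z \<in> B (- n)" by (auto simp: B_def)
        then show "z \<in> \<Union>\<K>" using both TK by blast
      qed
      then have "ball y \<epsilon> \<subseteq> T" unfolding K(3) by (simp add: interior_maximal)
      then have "y \<in> T" using \<epsilon>(1) by auto
      then show False using y openT by (simp add: frontier_def interior_open)
    qed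
    moreover have "\<not> (B n \<inter> \<Union>\<K> = {} \<and> B (- n) \<inter> \<Union>\<K> = {})"
    proof
      assume both: "B n \<inter> \<Union>\<K> = {} \<and> B (- n) \<inter> \<Union>\<K> = {}"
      have "ball y \<epsilon> \<subseteq> - T"
      proof (rule dense_complement_hyperplane[OF n _ open_ball])
        show "closed (- T)" using openT by (simp add: closed_Compl)
        fix z assume "z \<in> ball y \<epsilon>" "n \<bullet> z \<noteq> n \<bullet> y"
        then have "z \<in> B n \<or> z \<in> B (- n)" by (auto simp: B_def)
        then show "z \<in> - T" using both TK by blast
      qed
      then have "ball y \<epsilon> \<inter> closure T = {}"
        using open_Int_closure_eq_empty[OF open_ball, of y \<epsilon> T] by blast
      then have "y \<notin> closure T" using \<epsilon>(1) centre_in_ball[of y \<epsilon>] by blast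
      then show False using y by (simp add: frontier_def)
    qed
    ultimately consider "B n \<subseteq> T" "B (- n) \<inter> T = {}" | "B (- n) \<subseteq> T" "B n \<inter> T = {}"
      using B TK by blast
    then show ?thesis
    proof cases
      case 1
      then have "local_side T n y"
        unfolding local_side_def B_def using \<epsilon>(1) by (intro exI[of _ \<epsilon>]) fastforce
      then show ?thesis ..
    next
      case 2
      then have "local_side T (- n) y"
        unfolding local_side_def B_def using \<epsilon>(1) by (intro exI[of _ \<epsilon>]) fastforce
      then show ?thesis ..
    qed
  qed
  then show ?thesis using finH unfolding resolves_def by blast
qed

lemma local_side_along:
  assumes "local_side T n y"
  shows "\<forall>\<^sub>F t in at_right 0. n \<bullet> u > 0 \<longrightarrow> y - t *\<^sub>R u \<in> T \<and> y + t *\<^sub>R u \<notin> T"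
proof -
  obtain \<epsilon> where \<epsilon>: "\<epsilon> > 0"
      "\<And>z. z \<in> ball y \<epsilon> \<Longrightarrow> (n \<bullet> z < n \<bullet> y \<longrightarrow> z \<in> T) \<and> (n \<bullet> z > n \<bullet> y \<longrightarrow> z \<notin> T)"
    using assms by (auto simp: local_side_def)
  have lim: "((\<lambda>t. norm (t *\<^sub>R u)) \<longlongrightarrow> norm (0 *\<^sub>R u)) (at_right 0)"
    by (intro tendsto_intros)
  have "\<forall>\<^sub>F t in at_right 0. norm (t *\<^sub>R u) < \<epsilon>"
    by (rule order_tendstoD(2)[OF lim]) (use \<epsilon>(1) in simp)
  then show ?thesis
    using eventually_at_right_less[of 0]
  proof eventually_elim
    case (elim t)
    then have "y - t *\<^sub>R u \<in> ball y \<epsilon>" "y + t *\<^sub>R u \<in> ball y \<epsilon>" by (simp_all add: dist_norm)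
    from \<epsilon>(2)[OF this(1)] \<epsilon>(2)[OF this(2)] show ?case
      using elim by (simp add: inner_diff_right inner_add_right)
  qed
qed

text \<open>Both sets fill the same side of the hyperplane near \<open>y\<close>; for two elements
  of the mesh this forces equality.\<close>

lemma local_side_meet:
  assumes "local_side A n y" "local_side B n y" "n \<noteq> 0"
  shows "A \<inter> B \<noteq> {}"
proof -
  have n: "n \<bullet> n > 0" using assms(3) by simp
  have "\<forall>\<^sub>F t in at_right 0. y - t *\<^sub>R n \<in> A \<and> y - t *\<^sub>R n \<in> B"
    using local_side_along[OF assms(1), of n] local_side_along[OF assms(2), of n]
    by eventually_elim (use n in auto)
  then obtain t where "y - t *\<^sub>R n \<in> A \<and> y - t *\<^sub>R n \<in> B"
    using eventually_happens'[OF trivial_limit_at_right_real] by blast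
  then show ?thesis by blast
qed

lemma open_polytope_open: "open_polytope T \<Longrightarrow> open T"
  by (auto simp: open_polytope_def)

lemma open_polytope_bounded: "open_polytope T \<Longrightarrow> bounded T"
  unfolding open_polytope_def
  by (metis bounded_Union bounded_subset interior_subset polytope_imp_bounded)

lemma interior_closure_open_polytope:
  assumes "open_polytope T"
  shows "interior (closure T) = T"
proof -
  obtain \<K> where K: "finite \<K>" "\<And>K. K \<in> \<K> \<Longrightarrow> polytope K" "T = interior (\<Union>\<K>)"
    using assms by (auto simp: open_polytope_def)
  have "closed (\<Union>\<K>)" using K by (intro closed_Union) (auto intro: polytope_imp_closed)
  then have "closure T \<subseteq> \<Union>\<K>" unfolding K(3) by (intro closure_minimal interior_subset)
  then have "interior (closure T) \<subseteq> T" unfolding K(3) by (rule interior_mono)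
  moreover have "T \<subseteq> interior (closure T)"
    using open_polytope_open[OF assms] by (intro interior_maximal closure_subset)
  ultimately show ?thesis by auto
qed

section \<open>Faces\<close>

text \<open>The same choice as in \<open>face_lborel\<close>, so that the surface measure unfolds in
  terms of it; the sign is arbitrary, unlike that of \<open>unit_normal\<close>.\<close>

definition face_normal :: "'a::euclidean_space set \<Rightarrow> 'a" where
  "face_normal F = fst (SOME (n, b). norm n = 1 \<and> F \<subseteq> {x. n \<bullet> x = b})"

definition face_offset :: "'a::euclidean_space set \<Rightarrow> real" where
  "face_offset F = snd (SOME (n, b). norm n = 1 \<and> F \<subseteq> {x. n \<bullet> x = b})"

lemma face_lborel_eq: "face_lborel F = hyperplane_lborel (face_normal F) (face_offset F)"
  by (simp add: face_lborel_def face_normal_def face_offset_def case_prod_beta)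

lemma sets_face_lborel [simp, measurable_cong]: "sets (face_lborel F) = sets borel"
  by (simp add: face_lborel_eq)

lemma space_face_lborel [simp]: "space (face_lborel F) = UNIV"
  by (simp add: face_lborel_eq)

text \<open>A nonempty relatively open subset has the whole hyperplane as affine hull, so only one
  hyperplane contains \<open>F\<close>, and its unit normal is determined up to sign.\<close>

lemma
  fixes F :: "'a::euclidean_space set"
  assumes F: "mesh_face F"
  shows norm_face_normal: "norm (face_normal F) = 1"
    and face_subset_hyperplane: "F \<subseteq> {x. face_normal F \<bullet> x = face_offset F}"
    and face_openin: "openin (top_of_set {x. face_normal F \<bullet> x = face_offset F}) F"
    and face_normal_unique: "norm n = 1 \<Longrightarrow> F \<subseteq> {x. n \<bullet> x = b} \<Longrightarrow>
      n = face_normal F \<and> b = face_offset F \<or> n = - face_normal F \<and> b = - face_offset F"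
proof -
  obtain a c where ac: "a \<noteq> 0" "openin (top_of_set {x. a \<bullet> x = c}) F" and ne: "F \<noteq> {}"
    using F by (auto simp: mesh_face_def)
  have Fac: "F \<subseteq> {x. a \<bullet> x = c}" using openin_imp_subset[OF ac(2)] .
  have F': "openin (top_of_set (affine hull {x. a \<bullet> x = c})) F"
    using ac(2) by (simp add: affine_hyperplane affine_hull_eq[THEN iffD2])
  have aff: "affine hull F = {x. a \<bullet> x = c}"
    using affine_hull_openin[OF F' ne] by (simp add: affine_hyperplane affine_hull_eq[THEN iffD2])
  obtain y where y: "y \<in> F" using ne by blast
  have sub: "{x. a \<bullet> x = c} \<subseteq> {x. m \<bullet> x = d}" if "F \<subseteq> {x. m \<bullet> x = d}" for m d
    using hull_minimal[of F "{x. m \<bullet> x = d}" affine] that by (simp add: aff affine_hyperplane)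
  have par: "m = ((m \<bullet> a) / (a \<bullet> a)) *\<^sub>R a" if m: "F \<subseteq> {x. m \<bullet> x = d}" for m d
  proof (rule parallel_normals[OF ac(1)])
    fix v assume "a \<bullet> v = 0"
    then have "y + v \<in> {x. a \<bullet> x = c}" using y Fac by (auto simp: inner_add_right)
    then have "m \<bullet> (y + v) = d" using sub[OF m] by blast
    then show "m \<bullet> v = 0" using y m by (auto simp: inner_add_right)
  qed
  have "\<exists>n b. norm n = 1 \<and> F \<subseteq> {x. n \<bullet> x = b}"
    using ac(1) Fac by (intro exI[of _ "a /\<^sub>R norm a"] exI[of _ "c / norm a"]) (auto simp: field_simps)
  then have "case SOME (n, b). norm n = 1 \<and> F \<subseteq> {x. n \<bullet> x = b} of
      (n, b) \<Rightarrow> norm n = 1 \<and> F \<subseteq> {x. n \<bullet> x = b}"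
    by (intro someI_ex[of "\<lambda>(n, b). norm n = 1 \<and> F \<subseteq> {x. n \<bullet> x = b}"]) auto
  then show n1: "norm (face_normal F) = 1" and Fn: "F \<subseteq> {x. face_normal F \<bullet> x = face_offset F}"
    unfolding face_normal_def face_offset_def by (auto simp: case_prod_beta)
  define r where "r = (face_normal F \<bullet> a) / (a \<bullet> a)"
  have r: "face_normal F = r *\<^sub>R a" using par[OF Fn] by (simp add: r_def)
  then have r0: "r \<noteq> 0" using n1 by auto
  have "a \<bullet> y = c" "face_normal F \<bullet> y = face_offset F" using y Fac Fn by auto
  then have off: "face_offset F = r * c" using r by simp
  have "{x. face_normal F \<bullet> x = face_offset F} = {x. a \<bullet> x = c}"
    using r0 by (auto simp: r off)
  then show "openin (top_of_set {x. face_normal F \<bullet> x = face_offset F}) F" using ac(2) by simp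
  assume n: "norm n = 1" and Fb: "F \<subseteq> {x. n \<bullet> x = b}"
  obtain s where s: "n = s *\<^sub>R a" using par[OF Fb] by metis
  have "\<bar>s\<bar> * norm a = \<bar>r\<bar> * norm a" using n n1 r s by simp
  then have "\<bar>s\<bar> = \<bar>r\<bar>" using ac(1) by simp
  then consider "s = r" | "s = - r" by linarith
  moreover have "b = n \<bullet> y" "face_offset F = face_normal F \<bullet> y" using y Fb Fn by auto
  ultimately show "n = face_normal F \<and> b = face_offset F \<or> n = - face_normal F \<and> b = - face_offset F"
    using r s by cases auto
qed

lemma face_borel: "mesh_face F \<Longrightarrow> F \<in> sets borel"
proof -
  assume F: "mesh_face F"
  obtain U where "open U" "F = {x. face_normal F \<bullet> x = face_offset F} \<inter> U"
    using face_openin[OF F] by (auto simp: openin_open)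
  moreover have "closed {x. face_normal F \<bullet> x = face_offset F}" by (rule closed_hyperplane)
  ultimately show ?thesis by (metis borel_closed borel_open sets.Int)
qed

lemma rel_interior_face: "mesh_face F \<Longrightarrow> rel_interior F = F"
proof (rule rel_interior_openin)
  assume F: "mesh_face F"
  let ?P = "{x. face_normal F \<bullet> x = face_offset F}"
  have P: "affine hull ?P = ?P" by (simp only: affine_hyperplane affine_hull_eq)
  have "F \<noteq> {}" using F by (simp add: mesh_face_def)
  then have "affine hull F = ?P"
    using affine_hull_openin[of ?P F] face_openin[OF F] unfolding P by blast
  then show "openin (top_of_set (affine hull F)) F" using face_openin[OF F] by (simp only:)
qed

text \<open>Otherwise all points of a small ball around \<open>y\<close> would project orthogonally
  into \<open>N\<close>, and the ball would be a null set.\<close>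

lemma face_not_null:
  fixes F :: "'a::euclidean_space set"
  assumes F: "mesh_face F" and y: "y \<in> F" and \<epsilon>: "\<epsilon> > 0" and N: "N \<in> null_sets (face_lborel F)"
  shows "\<exists>z\<in>F - N. dist z y < \<epsilon>"
proof (rule ccontr)
  assume no: "\<not> (\<exists>z\<in>F - N. dist z y < \<epsilon>)"
  let ?n = "face_normal F" and ?b = "face_offset F"
  note n = norm_face_normal[OF F]
  obtain r where r: "r > 0" "ball y r \<inter> {x. ?n \<bullet> x = ?b} \<subseteq> F"
    using face_openin[OF F] y unfolding openin_contains_ball by auto
  have yb: "?n \<bullet> y = ?b" using face_subset_hyperplane[OF F] y by auto
  \<comment> \<open>The projection does not increase the distance to \<open>y\<close>:
    \<open>r\<close> keeps the projected point in \<open>F\<close>, \<open>\<epsilon>\<close> keeps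
    it close, and \<open>1/2\<close> keeps the ball inside the slab.\<close>
  define q where "q = min (min r \<epsilon>) (1/2)"
  have q: "q > 0" using r \<epsilon> by (simp add: q_def)
  have Nb: "N \<in> sets borel" using N by (auto simp: null_sets_def)
  have nn: "?n \<bullet> ?n = 1" using n by (simp add: dot_square_norm)
  have key: "indicator {?b - 1/2..?b - 1/2 + 1} (?n \<bullet> x) * indicator N (oblique_proj ?n ?b ?n x) = (1::ennreal)"
    if x: "x \<in> ball y q" for x
  proof -
    have d: "norm (x - y) < q" using x by (simp add: dist_norm norm_minus_commute)
    have eq: "?n \<bullet> x - ?b = ?n \<bullet> (x - y)" by (simp add: inner_diff_right yb)
    have "\<bar>?n \<bullet> (x - y)\<bar> \<le> norm (x - y)" using Cauchy_Schwarz_ineq2[of ?n "x - y"] n by simp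
    then have slab: "\<bar>?n \<bullet> x - ?b\<bar> \<le> 1/2" using d eq by (simp add: q_def)
    let ?p = "oblique_proj ?n ?b ?n x"
    have p: "?p - y = (x - y) - (?n \<bullet> (x - y)) *\<^sub>R ?n"
      by (simp add: oblique_proj_def nn eq)
    have "norm (?p - y) ^ 2 = norm (x - y) ^ 2 - (?n \<bullet> (x - y))\<^sup>2"
      unfolding p power2_norm_eq_inner
      by (simp add: inner_diff_left inner_diff_right nn inner_commute power2_eq_square algebra_simps)
    then have "norm (?p - y) ^ 2 \<le> norm (x - y) ^ 2" by simp
    then have "norm (?p - y) \<le> norm (x - y)" by (rule power2_le_imp_le) simp
    then have "dist ?p y < q" using d by (simp add: dist_norm)
    moreover have "?n \<bullet> ?p = ?b" by (rule oblique_proj_in_hyperplane) (simp add: nn)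
    ultimately have "?p \<in> F" "dist ?p y < \<epsilon>" using r(2) by (auto simp: q_def dist_commute)
    then have "?p \<in> N" using no by blast
    moreover have "?n \<bullet> x \<in> {?b - 1/2..?b - 1/2 + 1}"
      unfolding atLeastAtMost_iff using slab by linarith
    ultimately show ?thesis by (simp only: indicator_simps mult_1)
  qed
  have "emeasure lborel (ball y q) = (\<integral>\<^sup>+x. indicator (ball y q) x \<partial>lborel)" by simp
  also have "\<dots> \<le> (\<integral>\<^sup>+x. indicator {?b - 1/2..?b - 1/2 + 1} (?n \<bullet> x) * indicator N (oblique_proj ?n ?b ?n x) \<partial>lborel)"
  proof (intro nn_integral_mono)
    fix x
    show "indicator (ball y q) x \<le> indicator {?b - 1/2..?b - 1/2 + 1} (?n \<bullet> x) * (indicator N (oblique_proj ?n ?b ?n x) :: ennreal)"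
    proof (cases "x \<in> ball y q")
      case True
      then show ?thesis by (simp only: key indicator_simps order_refl)
    qed simp
  qed
  also have "\<dots> = emeasure (face_lborel F) N"
    unfolding face_lborel_eq by (rule emeasure_hyperplane_lborel[OF n Nb, symmetric])
  also have "\<dots> = 0" using N by auto
  finally have "ball y q \<in> null_sets lborel" by (auto simp: null_sets_def)
  moreover have "open (ball y q)" "ball y q \<noteq> {}" using q by auto
  ultimately show False
    using open_not_negligible negligible_iff_null_sets null_sets_completionI by blast
qed

text \<open>The prism over a set within radius \<open>R\<close> lies in the ball of radius
  \<open>R + 1\<close>.\<close>

lemma emeasure_face_lborel_bounded:
  fixes F :: "'a::euclidean_space set"
  assumes F: "mesh_face F" and A: "A \<in> sets borel" "bounded A"
  shows "emeasure (face_lborel F) A < \<infinity>"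
proof -
  let ?n = "face_normal F" and ?b = "face_offset F"
  note n = norm_face_normal[OF F]
  have nn: "?n \<bullet> ?n = 1" using n by (simp add: dot_square_norm)
  obtain R where R: "\<And>z. z \<in> A \<Longrightarrow> norm z \<le> R" using A(2) by (auto simp: bounded_iff)
  have le: "indicator {?b - 1/2..?b - 1/2 + 1} (?n \<bullet> x) * indicator A (oblique_proj ?n ?b ?n x)
      \<le> (indicator (cball (0::'a) (R + 1)) x :: ennreal)" for x
  proof (cases "?n \<bullet> x \<in> {?b - 1/2..?b - 1/2 + 1} \<and> oblique_proj ?n ?b ?n x \<in> A")
    case True
    have "x = oblique_proj ?n ?b ?n x + (?n \<bullet> x - ?b) *\<^sub>R ?n" by (simp add: oblique_proj_def nn)
    then have "norm x \<le> norm (oblique_proj ?n ?b ?n x) + \<bar>?n \<bullet> x - ?b\<bar>"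
      by (metis n norm_triangle_ineq norm_scaleR mult.right_neutral)
    also have "\<dots> \<le> R + 1" using True R by (intro add_mono) auto
    finally show ?thesis by (auto simp: indicator_def)
  qed (auto simp: indicator_def)
  have "(\<integral>\<^sup>+x. indicator {?b - 1/2..?b - 1/2 + 1} (?n \<bullet> x) * indicator A (oblique_proj ?n ?b ?n x) \<partial>lborel)
      \<le> (\<integral>\<^sup>+x. indicator (cball (0::'a) (R + 1)) x \<partial>lborel)"
    by (intro nn_integral_mono le)
  also have "\<dots> < \<infinity>" using emeasure_bounded_finite[of "cball (0::'a) (R + 1)"] by simp
  finally show ?thesis
    unfolding face_lborel_eq emeasure_hyperplane_lborel[OF n A(1)] .
qed

lemma integrable_face:
  fixes f :: "'a::euclidean_space \<Rightarrow> real"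
  assumes F: "mesh_face F" "bounded F" and f: "continuous_on UNIV f"
  shows "integrable (face_lborel F) (\<lambda>x. indicator F x *\<^sub>R f x)"
proof -
  have "compact (f ` closure F)"
    using F(2) f by (intro compact_continuous_image) (auto simp: compact_closure intro: continuous_on_subset)
  then have "bounded (f ` closure F)" by (rule compact_imp_bounded)
  then obtain B where B: "\<forall>x\<in>closure F. norm (f x) \<le> B" by (auto simp: bounded_iff)
  show ?thesis
  proof (rule integrableI_bounded_set_indicator[where B = B])
    show "F \<in> sets (face_lborel F)" using face_borel[OF F(1)] by simp
    show "f \<in> borel_measurable (face_lborel F)"
      using borel_measurable_continuous_onI[OF f] by simp
    show "emeasure (face_lborel F) F < \<infinity>"
      by (rule emeasure_face_lborel_bounded[OF F(1) face_borel[OF F(1)] F(2)])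
    show "AE x in face_lborel F. x \<in> F \<longrightarrow> norm (f x) \<le> B"
      using B closure_subset by blast
  qed
qed

definition crosses :: "'a::euclidean_space set \<Rightarrow> 'a \<Rightarrow> 'a \<Rightarrow> bool" where
  "crosses T n x \<longleftrightarrow> (\<forall>\<^sub>F t in at_right 0. x - t *\<^sub>R n \<in> T \<and> x + t *\<^sub>R n \<notin> T)"

text \<open>The only alternative is \<open>- n\<close>; then at almost every point of
  \<open>F\<close> the points \<open>x - t *\<^sub>R n\<close> would be both inside and outside
  \<open>T\<close> for small \<open>t\<close>, and \<open>F\<close> would be null.\<close>

lemma outward_normal_unique:
  assumes F: "mesh_face F" and n: "outward_normal T F n" and m: "outward_normal T F m"
  shows "m = n"
proof (rule ccontr)
  assume "m \<noteq> n"
  moreover obtain b c where "F \<subseteq> {x. n \<bullet> x = b}" "F \<subseteq> {x. m \<bullet> x = c}" "norm n = 1" "norm m = 1"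
    using n m by (auto simp: outward_normal_def)
  ultimately have mn: "m = - n"
    using face_normal_unique[OF F, of n b] face_normal_unique[OF F, of m c] by auto
  have "AE x in face_lborel F. x \<notin> F"
  proof -
    have "AE x in face_lborel F. x \<in> F \<longrightarrow> (\<forall>\<^sub>F t in at_right 0. x - t *\<^sub>R n \<in> T \<and> x + t *\<^sub>R n \<notin> T)"
      "AE x in face_lborel F. x \<in> F \<longrightarrow> (\<forall>\<^sub>F t in at_right 0. x - t *\<^sub>R m \<in> T \<and> x + t *\<^sub>R m \<notin> T)"
      using n m by (simp_all add: outward_normal_def)
    then show ?thesis
    proof eventually_elim
      case (elim x)
      show ?case
      proof
        assume "x \<in> F"
        then have "\<forall>\<^sub>F t in at_right 0. x - t *\<^sub>R n \<in> T \<and> x + t *\<^sub>R n \<notin> T"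
          "\<forall>\<^sub>F t in at_right 0. x - t *\<^sub>R m \<in> T \<and> x + t *\<^sub>R m \<notin> T"
          using elim by auto
        then have "\<forall>\<^sub>F t::real in at_right 0. False"
          by eventually_elim (simp add: mn)
        then show False by simp
    qed
  qed
  qed
  then obtain N where N: "N \<in> null_sets (face_lborel F)" "F \<subseteq> N"
    unfolding eventually_ae_filter by auto
  obtain y where "y \<in> F" using F by (auto simp: mesh_face_def)
  then show False using face_not_null[OF F _ zero_less_one N(1)] N(2) by blast
qed

section \<open>Consequences of the mesh axioms\<close>

locale hho_mesh = hho \<Omega> Th Fh k l stab
  for \<Omega> :: "'a::euclidean_space set" and Th Fh :: "'a set set" and k l :: nat and stab :: stabilization +
  assumes dim: "DIM('a) \<ge> 2"
    and domain: "open_polytope \<Omega>"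
    and mesh: "polytopal_mesh \<Omega> Th Fh"
    and degree: "l \<in> {k, k + 1}"
begin

lemma finite_Th: "finite Th" and finite_Fh: "finite Fh"
  using mesh by (simp_all add: polytopal_mesh_def)

lemma finite_elem_faces: "finite (elem_faces T)"
  using finite_Fh by (simp add: elem_faces_def)

lemma elem_polytope: "T \<in> Th \<Longrightarrow> open_polytope T"
  using mesh by (simp add: polytopal_mesh_def)

lemma elem_open: "T \<in> Th \<Longrightarrow> open T"
  using elem_polytope open_polytope_open by blast

lemma elem_bounded: "T \<in> Th \<Longrightarrow> bounded T"
  using elem_polytope open_polytope_bounded by blast

lemma elem_nonempty: "T \<in> Th \<Longrightarrow> T \<noteq> {}"
  using elem_polytope by (auto simp: open_polytope_def)

lemma elems_disjoint: "S \<in> Th \<Longrightarrow> T \<in> Th \<Longrightarrow> S \<inter> T \<noteq> {} \<Longrightarrow> S = T"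
  using mesh disjointD[of Th S T] by (auto simp: polytopal_mesh_def)

lemma faces_disjoint: "F \<in> Fh \<Longrightarrow> G \<in> Fh \<Longrightarrow> y \<in> F \<Longrightarrow> y \<in> G \<Longrightarrow> F = G"
  using mesh disjointD[of Fh F G] by (auto simp: polytopal_mesh_def)

lemma mesh_face: "F \<in> Fh \<Longrightarrow> mesh_face F"
  using mesh by (simp add: polytopal_mesh_def)

lemma face_cases:
  assumes "F \<in> Fh"
  obtains (interior) T1 T2 where "T1 \<in> Th" "T2 \<in> Th" "T1 \<noteq> T2" "F \<in> elem_faces T1" "F \<in> elem_faces T2"
  | (boundary) T where "T \<in> Th" "F \<in> elem_faces T" "F \<subseteq> frontier \<Omega>"
proof -
  have "(\<exists>T1\<in>Th. \<exists>T2\<in>Th. T1 \<noteq> T2 \<and> F \<subseteq> frontier T1 \<inter> frontier T2) \<or> (\<exists>T\<in>Th. F \<subseteq> frontier T \<inter> frontier \<Omega>)"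
    using mesh assms by (simp add: polytopal_mesh_def)
  then show thesis using assms that by (auto simp: elem_faces_def)
qed

lemma elem_faces_in_Fh: "F \<in> elem_faces T \<Longrightarrow> F \<in> Fh"
  by (simp add: elem_faces_def)

lemma face_bounded: "F \<in> Fh \<Longrightarrow> bounded F"
proof -
  assume "F \<in> Fh"
  then obtain T where "T \<in> Th" "F \<in> elem_faces T" using face_cases by metis
  then show ?thesis
    using bounded_subset[OF bounded_closure[OF elem_bounded]] by (auto simp: elem_faces_def frontier_def)
qed

lemma frontier_covered: "T \<in> Th \<Longrightarrow> y \<in> frontier T \<Longrightarrow> \<exists>F\<in>Fh. y \<in> closure F"
proof -
  assume "T \<in> Th" "y \<in> frontier T"
  moreover have "(\<Union>T\<in>Th. frontier T) = (\<Union>F\<in>Fh. closure F)" using mesh by (simp add: polytopal_mesh_def)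
  ultimately show ?thesis by blast
qed

lemma elem_subset_closure_domain: "T \<in> Th \<Longrightarrow> T \<subseteq> closure \<Omega>"
proof -
  have "(\<Union>T\<in>Th. closure T) = closure \<Omega>" using mesh by (simp add: polytopal_mesh_def)
  then show "T \<in> Th \<Longrightarrow> T \<subseteq> closure \<Omega>" using closure_subset by blast
qed

lemma elem_subset_domain: "T \<in> Th \<Longrightarrow> T \<subseteq> \<Omega>"
  using elem_subset_closure_domain elem_open interior_closure_open_polytope[OF domain]
  by (metis interior_maximal)

lemma outward_unit_normal:
  assumes "T \<in> Th" "F \<in> elem_faces T"
  shows "outward_normal T F (unit_normal T F)"
proof -
  have F: "F \<in> Fh" "F \<subseteq> frontier T" using assms(2) by (auto simp: elem_faces_def)
  then have "\<exists>n. outward_normal T F n" using mesh assms(1) by (simp add: polytopal_mesh_def)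
  then obtain n where n: "outward_normal T F n" ..
  then have "unit_normal T F = n"
    unfolding unit_normal_def using outward_normal_unique[OF mesh_face[OF F(1)]] by blast
  then show ?thesis using n by simp
qed

lemma unit_normal_cases:
  assumes "T \<in> Th" "F \<in> elem_faces T"
  shows "unit_normal T F = face_normal F \<or> unit_normal T F = - face_normal F"
  using outward_unit_normal[OF assms] face_normal_unique[OF mesh_face[OF elem_faces_in_Fh[OF assms(2)]]]
  unfolding outward_normal_def by blast

lemma norm_unit_normal: "T \<in> Th \<Longrightarrow> F \<in> elem_faces T \<Longrightarrow> norm (unit_normal T F) = 1"
  using outward_unit_normal by (simp add: outward_normal_def)

text \<open>Since there are finitely many elements, one null set per face serves all of them; it
  also absorbs the relative boundary.\<close>

lemma exceptional_points:
  assumes F: "F \<in> Fh"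
  shows "\<exists>N\<in>null_sets (face_lborel F). rel_frontier F \<subseteq> N \<and>
    (\<forall>T\<in>Th. F \<in> elem_faces T \<longrightarrow> (\<forall>x\<in>F - N. crosses T (unit_normal T F) x))"
proof -
  let ?P = "\<lambda>T. crosses T (unit_normal T F)"
  have "rel_frontier F \<in> null_sets (face_lborel F)"
    using mesh_face[OF F] by (auto simp: mesh_face_def null_sets_def closed_rel_frontier)
  then have "AE x in face_lborel F. x \<notin> rel_frontier F" by (rule AE_not_in)
  moreover have "AE x in face_lborel F. \<forall>T\<in>Th. F \<in> elem_faces T \<longrightarrow> x \<in> F \<longrightarrow> ?P T x"
  proof (rule AE_finite_allI[OF finite_Th])
    fix T assume "T \<in> Th"
    then show "AE x in face_lborel F. F \<in> elem_faces T \<longrightarrow> x \<in> F \<longrightarrow> ?P T x"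
      using outward_unit_normal[of T F] unfolding outward_normal_def crosses_def
      by (cases "F \<in> elem_faces T") auto
  qed
  ultimately have "AE x in face_lborel F. x \<notin> rel_frontier F \<and>
      (\<forall>T\<in>Th. F \<in> elem_faces T \<longrightarrow> x \<in> F \<longrightarrow> ?P T x)"
    by eventually_elim simp
  then obtain N where "N \<in> null_sets (face_lborel F)"
      "\<And>x. \<not> (x \<notin> rel_frontier F \<and> (\<forall>T\<in>Th. F \<in> elem_faces T \<longrightarrow> x \<in> F \<longrightarrow> ?P T x)) \<Longrightarrow> x \<in> N"
    unfolding eventually_ae_filter by auto
  then show ?thesis by blast
qed

lemma mesh_resolved:
  obtains H where "finite H" "\<And>T. T \<in> Th \<Longrightarrow> resolves H T"
proof -
  have "\<forall>T\<in>Th. \<exists>H. finite H \<and> resolves H T"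
    using elem_polytope by (intro ballI open_polytope_resolved)
  from bchoice[OF this] obtain h where h: "\<forall>T\<in>Th. finite (h T) \<and> resolves (h T) T" ..
  show thesis
  proof (rule that[of "\<Union>T\<in>Th. h T"])
    show "finite (\<Union>T\<in>Th. h T)" using finite_Th h by simp
    show "resolves (\<Union>T\<in>Th. h T) T" if "T \<in> Th" for T
      using h that by (auto intro: resolves_mono[of "h T"])
  qed
qed

text \<open>At a generic point of an interior face, both sides are occupied by the elements having it as a
  face. At a boundary face, a further element on the other side would contradict that \<open>\<Omega>\<close> has no
  slits.\<close>

lemma generic_frontier_point:
  assumes H: "\<And>T. T \<in> Th \<Longrightarrow> resolves H T"
    and F: "F \<in> Fh" and y: "y \<in> F"
    and out: "\<And>T. T \<in> Th \<Longrightarrow> F \<in> elem_faces T \<Longrightarrow> crosses T (unit_normal T F) y"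
    and gen: "generic_point H (face_normal F) y"
    and T: "T \<in> Th" "y \<in> frontier T"
  shows "F \<in> elem_faces T" "local_side T (unit_normal T F) y"
proof -
  have H': "local_side T n y \<or> local_side T (- n) y"
    if "T \<in> Th" "y \<in> frontier T" "n \<noteq> 0" "generic_point H n y" for T n
    using H that by (simp add: resolves_def)
  \<comment> \<open>Genericity leaves two orientations; the wrong one would place
    \<open>y + t *\<^sub>R ?n\<close> in \<open>S\<close>, against the crossing condition
    \<open>out\<close>.\<close>
  have side: "local_side S (unit_normal S F) y" if S: "S \<in> Th" "F \<in> elem_faces S" for S
  proof (rule ccontr)
    let ?n = "unit_normal S F"
    assume no: "\<not> local_side S ?n y"
    have n: "?n \<noteq> 0" "?n \<bullet> ?n > 0" using norm_unit_normal[OF S] by auto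
    have "generic_point H ?n y"
      using unit_normal_cases[OF S] gen by (auto simp: generic_point_minus)
    moreover have "y \<in> frontier S" using y S(2) by (auto simp: elem_faces_def)
    ultimately have "local_side S (- ?n) y" using H'[OF S(1) _ n(1)] no by blast
    from local_side_along[OF this, of "- ?n"]
    have "\<forall>\<^sub>F t in at_right 0. y + t *\<^sub>R ?n \<in> S" by eventually_elim (use n(2) in simp)
    then have "\<forall>\<^sub>F t::real in at_right 0. False"
      using out[OF S] unfolding crosses_def by eventually_elim simp
    then show False by simp
  qed
  have nz: "unit_normal S F \<noteq> 0" if "S \<in> Th" "F \<in> elem_faces S" for S
    using norm_unit_normal[OF that] by auto
  have T_side: "local_side T (unit_normal S F) y \<or> local_side T (- unit_normal S F) y"
    if S: "S \<in> Th" "F \<in> elem_faces S" for S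
    using H'[OF T(1,2) nz[OF S]] unit_normal_cases[OF S] gen by (auto simp: generic_point_minus)
  have meet: "T = S" if S: "S \<in> Th" "F \<in> elem_faces S" "local_side T (unit_normal S F) y" for S
    using local_side_meet[OF S(3) side[OF S(1,2)] nz[OF S(1,2)]] elems_disjoint[OF T(1) S(1)] by blast
  show FT: "F \<in> elem_faces T"
    using F
  proof (cases rule: face_cases)
    case (interior T1 T2)
    have "unit_normal T1 F \<noteq> unit_normal T2 F"
      using local_side_meet[OF side[OF interior(1,4)] _ nz[OF interior(1,4)], of T2]
        side[OF interior(2,5)] elems_disjoint[OF interior(1,2)] interior(3) by metis
    then have "unit_normal T2 F = - unit_normal T1 F"
      using unit_normal_cases[OF interior(1,4)] unit_normal_cases[OF interior(2,5)] by auto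
    then have "T = T1 \<or> T = T2"
      using T_side[OF interior(1,4)] meet[OF interior(1,4)] meet[OF interior(2,5)] by auto
    then show ?thesis using interior by auto
  next
    case (boundary S)
    let ?n = "unit_normal S F"
    show ?thesis
    proof (rule ccontr)
      assume "F \<notin> elem_faces T"
      then have "T \<noteq> S" using boundary by auto
      then have "local_side T (- ?n) y" using T_side[OF boundary(1,2)] meet[OF boundary(1,2)] by blast
      then obtain \<epsilon> where \<epsilon>: "\<epsilon> > 0" "\<And>z. z \<in> ball y \<epsilon> \<Longrightarrow> ?n \<bullet> y < ?n \<bullet> z \<Longrightarrow> z \<in> T"
        unfolding local_side_def by auto
      obtain \<delta> where \<delta>: "\<delta> > 0" "\<And>z. z \<in> ball y \<delta> \<Longrightarrow> ?n \<bullet> z < ?n \<bullet> y \<Longrightarrow> z \<in> S"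
        using side[OF boundary(1,2)] unfolding local_side_def by auto
      have "ball y (min \<epsilon> \<delta>) \<subseteq> closure \<Omega>"
      proof (rule dense_complement_hyperplane[OF nz[OF boundary(1,2)] closed_closure open_ball])
        fix z assume z: "z \<in> ball y (min \<epsilon> \<delta>)" "?n \<bullet> z \<noteq> ?n \<bullet> y"
        then have "z \<in> T \<or> z \<in> S" using \<epsilon>(2)[of z] \<delta>(2)[of z] by fastforce
        then show "z \<in> closure \<Omega>"
          using elem_subset_closure_domain[OF T(1)] elem_subset_closure_domain[OF boundary(1)] by blast
      qed
      then have "ball y (min \<epsilon> \<delta>) \<subseteq> interior (closure \<Omega>)" by (simp add: interior_maximal)
      then have "y \<in> \<Omega>"
        unfolding interior_closure_open_polytope[OF domain] using \<epsilon>(1) \<delta>(1) by auto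
      moreover have "y \<notin> \<Omega>"
        using boundary(3) y open_polytope_open[OF domain] by (auto simp: frontier_def interior_open)
      ultimately show False by simp
    qed
  qed
  show "local_side T (unit_normal T F) y" by (rule side[OF T(1) FT])
qed

section \<open>The divergence theorem on an element\<close>

lemma integrable_elem:
  fixes f :: "'a \<Rightarrow> real"
  assumes T: "T \<in> Th" and f: "continuous_on UNIV f"
  shows "integrable lborel (\<lambda>x. indicator T x *\<^sub>R f x)"
proof -
  have "integrable lborel (\<lambda>x. indicator (closure T) x *\<^sub>R f x)"
    using elem_bounded[OF T] f
    by (intro borel_integrable_compact) (auto simp: compact_closure intro: continuous_on_subset)
  then have "set_integrable lborel (closure T) f" by (simp add: set_integrable_def)
  then have "set_integrable lborel T f"
    by (rule set_integrable_subset) (use elem_open[OF T] in \<open>auto intro: closure_subset[THEN subsetD]\<close>)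
  then show ?thesis by (simp add: set_integrable_def)
qed

text \<open>The hypotheses \<open>trans\<close>, \<open>gen\<close> and \<open>notN\<close> hold for almost all \<open>x\<close>.\<close>

lemma integral_elem_line:
  fixes \<phi> \<phi>' :: "'a \<Rightarrow> real"
  assumes H: "\<And>T. T \<in> Th \<Longrightarrow> resolves H T"
    and N: "\<And>F. F \<in> Fh \<Longrightarrow> rel_frontier F \<subseteq> N F"
      "\<And>F T x. F \<in> Fh \<Longrightarrow> T \<in> Th \<Longrightarrow> F \<in> elem_faces T \<Longrightarrow> x \<in> F - N F \<Longrightarrow> crosses T (unit_normal T F) x"
    and T: "T \<in> Th" and e: "norm e = 1"
    and \<phi>: "\<And>x s. ((\<lambda>s. \<phi> (x + s *\<^sub>R e)) has_real_derivative \<phi>' (x + s *\<^sub>R e)) (at s)"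
      "continuous_on UNIV \<phi>'"
    and trans: "\<And>F. F \<in> Fh \<Longrightarrow> face_normal F \<bullet> e = 0 \<Longrightarrow> face_normal F \<bullet> x \<noteq> face_offset F"
    and gen: "\<And>F. F \<in> Fh \<Longrightarrow> face_normal F \<bullet> e \<noteq> 0 \<Longrightarrow>
        generic_point H (face_normal F) (oblique_proj (face_normal F) (face_offset F) e x)"
    and notN: "\<And>F. F \<in> Fh \<Longrightarrow> face_normal F \<bullet> e \<noteq> 0 \<Longrightarrow>
        oblique_proj (face_normal F) (face_offset F) e x \<notin> N F"
  shows "(\<integral>s. indicator T (x + s *\<^sub>R e) * \<phi>' (x + s *\<^sub>R e) \<partial>lborel) =
    (\<Sum>F\<in>elem_faces T. sgn (unit_normal T F \<bullet> e) *
       (indicator F (oblique_proj (face_normal F) (face_offset F) e x) *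
        \<phi> (oblique_proj (face_normal F) (face_offset F) e x)))"
proof -
  let ?p = "\<lambda>F. oblique_proj (face_normal F) (face_offset F) e x"
  \<comment> \<open>For transversal faces, the parameter at which the line meets the hyperplane of
    \<open>F\<close>.\<close>
  define d where "d F = - ((face_normal F \<bullet> x - face_offset F) / (face_normal F \<bullet> e))" for F
  have p: "?p F = x + d F *\<^sub>R e" for F by (simp add: oblique_proj_def d_def)
  define I where "I = {F \<in> elem_faces T. face_normal F \<bullet> e \<noteq> 0 \<and> ?p F \<in> F}"
  define J where "J F = sgn (unit_normal T F \<bullet> e)" for F
  define g where "g s = (indicator T (x + s *\<^sub>R e) :: real)" for s
  have e0: "e \<noteq> 0" using e by auto
  \<comment> \<open>The hit point lies in the closure of some face: \<open>trans\<close> excludes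
    faces parallel to \<open>e\<close>, \<open>notN\<close> excludes the relative boundary, and
    genericity makes the face one of \<open>T\<close>.\<close>
  have frontier_hit: "s \<in> d ` I" if s: "x + s *\<^sub>R e \<in> frontier T" for s
  proof -
    let ?y = "x + s *\<^sub>R e"
    obtain F where F: "F \<in> Fh" "?y \<in> closure F" using frontier_covered[OF T s] by blast
    note mF = mesh_face[OF F(1)]
    have "closure F \<subseteq> {z. face_normal F \<bullet> z = face_offset F}"
      using face_subset_hyperplane[OF mF] by (intro closure_minimal closed_hyperplane)
    then have yb: "face_normal F \<bullet> ?y = face_offset F" using F(2) by blast
    have ne: "face_normal F \<bullet> e \<noteq> 0"
      using trans[OF F(1)] yb by (auto simp: inner_add_right)
    have py: "?p F = ?y"
      using oblique_proj_invariant[OF ne, of "face_offset F" x s] yb by (simp add: oblique_proj_def[of _ _ _ "x + s *\<^sub>R e"])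
    have yN: "?y \<notin> N F" using notN[OF F(1) ne] py by simp
    then have "?y \<notin> rel_frontier F" using N(1)[OF F(1)] by blast
    then have yF: "?y \<in> F" using F(2) rel_interior_face[OF mF] by (simp add: rel_frontier_def)
    have "F \<in> elem_faces T"
      by (rule generic_frontier_point(1)[OF H F(1) yF _ _ T s])
        (use N(2)[OF F(1)] yF yN gen[OF F(1) ne] py in auto)
    then have "F \<in> I" using ne yF py by (simp add: I_def)
    moreover have "d F = s" using py p[of F] e0 by simp
    ultimately show ?thesis by blast
  qed
  obtain R where R: "\<And>z. z \<in> T \<Longrightarrow> norm z \<le> R" using elem_bounded[OF T] by (auto simp: bounded_iff)
  have cont_line: "continuous_on UNIV (\<lambda>s. x + s *\<^sub>R e)" by (intro continuous_intros)
  have "(\<integral>s. g s * \<phi>' (x + s *\<^sub>R e) \<partial>lborel) = (\<Sum>F\<in>I. J F * \<phi> (x + d F *\<^sub>R e))"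
  proof (rule integral_piecewise_constant[where J = J and R = "R + norm x" and
        \<psi> = "\<lambda>s. \<phi> (x + s *\<^sub>R e)" and \<psi>' = "\<lambda>s. \<phi>' (x + s *\<^sub>R e)"])
    show "finite I" using finite_elem_faces by (simp add: I_def)
    show "inj_on d I"
    proof (rule inj_onI)
      fix F G assume "F \<in> I" "G \<in> I" "d F = d G"
      then have "?p F \<in> F" "?p F \<in> G" "F \<in> Fh" "G \<in> Fh"
        by (auto simp: I_def p elem_faces_def)
      then show "F = G" using faces_disjoint by blast
    qed
    show "\<forall>\<^sub>F t in at s. g t = g s" if "s \<notin> d ` I" for s
    proof -
      have nf: "x + s *\<^sub>R e \<notin> frontier T" using frontier_hit that by blast
      have "\<exists>A. open A \<and> x + s *\<^sub>R e \<in> A \<and> (A \<subseteq> T \<or> A \<inter> T = {})"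
      proof (cases "x + s *\<^sub>R e \<in> T")
        case True
        then show ?thesis using elem_open[OF T] by blast
      next
        case False
        then have "x + s *\<^sub>R e \<in> - closure T"
          using nf elem_open[OF T] by (simp add: frontier_def interior_open)
        moreover have "open (- closure T)" by (rule open_Compl[OF closed_closure])
        ultimately show ?thesis using closure_subset[of T] by blast
      qed
      then obtain A where A: "open A" "x + s *\<^sub>R e \<in> A" "A \<subseteq> T \<or> A \<inter> T = {}" by blast
      have "open ((\<lambda>s. x + s *\<^sub>R e) -` A)" using A(1) cont_line by (rule open_vimage)
      then show ?thesis
        unfolding eventually_at_topological g_def
        using A(2,3) by (intro exI[of _ "(\<lambda>s. x + s *\<^sub>R e) -` A"]) (auto simp: indicator_def)
    qed
    show "\<exists>\<alpha> \<beta>. \<alpha> - \<beta> = J F \<and> (\<forall>\<^sub>F t in at_left (d F). g t = \<alpha>) \<and> (\<forall>\<^sub>F t in at_right (d F). g t = \<beta>)"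
      if "F \<in> I" for F
    proof -
      have F: "F \<in> elem_faces T" "F \<in> Fh" "face_normal F \<bullet> e \<noteq> 0" "?p F \<in> F"
        using that by (auto simp: I_def elem_faces_def)
      let ?n = "unit_normal T F" and ?y = "?p F"
      have yT: "?y \<in> frontier T" using F by (auto simp: elem_faces_def)
      have side: "local_side T ?n ?y"
        by (rule generic_frontier_point(2)[OF H F(2) F(4) _ _ T yT])
          (use N(2)[OF F(2)] F(4) notN[OF F(2,3)] gen[OF F(2,3)] in auto)
      have ne: "?n \<bullet> e \<noteq> 0" using unit_normal_cases[OF T F(1)] F(3) by auto
      have along: "\<forall>\<^sub>F t in at_right 0. ?n \<bullet> u > 0 \<longrightarrow> ?y - t *\<^sub>R u \<in> T \<and> ?y + t *\<^sub>R u \<notin> T" for u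
        by (rule local_side_along[OF side])
      have right: "(\<forall>\<^sub>F t in at_right (d F). P t) \<longleftrightarrow> (\<forall>\<^sub>F t in at_right 0. P (d F + t))"
        and left: "(\<forall>\<^sub>F t in at_left (d F). P t) \<longleftrightarrow> (\<forall>\<^sub>F t in at_right 0. P (d F - t))" for P
      proof -
        show "(\<forall>\<^sub>F t in at_right (d F). P t) \<longleftrightarrow> (\<forall>\<^sub>F t in at_right 0. P (d F + t))"
          by (subst eventually_at_right_to_0) (simp add: add.commute)
        show "(\<forall>\<^sub>F t in at_left (d F). P t) \<longleftrightarrow> (\<forall>\<^sub>F t in at_right 0. P (d F - t))"
          by (subst at_left_minus, subst eventually_filtermap, subst eventually_at_right_to_0) (simp add: algebra_simps)
      qed
      have pos: "x + (d F + t) *\<^sub>R e = ?y + t *\<^sub>R e" "x + (d F - t) *\<^sub>R e = ?y - t *\<^sub>R e" for t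
        by (simp_all add: p algebra_simps)
      show ?thesis
      \<comment> \<open>A positive product means that the line leaves \<open>T\<close> here, a
        negative one that it enters; the jump of the indicator, left value minus right value, is
        accordingly \<open>1\<close> or \<open>-1\<close>.\<close>
      proof (cases "?n \<bullet> e > 0")
        case True
        have "\<forall>\<^sub>F t in at_left (d F). g t = 1"
          unfolding left g_def pos using along[of e] by eventually_elim (use True in simp)
        moreover have "\<forall>\<^sub>F t in at_right (d F). g t = 0"
          unfolding right g_def pos using along[of e] by eventually_elim (use True in simp)
        ultimately show ?thesis using True by (intro exI[of _ 1] exI[of _ 0]) (simp add: J_def)
      next
        case False
        then have neg: "?n \<bullet> (- e) > 0" using ne by simp
        have "\<forall>\<^sub>F t in at_left (d F). g t = 0"
          unfolding left g_def pos using along[of "- e"] by eventually_elim (use neg in simp)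
        moreover have "\<forall>\<^sub>F t in at_right (d F). g t = 1"
          unfolding right g_def pos using along[of "- e"] by eventually_elim (use neg in simp)
        ultimately show ?thesis using neg by (intro exI[of _ 0] exI[of _ 1]) (simp add: J_def)
      qed
    qed
    show "\<bar>s\<bar> \<le> R + norm x" if "g s \<noteq> 0" for s
    proof -
      have "norm (x + s *\<^sub>R e) \<le> R" using that R by (auto simp: g_def indicator_def split: if_splits)
      moreover have "norm (s *\<^sub>R e) \<le> norm (x + s *\<^sub>R e) + norm x"
        using norm_triangle_ineq4[of "x + s *\<^sub>R e" x] by simp
      ultimately show ?thesis using e by simp
    qed
    show "((\<lambda>s. \<phi> (x + s *\<^sub>R e)) has_real_derivative \<phi>' (x + s *\<^sub>R e)) (at s)" for s by (rule \<phi>(1))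
    show "continuous_on UNIV (\<lambda>s. \<phi>' (x + s *\<^sub>R e))"
      by (rule continuous_on_compose2[OF \<phi>(2) cont_line]) simp
  qed
  also have "\<dots> = (\<Sum>F\<in>elem_faces T. J F * (indicator F (?p F) * \<phi> (?p F)))"
  proof (rule sum.mono_neutral_cong_left)
    show "finite (elem_faces T)" by (rule finite_elem_faces)
    show "I \<subseteq> elem_faces T" by (auto simp: I_def)
    \<comment> \<open>Faces parallel to \<open>e\<close> drop out through \<open>sgn 0 = 0\<close>,
      faces missed by the line through the indicator.\<close>
    show "\<forall>F\<in>elem_faces T - I. J F * (indicator F (?p F) * \<phi> (?p F)) = 0"
    proof
      fix F assume F: "F \<in> elem_faces T - I"
      then have "face_normal F \<bullet> e = 0 \<or> ?p F \<notin> F" by (auto simp: I_def)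
      then show "J F * (indicator F (?p F) * \<phi> (?p F)) = 0"
        using unit_normal_cases[OF T, of F] F by (auto simp: J_def)
    qed
    show "J F * \<phi> (x + d F *\<^sub>R e) = J F * (indicator F (?p F) * \<phi> (?p F))" if "F \<in> I" for F
      using that by (simp add: I_def p)
  qed
  finally show ?thesis by (simp add: g_def J_def)
qed

text \<open>When the identity on lines is integrated over the slab, the change of variables from
  slab to face brings in \<open>\<bar>n \<bullet> e\<bar>\<close>, which together with the sign of
  the crossing gives back \<open>unit_normal T F \<bullet> e\<close>. Faces parallel to
  \<open>e\<close> contribute zero.\<close>

lemma divergence:
  fixes \<phi> \<phi>' :: "'a \<Rightarrow> real"
  assumes T: "T \<in> Th" and e: "norm e = 1"
    and \<phi>: "\<And>x s. ((\<lambda>s. \<phi> (x + s *\<^sub>R e)) has_real_derivative \<phi>' (x + s *\<^sub>R e)) (at s)"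
      "continuous_on UNIV \<phi>" "continuous_on UNIV \<phi>'"
  shows "(LINT x:T|lborel. \<phi>' x) =
    (\<Sum>F\<in>elem_faces T. (unit_normal T F \<bullet> e) * (LINT x:F|face_lborel F. \<phi> x))"
proof -
  obtain H where H: "finite H" "\<And>T. T \<in> Th \<Longrightarrow> resolves H T" by (rule mesh_resolved) blast
  have "\<forall>F\<in>Fh. \<exists>M. M \<in> null_sets (face_lborel F) \<and> rel_frontier F \<subseteq> M \<and>
      (\<forall>T\<in>Th. F \<in> elem_faces T \<longrightarrow> (\<forall>x\<in>F - M. crosses T (unit_normal T F) x))"
    using exceptional_points by (auto simp: Bex_def)
  from bchoice[OF this] obtain N where N0: "\<forall>F\<in>Fh. N F \<in> null_sets (face_lborel F) \<and>
      rel_frontier F \<subseteq> N F \<and> (\<forall>T\<in>Th. F \<in> elem_faces T \<longrightarrow> (\<forall>x\<in>F - N F. crosses T (unit_normal T F) x))" ..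
  let ?p = "\<lambda>F. oblique_proj (face_normal F) (face_offset F) e"
  have AE_trans: "AE x in lborel. \<forall>F\<in>Fh. face_normal F \<bullet> e = 0 \<longrightarrow> face_normal F \<bullet> x \<noteq> face_offset F"
  proof (rule AE_finite_allI[OF finite_Fh])
    fix F assume "F \<in> Fh"
    then have "face_normal F \<noteq> 0" using norm_face_normal[OF mesh_face] by force
    from AE_notin_hyperplane[OF this, of "face_offset F"]
    show "AE x in lborel. face_normal F \<bullet> e = 0 \<longrightarrow> face_normal F \<bullet> x \<noteq> face_offset F"
      by eventually_elim simp
  qed
  have AE_N: "AE x in lborel. \<forall>F\<in>Fh. face_normal F \<bullet> e \<noteq> 0 \<longrightarrow> ?p F x \<notin> N F"
  proof (rule AE_finite_allI[OF finite_Fh])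
    fix F assume F: "F \<in> Fh"
    show "AE x in lborel. face_normal F \<bullet> e \<noteq> 0 \<longrightarrow> ?p F x \<notin> N F"
    proof (cases "face_normal F \<bullet> e = 0")
      case False
      have "N F \<in> null_sets (hyperplane_lborel (face_normal F) (face_offset F))"
        using N0 F by (simp add: face_lborel_eq)
      from AE_oblique_proj_notin_null[OF norm_face_normal[OF mesh_face[OF F]] e False this]
      show ?thesis by eventually_elim simp
    qed simp
  qed
  have AE_gen: "AE x in lborel. \<forall>F\<in>Fh. face_normal F \<bullet> e \<noteq> 0 \<longrightarrow> generic_point H (face_normal F) (?p F x)"
  proof (rule AE_finite_allI[OF finite_Fh])
    fix F assume F: "F \<in> Fh"
    let ?n = "face_normal F" and ?b = "face_offset F"
    show "AE x in lborel. ?n \<bullet> e \<noteq> 0 \<longrightarrow> generic_point H ?n (?p F x)"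
    proof (cases "?n \<bullet> e = 0")
      case ne: False
      have "AE x in lborel. \<forall>q\<in>H. fst q \<bullet> ?p F x = snd q \<longrightarrow> (\<forall>z. ?n \<bullet> z = ?b \<longrightarrow> fst q \<bullet> z = snd q)"
      proof (rule AE_finite_allI[OF H(1)])
        fix q assume "q \<in> H"
        define a c where "a = fst q" and "c = snd q"
        \<comment> \<open>As a function of \<open>x\<close>, \<open>a \<bullet> ?p F x\<close> is
          affine with gradient \<open>w\<close>. If \<open>w = 0\<close>, then \<open>a\<close> is a
          multiple of the face normal and is constant on the hyperplane of \<open>F\<close>;
          otherwise equality with \<open>c\<close> holds only on a null set.\<close>
        define r where "r = (a \<bullet> e) / (?n \<bullet> e)"
        define w where "w = a - r *\<^sub>R ?n"
        have ap: "a \<bullet> ?p F x = w \<bullet> x + r * ?b" for x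
          using ne by (simp add: oblique_proj_def w_def r_def inner_diff_right inner_diff_left field_simps)
        show "AE x in lborel. fst q \<bullet> ?p F x = snd q \<longrightarrow> (\<forall>z. ?n \<bullet> z = ?b \<longrightarrow> fst q \<bullet> z = snd q)"
        proof (cases "w = 0")
          case True
          then have az: "a \<bullet> z = r * ?b" if "?n \<bullet> z = ?b" for z using that by (simp add: w_def)
          have "a \<bullet> ?p F x = r * ?b" for x using ap[of x] True by simp
          then show ?thesis using az by (auto simp: a_def[symmetric] c_def[symmetric])
        next
          case False
          from AE_notin_hyperplane[OF this, of "c - r * ?b"]
          show ?thesis by eventually_elim (simp add: a_def[symmetric] c_def[symmetric] ap)
        qed
      qed
      then show ?thesis
      proof eventually_elim
        case (elim x)
        have "?n \<bullet> ?p F x = ?b" by (rule oblique_proj_in_hyperplane[OF ne])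
        then show ?case using elim unfolding generic_point_def case_prod_beta by simp
      qed
    qed simp
  qed
  define f where "f x = indicator T x * \<phi>' x" for x
  define G where "G F x = indicator F x * \<phi> x" for F x
  have f: "integrable lborel f"
    using integrable_elem[OF T \<phi>(3)] by (simp add: f_def[abs_def])
  have G_borel: "G F \<in> borel_measurable borel" if "F \<in> elem_faces T" for F
    unfolding G_def[abs_def]
    using face_borel[OF mesh_face[OF elem_faces_in_Fh[OF that]]] borel_measurable_continuous_onI[OF \<phi>(2)]
    by measurable
  have G_int: "integrable (face_lborel F) (G F)" if "F \<in> elem_faces T" for F
    using integrable_face[OF mesh_face face_bounded \<phi>(2)] elem_faces_in_Fh[OF that]
    by (simp add: G_def[abs_def])
  have line: "AE x in slab_measure e. (\<integral>s. f (x + s *\<^sub>R e) \<partial>lborel) =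
      (\<Sum>F\<in>elem_faces T. sgn (unit_normal T F \<bullet> e) * G F (?p F x))"
  proof (rule AE_slab_measure)
    show "AE x in lborel. (\<integral>s. f (x + s *\<^sub>R e) \<partial>lborel) =
      (\<Sum>F\<in>elem_faces T. sgn (unit_normal T F \<bullet> e) * G F (?p F x))"
      using AE_trans AE_N AE_gen
    proof eventually_elim
      case (elim x)
      show ?case
        unfolding f_def G_def
        by (rule integral_elem_line[where N = N, OF H(2) _ _ T e \<phi>(1,3)]) (use N0 elim in auto)
    qed
  qed
  have sgn_int: "integrable (slab_measure e) (\<lambda>x. sgn (unit_normal T F \<bullet> e) * G F (?p F x)) \<and>
      (\<integral>x. sgn (unit_normal T F \<bullet> e) * G F (?p F x) \<partial>slab_measure e)
        = (unit_normal T F \<bullet> e) * (\<integral>x. G F x \<partial>face_lborel F)" if F: "F \<in> elem_faces T" for F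
  proof (cases "face_normal F \<bullet> e = 0")
    case True
    then have "unit_normal T F \<bullet> e = 0" using unit_normal_cases[OF T F] by auto
    then show ?thesis by simp
  next
    case False
    note n = norm_face_normal[OF mesh_face[OF elem_faces_in_Fh[OF F]]]
    have "\<bar>face_normal F \<bullet> e\<bar> = \<bar>unit_normal T F \<bullet> e\<bar>" using unit_normal_cases[OF T F] by auto
    then have "sgn (unit_normal T F \<bullet> e) * \<bar>face_normal F \<bullet> e\<bar> = unit_normal T F \<bullet> e"
      by (simp add: sgn_mult_abs)
    moreover note integral_oblique_proj(1)[OF n e False G_borel[OF F], of "face_offset F"]
      integral_oblique_proj(2)[OF n e False G_borel[OF F], of "face_offset F"]
    ultimately show ?thesis
      using G_int[OF F] by (simp add: face_lborel_eq mult.assoc[symmetric])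
  qed
  have "(LINT x:T|lborel. \<phi>' x) = (\<integral>x. f x \<partial>lborel)"
    by (simp add: set_lebesgue_integral_def f_def)
  also have "\<dots> = (\<integral>x. (\<integral>s. f (x + s *\<^sub>R e) \<partial>lborel) \<partial>slab_measure e)"
    by (rule integral_slab_lines[OF e f])
  also have "\<dots> = (\<integral>x. (\<Sum>F\<in>elem_faces T. sgn (unit_normal T F \<bullet> e) * G F (?p F x)) \<partial>slab_measure e)"
  proof (rule integral_cong_AE[OF _ _ line])
    show "(\<lambda>x. \<integral>s. f (x + s *\<^sub>R e) \<partial>lborel) \<in> borel_measurable (slab_measure e)"
      by (rule measurable_slab_lines[OF e]) (use f in auto)
    show "(\<lambda>x. \<Sum>F\<in>elem_faces T. sgn (unit_normal T F \<bullet> e) * G F (?p F x)) \<in> borel_measurable (slab_measure e)"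
      by (intro borel_measurable_sum borel_measurable_integrable) (use sgn_int in blast)
  qed
  also have "\<dots> = (\<Sum>F\<in>elem_faces T. (unit_normal T F \<bullet> e) * (\<integral>x. G F x \<partial>face_lborel F))"
    using sgn_int by (subst Bochner_Integration.integral_sum) auto
  finally show ?thesis by (simp add: set_lebesgue_integral_def G_def)
qed

end

section \<open>Inner products and projections\<close>

text \<open>Continuity on the whole space makes products integrable on the bounded elements and
  faces; element polynomials qualify because they are kept in their global form.\<close>

definition cont_funs :: "('a::topological_space \<Rightarrow> 'b::real_normed_vector) set" where
  "cont_funs = {f. continuous_on UNIV f}"

text \<open>Face polynomials are extended by zero and thus discontinuous in general, so continuity
  is required of the trace on \<open>F\<close> only.\<close>

definition face_cont_funs :: "'a::topological_space set \<Rightarrow> ('a \<Rightarrow> real) set" where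
  "face_cont_funs F = {f. \<exists>g\<in>cont_funs. \<forall>x\<in>F. f x = g x}"

lemma subspace_cont_funs: "subspace cont_funs"
  unfolding subspace_def cont_funs_def
  by (auto simp: plus_fun_def scaleR_fun_def zero_fun_def intro!: continuous_intros)

lemma subspace_face_cont_funs: "subspace (face_cont_funs F)"
proof -
  have "c *\<^sub>R f + g \<in> face_cont_funs F" if fg: "f \<in> face_cont_funs F" "g \<in> face_cont_funs F" for f g c
  proof -
    obtain f' g' where "f' \<in> cont_funs" "\<forall>x\<in>F. f x = f' x" "g' \<in> cont_funs" "\<forall>x\<in>F. g x = g' x"
      using fg unfolding face_cont_funs_def by blast
    then have "c *\<^sub>R f' + g' \<in> cont_funs" "\<forall>x\<in>F. (c *\<^sub>R f + g) x = (c *\<^sub>R f' + g') x"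
      using subspace_cont_funs by (auto simp: fun_apply intro!: subspace_comb)
    then show ?thesis unfolding face_cont_funs_def by blast
  qed
  moreover have "0 \<in> face_cont_funs F"
    using subspace_0[OF subspace_cont_funs] by (auto simp: face_cont_funs_def)
  ultimately show ?thesis by (intro subspaceI_comb)
qed

lemma polys_subset_cont: "polys m \<subseteq> cont_funs"
  by (auto simp: cont_funs_def continuous_on_polys)

lemma cont_subset_face_cont: "cont_funs \<subseteq> face_cont_funs F"
  by (auto simp: face_cont_funs_def)

lemma polys_on_subset_face_cont: "polys_on m F \<subseteq> face_cont_funs F"
  using polys_subset_cont[of m] by (auto simp: polys_on_def face_cont_funs_def subset_iff)

lemma polys_cont: "p \<in> polys m \<Longrightarrow> p \<in> cont_funs"
  using polys_subset_cont by blast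

lemma cont_face_cont: "f \<in> cont_funs \<Longrightarrow> f \<in> face_cont_funs F"
  using cont_subset_face_cont by blast

lemma polys_on_face_cont: "q \<in> polys_on m F \<Longrightarrow> q \<in> face_cont_funs F"
  using polys_on_subset_face_cont by blast

lemma linear_map_on_diff_fun:
  assumes "subspace W" "linear_map_on V W f" "linear_map_on V W g"
  shows "linear_map_on V W (\<lambda>v. f v - g v)"
  using assms unfolding linear_map_on_def by (auto simp: subspace_diff scaleR_diff_right)

lemma linear_map_on_subset: "linear_map_on V W f \<Longrightarrow> W \<subseteq> W' \<Longrightarrow> linear_map_on V W' f"
  unfolding linear_map_on_def by blast

lemma face_ip_cong:
  "(\<And>x. x \<in> F \<Longrightarrow> f x = f' x) \<Longrightarrow> (\<And>x. x \<in> F \<Longrightarrow> g x = g' x) \<Longrightarrow> face_ip F f g = face_ip F f' g'"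
  unfolding face_ip_def set_lebesgue_integral_def
  by (intro Bochner_Integration.integral_cong) (auto simp: indicator_def)

lemma psd_form_set_integral:
  fixes V :: "('a \<Rightarrow> 'b::real_inner) set"
  assumes V: "subspace V"
    and int: "\<And>f g. f \<in> V \<Longrightarrow> g \<in> V \<Longrightarrow> integrable M (\<lambda>x. indicator A x *\<^sub>R (f x \<bullet> g x))"
  shows "psd_form V (\<lambda>f g. LINT x:A|M. f x \<bullet> g x)"
proof -
  have "(LINT x:A|M. (c *\<^sub>R u + v) x \<bullet> w x) = c * (LINT x:A|M. u x \<bullet> w x) + (LINT x:A|M. v x \<bullet> w x)"
    if "u \<in> V" "v \<in> V" "w \<in> V" for u v w c
  proof -
    have "indicator A x *\<^sub>R ((c *\<^sub>R u + v) x \<bullet> w x) =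
        c * (indicator A x *\<^sub>R (u x \<bullet> w x)) + indicator A x *\<^sub>R (v x \<bullet> w x)" for x
      by (simp add: fun_apply inner_add_left algebra_simps)
    then show ?thesis
      unfolding set_lebesgue_integral_def using int[OF that(1,3)] int[OF that(2,3)] by simp
  qed
  then show ?thesis
    by (simp add: psd_form_def V inner_commute) (simp add: set_lebesgue_integral_def)
qed

lemma AE_zero_set_integral:
  fixes f :: "'a \<Rightarrow> 'b::real_inner"
  assumes int: "integrable M (\<lambda>x. indicator A x *\<^sub>R (f x \<bullet> f x))" and 0: "(LINT x:A|M. f x \<bullet> f x) = 0"
  shows "AE x in M. x \<in> A \<longrightarrow> f x = 0"
proof -
  have "AE x in M. indicator A x *\<^sub>R (f x \<bullet> f x) = 0"
    using 0 unfolding set_lebesgue_integral_def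
    by (subst (asm) integral_nonneg_eq_0_iff_AE[OF int]) auto
  then show ?thesis by eventually_elim auto
qed

lemma continuous_AE_zero_on_open:
  fixes f :: "'a::euclidean_space \<Rightarrow> 'b::real_normed_vector"
  assumes T: "open T" and f: "continuous_on UNIV f" and ae: "AE x in lborel. x \<in> T \<longrightarrow> f x = 0" and x: "x \<in> T"
  shows "f x = 0"
proof (rule ccontr)
  assume "f x \<noteq> 0"
  let ?U = "T \<inter> f -` (- {0})"
  have "open ?U" using T f by (intro open_Int open_vimage open_Compl) auto
  moreover have "x \<in> ?U" using x \<open>f x \<noteq> 0\<close> by simp
  moreover have "negligible ?U"
  proof -
    obtain N where N: "N \<in> null_sets lborel" "{x. \<not> (x \<in> T \<longrightarrow> f x = 0)} \<subseteq> N"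
      using ae unfolding eventually_ae_filter by auto
    then have "negligible N" using negligible_iff_null_sets null_sets_completionI by blast
    moreover have "?U \<subseteq> N" using N(2) by auto
    ultimately show ?thesis by (rule negligible_subset)
  qed
  ultimately show False using open_not_negligible by blast
qed

context hho_mesh
begin

lemma integrable_elem_inner:
  fixes f g :: "'a \<Rightarrow> 'b::euclidean_space"
  assumes "T \<in> Th" "f \<in> cont_funs" "g \<in> cont_funs"
  shows "integrable lborel (\<lambda>x. indicator T x *\<^sub>R (f x \<bullet> g x))"
  using assms by (intro integrable_elem) (auto simp: cont_funs_def intro!: continuous_intros)

lemma elem_vec_ip_eq: "elem_vec_ip T = (\<lambda>f g. LINT x:T|lborel. f x \<bullet> g x)"
  and elem_ip_eq: "elem_ip T = (\<lambda>f g. LINT x:T|lborel. f x \<bullet> g x)"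
  and face_ip_eq: "face_ip F = (\<lambda>f g. LINT x:F|face_lborel F. f x \<bullet> g x)"
  by (simp_all add: elem_vec_ip_def[abs_def] elem_ip_def[abs_def] face_ip_def[abs_def])

lemma psd_elem_vec_ip: "T \<in> Th \<Longrightarrow> psd_form cont_funs (elem_vec_ip T)"
  and psd_elem_ip: "T \<in> Th \<Longrightarrow> psd_form cont_funs (elem_ip T)"
  unfolding elem_vec_ip_eq elem_ip_eq
  by (intro psd_form_set_integral subspace_cont_funs integrable_elem_inner; assumption)+

lemma elem_inner_zero:
  fixes f :: "'a \<Rightarrow> 'b::euclidean_space"
  assumes T: "T \<in> Th" and f: "f \<in> cont_funs" "(LINT x:T|lborel. f x \<bullet> f x) = 0" and x: "x \<in> T"
  shows "f x = 0"
proof (rule continuous_AE_zero_on_open[OF elem_open[OF T] _ _ x])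
  show "continuous_on UNIV f" using f(1) by (simp add: cont_funs_def)
  show "AE x in lborel. x \<in> T \<longrightarrow> f x = 0"
    by (rule AE_zero_set_integral[OF integrable_elem_inner[OF T f(1) f(1)] f(2)])
qed

lemma elem_vec_ip_zero: "T \<in> Th \<Longrightarrow> f \<in> cont_funs \<Longrightarrow> elem_vec_ip T f f = 0 \<Longrightarrow> x \<in> T \<Longrightarrow> f x = 0"
  and elem_ip_zero: "T \<in> Th \<Longrightarrow> g \<in> cont_funs \<Longrightarrow> elem_ip T g g = 0 \<Longrightarrow> x \<in> T \<Longrightarrow> g x = 0"
  unfolding elem_vec_ip_eq elem_ip_eq by (rule elem_inner_zero; assumption)+

lemma elem_ip_polys_zero: "T \<in> Th \<Longrightarrow> p \<in> polys m \<Longrightarrow> elem_ip T p p = 0 \<Longrightarrow> p = 0"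
  using elem_ip_zero polys_subset_cont polys_vanishing elem_open elem_nonempty by (meson subsetD)

lemma integrable_face_product:
  assumes F: "F \<in> Fh" and fg: "f \<in> face_cont_funs F" "g \<in> face_cont_funs F"
  shows "integrable (face_lborel F) (\<lambda>x. indicator F x *\<^sub>R (f x * g x))"
proof -
  obtain f' g' where f': "f' \<in> cont_funs" "\<forall>x\<in>F. f x = f' x" and g': "g' \<in> cont_funs" "\<forall>x\<in>F. g x = g' x"
    using fg unfolding face_cont_funs_def by blast
  have "integrable (face_lborel F) (\<lambda>x. indicator F x *\<^sub>R (f' x * g' x))"
    using f' g' by (intro integrable_face mesh_face face_bounded F)
      (auto simp: cont_funs_def intro!: continuous_intros)
  moreover have "indicator F x *\<^sub>R (f' x * g' x) = indicator F x *\<^sub>R (f x * g x)" for x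
    using f' g' by (auto simp: indicator_def)
  ultimately show ?thesis by (simp only:)
qed

lemma psd_face_ip: "F \<in> Fh \<Longrightarrow> psd_form (face_cont_funs F) (face_ip F)"
  unfolding face_ip_eq
  by (intro psd_form_set_integral subspace_face_cont_funs) (drule (2) integrable_face_product, simp)

text \<open>A nonzero value persists near \<open>x\<close> by continuity, and by
  \<open>face_not_null\<close> this part of the face does not fit into a null set.\<close>

lemma face_ip_zero:
  assumes F: "F \<in> Fh" and f: "f \<in> face_cont_funs F" "face_ip F f f = 0" and x: "x \<in> F"
  shows "f x = 0"
proof (rule ccontr)
  assume fx: "f x \<noteq> 0"
  obtain g where g: "continuous_on UNIV g" "\<forall>x\<in>F. f x = g x"
    using f(1) by (auto simp: face_cont_funs_def cont_funs_def)
  have "AE x in face_lborel F. x \<in> F \<longrightarrow> f x = 0"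
    using f integrable_face_product[OF F f(1) f(1)] by (intro AE_zero_set_integral) (simp_all add: face_ip_eq)
  then obtain N where N: "N \<in> null_sets (face_lborel F)" "\<And>z. z \<in> F \<Longrightarrow> f z \<noteq> 0 \<Longrightarrow> z \<in> N"
    unfolding eventually_ae_filter by auto
  have "open (g -` (- {0}))" using g(1) by (intro open_vimage open_Compl) auto
  moreover have "x \<in> g -` (- {0})" using fx g(2) x by auto
  ultimately obtain \<epsilon> where \<epsilon>: "\<epsilon> > 0" "\<And>z. dist z x < \<epsilon> \<Longrightarrow> g z \<noteq> 0"
    unfolding open_dist by auto
  obtain z where "z \<in> F - N" "dist z x < \<epsilon>"
    using face_not_null[OF mesh_face[OF F] x \<epsilon>(1) N(1)] by blast
  then show False using N(2)[of z] \<epsilon>(2)[of z] g(2) by auto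
qed

lemma polys_on_zero: "F \<in> Fh \<Longrightarrow> q \<in> polys_on m F \<Longrightarrow> face_ip F q q = 0 \<Longrightarrow> q = 0"
proof
  fix x assume "F \<in> Fh" "q \<in> polys_on m F" "face_ip F q q = 0"
  then show "q x = 0 x"
    using face_ip_zero[of F q x] polys_on_subset_face_cont
    by (cases "x \<in> F") (auto simp: polys_on_def zero_fun_def)
qed

lemma linear_map_on_ip:
  "psd_form W B \<Longrightarrow> V \<subseteq> W \<Longrightarrow> f \<in> W \<Longrightarrow> linear_map_on V UNIV (B f)"
  unfolding linear_map_on_def using psd_comb_right by (fastforce simp: subset_iff)

lemma
  assumes T: "T \<in> Th"
  shows elem_proj_linear: "linear_map_on cont_funs (polys m) (elem_proj m T)"
    and elem_proj_id: "p \<in> polys m \<Longrightarrow> elem_proj m T p = p"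
proof -
  note B = psd_elem_ip[OF T] and pc = polys_subset_cont[of m]
  have Bp: "psd_form (polys m) (elem_ip T)"
    by (rule psd_form_subset[OF B subspace_polys pc])
  have ex: "\<exists>!p. p \<in> polys m \<and> (\<forall>q\<in>polys m. elem_ip T p q = elem_ip T f q)" if "f \<in> cont_funs" for f
    by (rule riesz_unique[OF finite_dim_polys Bp linear_map_on_ip[OF B pc that]])
      (rule elem_ip_polys_zero[OF T])
  show "linear_map_on cont_funs (polys m) (elem_proj m T)"
    unfolding elem_proj_def
  proof (rule linear_map_on_the[OF subspace_polys subspace_cont_funs ex])
    fix u v p q :: "'a \<Rightarrow> real" and c
    assume *: "u \<in> cont_funs" "v \<in> cont_funs" "p \<in> polys m" "q \<in> polys m"
      "\<forall>w\<in>polys m. elem_ip T p w = elem_ip T u w" "\<forall>w\<in>polys m. elem_ip T q w = elem_ip T v w"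
    show "\<forall>w\<in>polys m. elem_ip T (c *\<^sub>R p + q) w = elem_ip T (c *\<^sub>R u + v) w"
    proof
      fix w :: "'a \<Rightarrow> real" assume w: "w \<in> polys m"
      then have "p \<in> cont_funs" "q \<in> cont_funs" "w \<in> cont_funs" using * pc by auto
      then show "elem_ip T (c *\<^sub>R p + q) w = elem_ip T (c *\<^sub>R u + v) w"
        using * w psd_comb_left[OF B, of p q w c] psd_comb_left[OF B, of u v w c] by simp
    qed
  qed
  assume p: "p \<in> polys m"
  then show "elem_proj m T p = p"
    unfolding elem_proj_def using ex[of p] pc by (intro the1_equality) auto
qed

text \<open>\<open>face_proj_eq\<close> asks for agreement on \<open>F\<close> only, since element
  functions and zero-extended face polynomials differ off the face.\<close>

lemma
  assumes F: "F \<in> Fh"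
  shows face_proj_linear: "linear_map_on (face_cont_funs F) (polys_on m F) (face_proj m F)"
    and face_proj_ip: "f \<in> face_cont_funs F \<Longrightarrow> q \<in> polys_on m F \<Longrightarrow>
      face_ip F (face_proj m F f) q = face_ip F f q"
    and face_proj_eq: "p \<in> polys_on m F \<Longrightarrow> (\<And>x. x \<in> F \<Longrightarrow> f x = p x) \<Longrightarrow> face_proj m F f = p"
proof -
  note B = psd_face_ip[OF F] and pc = polys_on_subset_face_cont[of m F]
  have Bp: "psd_form (polys_on m F) (face_ip F)"
    by (rule psd_form_subset[OF B subspace_polys_on pc])
  have ex: "\<exists>!p. p \<in> polys_on m F \<and> (\<forall>q\<in>polys_on m F. face_ip F p q = face_ip F f q)"
    if "f \<in> face_cont_funs F" for f
    by (rule riesz_unique[OF finite_dim_polys_on Bp linear_map_on_ip[OF B pc that]])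
      (rule polys_on_zero[OF F])
  show "linear_map_on (face_cont_funs F) (polys_on m F) (face_proj m F)"
    unfolding face_proj_def
  proof (rule linear_map_on_the[OF subspace_polys_on subspace_face_cont_funs ex])
    fix u v p q :: "'a \<Rightarrow> real" and c
    assume *: "u \<in> face_cont_funs F" "v \<in> face_cont_funs F" "p \<in> polys_on m F" "q \<in> polys_on m F"
      "\<forall>w\<in>polys_on m F. face_ip F p w = face_ip F u w" "\<forall>w\<in>polys_on m F. face_ip F q w = face_ip F v w"
    show "\<forall>w\<in>polys_on m F. face_ip F (c *\<^sub>R p + q) w = face_ip F (c *\<^sub>R u + v) w"
    proof
      fix w :: "'a \<Rightarrow> real" assume w: "w \<in> polys_on m F"
      then have "p \<in> face_cont_funs F" "q \<in> face_cont_funs F" "w \<in> face_cont_funs F" using * pc by auto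
      then show "face_ip F (c *\<^sub>R p + q) w = face_ip F (c *\<^sub>R u + v) w"
        using * w psd_comb_left[OF B, of p q w c] psd_comb_left[OF B, of u v w c] by simp
    qed
  qed
  show "f \<in> face_cont_funs F \<Longrightarrow> q \<in> polys_on m F \<Longrightarrow> face_ip F (face_proj m F f) q = face_ip F f q"
    unfolding face_proj_def using theI'[OF ex, of f] by blast
  assume p: "p \<in> polys_on m F" and eq: "\<And>x. x \<in> F \<Longrightarrow> f x = p x"
  have f: "f \<in> face_cont_funs F" using p pc eq unfolding face_cont_funs_def by fastforce
  have "face_ip F p q = face_ip F f q" for q by (rule face_ip_cong) (simp_all add: eq)
  then show "face_proj m F f = p"
    unfolding face_proj_def using ex[OF f] p by (intro the1_equality) auto
qed

section \<open>Integration by parts\<close>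

text \<open>For each basis vector \<open>i\<close>, the divergence theorem in direction
  \<open>i\<close> is applied to \<open>v\<close> times the partial derivative of \<open>w\<close>
  along \<open>i\<close>.\<close>

lemma green:
  assumes T: "T \<in> Th" and v: "v \<in> polys m" and w: "w \<in> polys m'"
  shows "elem_vec_ip T (grad v) (grad w) =
    - elem_ip T v (laplacian w) + (\<Sum>F\<in>elem_faces T. face_ip F v (\<lambda>x. grad w x \<bullet> unit_normal T F))"
proof -
  define \<phi> where "\<phi> i x = v x * partial i w x" for i x
  define \<phi>' where "\<phi>' i x = v x * partial i (partial i w) x + partial i v x * partial i w x" for i x
  have cont: "continuous_on UNIV v" "continuous_on UNIV (partial i w)" "continuous_on UNIV (partial i v)"
      "continuous_on UNIV (partial i (partial i w))" if "i \<in> Basis" for i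
    using continuous_on_polys[OF v] continuous_on_partial[OF w that] continuous_on_partial[OF v that]
      continuous_on_partial[OF partial_in_polys_same[OF w that] that] by auto
  have div: "(LINT x:T|lborel. \<phi>' i x) =
      (\<Sum>F\<in>elem_faces T. (unit_normal T F \<bullet> i) * (LINT x:F|face_lborel F. \<phi> i x))"
    if i: "i \<in> Basis" for i
  proof (rule divergence[OF T])
    show "norm i = 1" using i by simp
    show "((\<lambda>s. \<phi> i (x + s *\<^sub>R i)) has_real_derivative \<phi>' i (x + s *\<^sub>R i)) (at s)" for x s
    proof -
      have "((\<lambda>s. v (x + s *\<^sub>R i)) has_real_derivative partial i v (x + s *\<^sub>R i)) (at s)"
        "((\<lambda>s. partial i w (x + s *\<^sub>R i)) has_real_derivative partial i (partial i w) (x + s *\<^sub>R i)) (at s)"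
        by (intro has_real_derivative_partial differentiable_polys[OF v]
            differentiable_polys[OF partial_in_polys_same[OF w i]])+
      from DERIV_mult[OF this] show ?thesis by (simp add: \<phi>_def \<phi>'_def algebra_simps)
    qed
    show "continuous_on UNIV (\<phi> i)" "continuous_on UNIV (\<phi>' i)"
      unfolding \<phi>_def[abs_def] \<phi>'_def[abs_def] using cont[OF i] by (auto intro!: continuous_intros)
  qed
  have int: "integrable lborel (\<lambda>x. indicator T x *\<^sub>R (v x * partial i (partial i w) x))"
      "integrable lborel (\<lambda>x. indicator T x *\<^sub>R (partial i v x * partial i w x))" if "i \<in> Basis" for i
    by (intro integrable_elem[OF T] continuous_intros cont[OF that])+
  have intF: "integrable (face_lborel F) (\<lambda>x. indicator F x *\<^sub>R \<phi> i x)"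
    if "F \<in> elem_faces T" "i \<in> Basis" for F i
    unfolding \<phi>_def using cont[OF that(2)] elem_faces_in_Fh[OF that(1)]
    by (intro integrable_face mesh_face face_bounded) (auto intro!: continuous_intros)
  have "elem_vec_ip T (grad v) (grad w) + elem_ip T v (laplacian w) = (\<Sum>i\<in>Basis. LINT x:T|lborel. \<phi>' i x)"
  proof -
    have "elem_vec_ip T (grad v) (grad w) =
        (\<integral>x. (\<Sum>i\<in>Basis. indicator T x *\<^sub>R (partial i v x * partial i w x)) \<partial>lborel)"
      unfolding elem_vec_ip_def set_lebesgue_integral_def
      by (simp add: inner_grad_grad sum_distrib_left)
    also have "\<dots> = (\<Sum>i\<in>Basis. \<integral>x. indicator T x *\<^sub>R (partial i v x * partial i w x) \<partial>lborel)"
      by (rule Bochner_Integration.integral_sum) (rule int)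
    finally have 1: "elem_vec_ip T (grad v) (grad w) = \<dots>" .
    have "elem_ip T v (laplacian w) =
        (\<integral>x. (\<Sum>i\<in>Basis. indicator T x *\<^sub>R (v x * partial i (partial i w) x)) \<partial>lborel)"
      unfolding elem_ip_def set_lebesgue_integral_def
      by (simp add: laplacian_eq sum_distrib_left)
    also have "\<dots> = (\<Sum>i\<in>Basis. \<integral>x. indicator T x *\<^sub>R (v x * partial i (partial i w) x) \<partial>lborel)"
      by (rule Bochner_Integration.integral_sum) (rule int)
    finally have 2: "elem_ip T v (laplacian w) = \<dots>" .
    have "(LINT x:T|lborel. \<phi>' i x) = (\<integral>x. indicator T x *\<^sub>R (v x * partial i (partial i w) x) \<partial>lborel)
        + (\<integral>x. indicator T x *\<^sub>R (partial i v x * partial i w x) \<partial>lborel)" if "i \<in> Basis" for i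
      unfolding set_lebesgue_integral_def \<phi>'_def scaleR_add_right
      by (rule Bochner_Integration.integral_add) (rule int[OF that])+
    then show ?thesis unfolding 1 2 by (simp add: sum.distrib)
  qed
  also have "\<dots> = (\<Sum>i\<in>Basis. \<Sum>F\<in>elem_faces T. (unit_normal T F \<bullet> i) * (LINT x:F|face_lborel F. \<phi> i x))"
    using div by simp
  also have "\<dots> = (\<Sum>F\<in>elem_faces T. \<Sum>i\<in>Basis. (unit_normal T F \<bullet> i) * (LINT x:F|face_lborel F. \<phi> i x))"
    by (rule sum.swap)
  also have "\<dots> = (\<Sum>F\<in>elem_faces T. face_ip F v (\<lambda>x. grad w x \<bullet> unit_normal T F))"
  proof (rule sum.cong[OF refl])
    fix F assume F: "F \<in> elem_faces T"
    have "face_ip F v (\<lambda>x. grad w x \<bullet> unit_normal T F) =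
        (\<integral>x. (\<Sum>i\<in>Basis. (unit_normal T F \<bullet> i) * (indicator F x *\<^sub>R \<phi> i x)) \<partial>face_lborel F)"
      unfolding face_ip_def set_lebesgue_integral_def
      by (intro Bochner_Integration.integral_cong) (simp_all add: inner_grad \<phi>_def sum_distrib_left mult_ac)
    also have "\<dots> = (\<Sum>i\<in>Basis. (unit_normal T F \<bullet> i) * (LINT x:F|face_lborel F. \<phi> i x))"
      unfolding set_lebesgue_integral_def
      by (subst Bochner_Integration.integral_sum) (use intF[OF F] in auto)
    finally show "(\<Sum>i\<in>Basis. (unit_normal T F \<bullet> i) * (LINT x:F|face_lborel F. \<phi> i x)) =
        face_ip F v (\<lambda>x. grad w x \<bullet> unit_normal T F)" ..
  qed
  finally show ?thesis by simp
qed

lemma elem_volume: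
  assumes T: "T \<in> Th" and i: "i \<in> Basis"
  shows "elem_ip T (\<lambda>_. 1) (\<lambda>_. 1) =
    (\<Sum>F\<in>elem_faces T. (unit_normal T F \<bullet> i) * (LINT x:F|face_lborel F. x \<bullet> i))"
proof -
  have "(LINT x:T|lborel. (1::real)) =
      (\<Sum>F\<in>elem_faces T. (unit_normal T F \<bullet> i) * (LINT x:F|face_lborel F. x \<bullet> i))"
  proof (rule divergence[OF T])
    show "((\<lambda>s. (x + s *\<^sub>R i) \<bullet> i) has_real_derivative 1) (at s)" for x s
      using i by (auto intro!: derivative_eq_intros simp: inner_add_left inner_Basis)
  qed (use i in \<open>auto intro!: continuous_intros\<close>)
  then show ?thesis by (simp add: elem_ip_def)
qed

lemma elem_volume_pos: "T \<in> Th \<Longrightarrow> 0 < elem_ip T (\<lambda>_. 1) (\<lambda>_. 1)"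
proof -
  assume T: "T \<in> Th"
  have one: "(\<lambda>_. 1) \<in> cont_funs" by (simp add: cont_funs_def)
  obtain x where "x \<in> T" using elem_nonempty[OF T] by blast
  then have "elem_ip T (\<lambda>_. 1) (\<lambda>_. 1) \<noteq> 0" using elem_ip_zero[OF T one] by force
  then show ?thesis using psd_nonneg[OF psd_elem_ip[OF T] one] by linarith
qed

text \<open>An element without faces would have volume zero by \<open>elem_volume\<close>.\<close>

lemma elem_faces_nonempty: "T \<in> Th \<Longrightarrow> elem_faces T \<noteq> {}"
  using elem_volume[of T "SOME i. i \<in> Basis"] elem_volume_pos[of T] SOME_Basis by fastforce

section \<open>The hybrid high-order forms\<close>

text \<open>Values at other indices are left free because the local forms only see the faces of
  \<open>T\<close>.\<close>

definition local_faces :: "'a set \<Rightarrow> ('a set \<Rightarrow> 'a \<Rightarrow> real) set" where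
  "local_faces T = {v. \<forall>F\<in>elem_faces T. v F \<in> polys_on k F}"

definition local_space :: "'a set \<Rightarrow> (('a \<Rightarrow> real) \<times> ('a set \<Rightarrow> 'a \<Rightarrow> real)) set" where
  "local_space T = polys l \<times> local_faces T"

lemma subspace_local_faces: "subspace (local_faces T)"
  by (rule subspaceI_comb)
    (auto simp: local_faces_def fun_apply intro!: subspace_comb subspace_polys_on subspace_0)

lemma subspace_local_space: "subspace (local_space T)"
  unfolding local_space_def by (intro subspace_Times subspace_polys subspace_local_faces)

lemma linear_fst_local: "linear_map_on (local_space T) (polys l) fst"
  by (auto simp: linear_map_on_def local_space_def)

lemma linear_snd_local: "F \<in> elem_faces T \<Longrightarrow> linear_map_on (local_space T) (polys_on k F) (\<lambda>v. snd v F)"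
  by (auto simp: linear_map_on_def local_space_def local_faces_def fun_apply)

lemma snd_local_cont: "v \<in> local_space T \<Longrightarrow> F \<in> elem_faces T \<Longrightarrow> snd v F \<in> face_cont_funs F"
  by (rule polys_on_face_cont[OF linear_map_on_in[OF linear_snd_local]])

section \<open>The reconstruction operator\<close>

definition recon_rhs :: "'a set \<Rightarrow> ('a \<Rightarrow> real) \<times> ('a set \<Rightarrow> 'a \<Rightarrow> real) \<Rightarrow> ('a \<Rightarrow> real) \<Rightarrow> real" where
  "recon_rhs T v w = - elem_ip T (fst v) (laplacian w)
     + (\<Sum>F\<in>elem_faces T. face_ip F (snd v F) (\<lambda>x. grad w x \<bullet> unit_normal T F))"

lemma normal_derivative_linear:
  "linear_map_on (polys (k + 1) :: ('a \<Rightarrow> real) set) (polys k) (\<lambda>w x. grad w x \<bullet> n)"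
proof -
  have "(\<lambda>x. grad (c *\<^sub>R u + v) x \<bullet> n) = c *\<^sub>R (\<lambda>x. grad u x \<bullet> n) + (\<lambda>x. grad v x \<bullet> n)"
    if "u \<in> polys (k + 1)" "v \<in> polys (k + 1)" for u v :: "'a \<Rightarrow> real" and c
    using linear_map_on_comb[OF linear_map_on_grad that, of c]
    by (simp add: fun_eq_iff fun_apply inner_add_left)
  then show ?thesis
    by (simp add: linear_map_on_def normal_derivative_in_polys)
qed

lemma face_ip_comb_right:
  assumes "F \<in> Fh" "f \<in> face_cont_funs F" "u \<in> cont_funs" "v \<in> cont_funs"
  shows "face_ip F f (c *\<^sub>R u + v) = c * face_ip F f u + face_ip F f v"
  using assms by (intro psd_comb_right[OF psd_face_ip]) (auto intro: cont_face_cont)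

lemma recon_rhs_linear:
  assumes T: "T \<in> Th" and v: "v \<in> local_space T"
  shows "linear_map_on (polys (k + 1)) UNIV (recon_rhs T v)"
proof -
  have v': "fst v \<in> polys l" "\<And>F. F \<in> elem_faces T \<Longrightarrow> snd v F \<in> face_cont_funs F"
    using v snd_local_cont by (auto simp: local_space_def)
  have "recon_rhs T v (c *\<^sub>R w + z) = c * recon_rhs T v w + recon_rhs T v z"
    if w: "w \<in> polys (k + 1)" and z: "z \<in> polys (k + 1)" for c w z
  proof -
    have "elem_ip T (fst v) (laplacian (c *\<^sub>R w + z)) =
        c * elem_ip T (fst v) (laplacian w) + elem_ip T (fst v) (laplacian z)"
      unfolding linear_map_on_comb[OF linear_map_on_laplacian w z]
      using v'(1) laplacian_in_polys[OF w] laplacian_in_polys[OF z]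
      by (intro psd_comb_right[OF psd_elem_ip[OF T]]) (auto intro: polys_cont)
    moreover have "face_ip F (snd v F) (\<lambda>x. grad (c *\<^sub>R w + z) x \<bullet> unit_normal T F) =
        c * face_ip F (snd v F) (\<lambda>x. grad w x \<bullet> unit_normal T F)
        + face_ip F (snd v F) (\<lambda>x. grad z x \<bullet> unit_normal T F)" if F: "F \<in> elem_faces T" for F
      unfolding linear_map_on_comb[OF normal_derivative_linear w z]
      using linear_map_on_in[OF normal_derivative_linear w] linear_map_on_in[OF normal_derivative_linear z]
      by (intro face_ip_comb_right elem_faces_in_Fh[OF F] v'(2)[OF F]) (auto intro: polys_cont)
    ultimately show ?thesis
      by (simp add: recon_rhs_def sum.distrib sum_distrib_left algebra_simps)
  qed
  then show ?thesis by (simp add: linear_map_on_def)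
qed

lemma recon_rhs_comb:
  assumes T: "T \<in> Th" and u: "u \<in> local_space T" and v: "v \<in> local_space T" and w: "w \<in> polys (k + 1)"
  shows "recon_rhs T (c *\<^sub>R u + v) w = c * recon_rhs T u w + recon_rhs T v w"
proof -
  have "elem_ip T (c *\<^sub>R fst u + fst v) (laplacian w) =
      c * elem_ip T (fst u) (laplacian w) + elem_ip T (fst v) (laplacian w)"
    using u v laplacian_in_polys[OF w]
    by (intro psd_comb_left[OF psd_elem_ip[OF T]]) (auto simp: local_space_def intro: polys_cont)
  moreover have "face_ip F (c *\<^sub>R snd u F + snd v F) (\<lambda>x. grad w x \<bullet> unit_normal T F) =
      c * face_ip F (snd u F) (\<lambda>x. grad w x \<bullet> unit_normal T F)
      + face_ip F (snd v F) (\<lambda>x. grad w x \<bullet> unit_normal T F)" if F: "F \<in> elem_faces T" for F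
  proof (rule psd_comb_left[OF psd_face_ip[OF elem_faces_in_Fh[OF F]]])
    show "snd u F \<in> face_cont_funs F" "snd v F \<in> face_cont_funs F"
      using u v F by (simp_all add: snd_local_cont)
    show "(\<lambda>x. grad w x \<bullet> unit_normal T F) \<in> face_cont_funs F"
      using linear_map_on_in[OF normal_derivative_linear w] by (intro cont_face_cont polys_cont)
  qed
  ultimately show ?thesis
    by (simp add: recon_rhs_def fun_apply sum.distrib sum_distrib_left algebra_simps)
qed

lemma psd_grad_form:
  assumes T: "T \<in> Th"
  shows "psd_form (polys m) (\<lambda>p q. elem_vec_ip T (grad p) (grad q))"
  by (rule psd_form_pullback[OF subspace_polys _ psd_elem_vec_ip[OF T]])
    (use linear_map_on_grad in \<open>simp add: cont_funs_def\<close>)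

lemma grad_form_zero:
  assumes T: "T \<in> Th" and p: "p \<in> polys m" "elem_vec_ip T (grad p) (grad p) = 0"
  shows "\<exists>c. p = (\<lambda>_. c)"
proof (rule polys_constant[OF p(1) elem_open[OF T] elem_nonempty[OF T]])
  have "grad p \<in> cont_funs" by (simp add: cont_funs_def continuous_on_grad[OF p(1)])
  then show "grad p x = 0" if "x \<in> T" for x using elem_vec_ip_zero[OF T _ p(2) that] by blast
qed

lemma partial_const: "partial i (\<lambda>_. c) = (\<lambda>_. 0)"
  by (rule ext, rule partial_eqI) (auto intro!: derivative_eq_intros)

lemma grad_const: "grad (\<lambda>_. c) x = 0"
  by (simp add: grad_eq partial_const)

lemma laplacian_const: "laplacian (\<lambda>_. c) = (\<lambda>_. 0)"
  by (simp add: fun_eq_iff laplacian_eq partial_const)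

text \<open>A Neumann problem: the form has the constants as kernel, and the right-hand side
  annihilates them because gradient and Laplacian of a constant vanish, so \<open>riesz\<close>
  applies. The mean value condition then fixes the additive constant.\<close>

lemma recon_unique:
  assumes T: "T \<in> Th" and v: "v \<in> local_space T"
  shows "\<exists>!p. p \<in> polys (k + 1) \<and> ((\<forall>w\<in>polys (k + 1). elem_vec_ip T (grad p) (grad w) = recon_rhs T v w) \<and>
     elem_ip T p (\<lambda>_. 1) = elem_ip T (fst v) (\<lambda>_. 1))"
proof -
  let ?P = "polys (k + 1) :: ('a \<Rightarrow> real) set" and ?B = "\<lambda>p q. elem_vec_ip T (grad p) (grad q)"
  note B = psd_grad_form[OF T, of "k + 1"] and E = psd_elem_ip[OF T]
  have one: "(\<lambda>_. 1) \<in> cont_funs" by (simp add: cont_funs_def)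
  note pc = polys_subset_cont[of "k + 1", THEN subsetD]
  have null: "recon_rhs T v w = 0" if w: "w \<in> ?P" "?B w w = 0" for w
  proof -
    obtain c where "w = (\<lambda>_. c)" using grad_form_zero[OF T w] by blast
    then show ?thesis
      by (simp add: recon_rhs_def grad_const laplacian_const elem_ip_def face_ip_def)
  qed
  obtain q where q: "q \<in> ?P" "\<And>w. w \<in> ?P \<Longrightarrow> ?B q w = recon_rhs T v w"
    using riesz[OF finite_dim_polys B recon_rhs_linear[OF T v] null] by blast
  define V where "V = elem_ip T (\<lambda>_. 1) (\<lambda>_. 1)"
  have V: "V > 0" using elem_volume_pos[OF T] by (simp add: V_def)
  \<comment> \<open>Shifts the mean value of \<open>q\<close> to the prescribed one.\<close>
  define c where "c = (elem_ip T (fst v) (\<lambda>_. 1) - elem_ip T q (\<lambda>_. 1)) / V"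
  define p where "p = c *\<^sub>R (\<lambda>_. 1) + q"
  have p: "p \<in> ?P" unfolding p_def using q(1) by (intro subspace_comb subspace_polys const_in_polys)
  have Bp: "?B p w = recon_rhs T v w" if "w \<in> ?P" for w
  proof -
    have "grad p = grad q"
    proof
      fix x
      have "grad p = c *\<^sub>R grad (\<lambda>_. 1) + grad q"
        unfolding p_def by (rule linear_map_on_comb[OF linear_map_on_grad const_in_polys q(1)])
      then show "grad p x = grad q x" by (simp add: fun_apply grad_const)
    qed
    then show ?thesis using q(2)[OF that] by simp
  qed
  have "elem_ip T p (\<lambda>_. 1) = c * V + elem_ip T q (\<lambda>_. 1)"
    unfolding p_def V_def using one pc[OF q(1)] by (intro psd_comb_left[OF E])
  then have Ep: "elem_ip T p (\<lambda>_. 1) = elem_ip T (fst v) (\<lambda>_. 1)"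
    using V by (simp add: c_def)
  show ?thesis
  proof (rule ex1I[of _ p])
    fix p' assume p': "p' \<in> ?P \<and> ((\<forall>w\<in>?P. ?B p' w = recon_rhs T v w) \<and>
        elem_ip T p' (\<lambda>_. 1) = elem_ip T (fst v) (\<lambda>_. 1))"
    have d: "p' - p \<in> ?P" using p p' by (simp add: subspace_diff subspace_polys)
    have "?B (p' - p) (p' - p) = 0"
      using psd_diff_left[OF B, of p' p "p' - p"] p p' d Bp[OF d] by simp
    from grad_form_zero[OF T d this] obtain a where a: "p' - p = (\<lambda>_. a)" by blast
    have "elem_ip T (p' - p) (\<lambda>_. 1) = 0"
      using psd_diff_left[OF E, of p' p "\<lambda>_. 1"] p p' Ep one pc by auto
    moreover have "p' - p = a *\<^sub>R (\<lambda>_. 1)" by (simp add: a fun_eq_iff fun_apply)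
    ultimately have "a * V = 0"
      unfolding V_def using psd_scale_left[OF E one one, of a] by simp
    then show "p' = p" using V a by (simp add: fun_eq_iff)
  qed (use p Bp Ep in auto)
qed

lemma
  assumes T: "T \<in> Th"
  shows recon_linear: "linear_map_on (local_space T) (polys (k + 1)) (recon T)"
    and recon_eq: "v \<in> local_space T \<Longrightarrow> w \<in> polys (k + 1) \<Longrightarrow>
      elem_vec_ip T (grad (recon T v)) (grad w) = recon_rhs T v w"
proof -
  have recon: "recon T = (\<lambda>v. THE p. p \<in> polys (k + 1) \<and>
      ((\<forall>w\<in>polys (k + 1). elem_vec_ip T (grad p) (grad w) = recon_rhs T v w) \<and>
       elem_ip T p (\<lambda>_. 1) = elem_ip T (fst v) (\<lambda>_. 1)))"
    by (simp add: recon_def recon_rhs_def fun_eq_iff)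
  note B = psd_grad_form[OF T, of "k + 1"] and E = psd_elem_ip[OF T]
  have one: "(\<lambda>_. 1) \<in> cont_funs" by (simp add: cont_funs_def)
  note pc = polys_subset_cont[THEN subsetD]
  show "linear_map_on (local_space T) (polys (k + 1)) (recon T)"
    unfolding recon
  proof (rule linear_map_on_the[OF subspace_polys subspace_local_space recon_unique[OF T]])
    fix u v p q and c :: real
    assume u: "u \<in> local_space T" and v: "v \<in> local_space T" and p: "p \<in> polys (k + 1)" and q: "q \<in> polys (k + 1)"
      and P: "(\<forall>w\<in>polys (k + 1). elem_vec_ip T (grad p) (grad w) = recon_rhs T u w) \<and>
        elem_ip T p (\<lambda>_. 1) = elem_ip T (fst u) (\<lambda>_. 1)"
      and Q: "(\<forall>w\<in>polys (k + 1). elem_vec_ip T (grad q) (grad w) = recon_rhs T v w) \<and>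
        elem_ip T q (\<lambda>_. 1) = elem_ip T (fst v) (\<lambda>_. 1)"
    have "elem_vec_ip T (grad (c *\<^sub>R p + q)) (grad w) = recon_rhs T (c *\<^sub>R u + v) w"
      if w: "w \<in> polys (k + 1)" for w
      using psd_comb_left[OF B p q w, of c] recon_rhs_comb[OF T u v w, of c] P Q w by simp
    moreover have "elem_ip T (c *\<^sub>R p + q) (\<lambda>_. 1) = c * elem_ip T p (\<lambda>_. 1) + elem_ip T q (\<lambda>_. 1)"
      by (rule psd_comb_left[OF E pc[OF p] pc[OF q] one])
    moreover have "elem_ip T (c *\<^sub>R fst u + fst v) (\<lambda>_. 1) = c * elem_ip T (fst u) (\<lambda>_. 1) + elem_ip T (fst v) (\<lambda>_. 1)"
      using u v by (intro psd_comb_left[OF E _ _ one]) (auto simp: local_space_def intro: pc)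
    ultimately show "(\<forall>w\<in>polys (k + 1). elem_vec_ip T (grad (c *\<^sub>R p + q)) (grad w) = recon_rhs T (c *\<^sub>R u + v) w) \<and>
        elem_ip T (c *\<^sub>R p + q) (\<lambda>_. 1) = elem_ip T (fst (c *\<^sub>R u + v)) (\<lambda>_. 1)"
      using P Q by simp
  qed
  show "v \<in> local_space T \<Longrightarrow> w \<in> polys (k + 1) \<Longrightarrow>
      elem_vec_ip T (grad (recon T v)) (grad w) = recon_rhs T v w"
    unfolding recon using theI'[OF recon_unique[OF T], of v] by blast
qed

section \<open>Stabilization and the local form\<close>

lemma delta_elem_linear:
  assumes T: "T \<in> Th"
  shows "linear_map_on (local_space T) (polys l) (delta_elem T)"
proof -
  have "linear_map_on (local_space T) cont_funs (\<lambda>v. recon T v - fst v)"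
    by (intro linear_map_on_diff_fun subspace_cont_funs
        linear_map_on_subset[OF recon_linear[OF T] polys_subset_cont]
        linear_map_on_subset[OF linear_fst_local polys_subset_cont])
  from linear_map_on_compose[OF this elem_proj_linear[OF T]] show ?thesis
    by (simp add: delta_elem_def[abs_def] fun_diff_def)
qed

lemma delta_face_linear:
  assumes T: "T \<in> Th" and F: "F \<in> elem_faces T"
  shows "linear_map_on (local_space T) (polys_on k F) (delta_face T F)"
proof -
  have "linear_map_on (local_space T) (face_cont_funs F) (\<lambda>v. recon T v - snd v F)"
    by (intro linear_map_on_diff_fun subspace_face_cont_funs
        linear_map_on_subset[OF recon_linear[OF T] order_trans[OF polys_subset_cont cont_subset_face_cont]]
        linear_map_on_subset[OF linear_snd_local[OF F] polys_on_subset_face_cont])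
  from linear_map_on_compose[OF this face_proj_linear[OF elem_faces_in_Fh[OF F]]] show ?thesis
    by (simp add: delta_face_def[abs_def] fun_diff_def)
qed

lemma jump_linear:
  assumes F: "F \<in> elem_faces T"
  shows "linear_map_on (local_space T) (polys_on k F) (\<lambda>v. face_proj k F (\<lambda>x. fst v x - snd v F x))"
proof -
  have "linear_map_on (local_space T) (face_cont_funs F) (\<lambda>v. fst v - snd v F)"
    by (intro linear_map_on_diff_fun subspace_face_cont_funs
        linear_map_on_subset[OF linear_fst_local order_trans[OF polys_subset_cont cont_subset_face_cont]]
        linear_map_on_subset[OF linear_snd_local[OF F] polys_on_subset_face_cont])
  from linear_map_on_compose[OF this face_proj_linear[OF elem_faces_in_Fh[OF F]]] show ?thesis
    by (simp add: fun_diff_def)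
qed

lemma psd_s_face:
  assumes T: "T \<in> Th" and F: "F \<in> elem_faces T"
  shows "psd_form (local_space T) (s_face T F)"
proof (cases stab)
  case Reconstruction_Stab
  have "linear_map_on (local_space T) (face_cont_funs F) (\<lambda>v. delta_face T F v - delta_elem T v)"
    by (intro linear_map_on_diff_fun subspace_face_cont_funs
        linear_map_on_subset[OF delta_elem_linear[OF T] order_trans[OF polys_subset_cont cont_subset_face_cont]]
        linear_map_on_subset[OF delta_face_linear[OF T F] polys_on_subset_face_cont])
  from psd_form_pullback[OF subspace_local_space this psd_face_ip[OF elem_faces_in_Fh[OF F]]]
  show ?thesis unfolding s_face_def[abs_def] by (simp add: Reconstruction_Stab fun_diff_def)
next
  case Projection_Stab
  from psd_form_pullback[OF subspace_local_space
      linear_map_on_subset[OF jump_linear[OF F] polys_on_subset_face_cont] psd_face_ip[OF elem_faces_in_Fh[OF F]]]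
  show ?thesis unfolding s_face_def[abs_def] by (simp add: Projection_Stab)
qed

text \<open>From dimension two on there is a direction tangential to the face, along which a
  relatively open set extends; in dimension one faces would be points.\<close>

lemma diameter_face_pos:
  assumes F: "F \<in> Fh"
  shows "0 < diameter F"
proof -
  let ?n = "face_normal F"
  obtain v where v: "v \<noteq> 0" "orthogonal ?n v" using orthogonal_to_vector_exists dim by blast
  obtain y where y: "y \<in> F" using mesh_face[OF F] by (auto simp: mesh_face_def)
  obtain r where r: "r > 0" "ball y r \<inter> {x. ?n \<bullet> x = face_offset F} \<subseteq> F"
    using face_openin[OF mesh_face[OF F]] y unfolding openin_contains_ball by auto
  let ?z = "y + (r / 2 / norm v) *\<^sub>R v"
  have "dist y ?z = r / 2" using v(1) r(1) by (simp add: dist_norm)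
  moreover have "?n \<bullet> ?z = face_offset F"
    using v(2) y face_subset_hyperplane[OF mesh_face[OF F]] by (auto simp: inner_add_right orthogonal_def)
  ultimately have "?z \<in> F" using r by (auto simp: subset_iff)
  then have "dist y ?z \<le> diameter F" using y by (intro diameter_bounded_bound face_bounded[OF F])
  then show ?thesis using \<open>dist y ?z = r / 2\<close> r(1) by linarith
qed

lemma psd_s_elem: "T \<in> Th \<Longrightarrow> psd_form (local_space T) (s_elem T)"
  unfolding s_elem_def[abs_def]
  by (intro psd_form_sum psd_form_scale psd_s_face subspace_local_space)
    (auto intro: less_imp_le diameter_face_pos elem_faces_in_Fh)

lemma psd_a_elem: "T \<in> Th \<Longrightarrow> psd_form (local_space T) (a_elem T)"
  unfolding a_elem_def[abs_def]
  by (intro psd_form_add psd_s_elem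
      psd_form_pullback[OF subspace_local_space recon_linear psd_grad_form, of T T])

text \<open>If \<open>a_T(v, v)\<close> vanishes, then the stabilization makes \<open>v_F\<close> and \<open>v_T\<close> indistinguishable for test
  functions in \<open>P^k(F)\<close>; by Green's formula, the gradient of the reconstruction, which vanishes, is
  then the gradient of \<open>v_T\<close> itself.\<close>

lemma a_elem_zero:
  assumes T: "T \<in> Th" and v: "v \<in> local_space T" and a0: "a_elem T v v = 0"
  shows "\<exists>c. fst v = (\<lambda>_. c) \<and> (\<forall>F\<in>elem_faces T. snd v F = (\<lambda>x. if x \<in> F then c else 0))"
proof -
  let ?p = "recon T v"
  have vT: "fst v \<in> polys l" and vF: "\<And>F. F \<in> elem_faces T \<Longrightarrow> snd v F \<in> polys_on k F"
    using v by (auto simp: local_space_def local_faces_def)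
  have vT1: "fst v \<in> polys (k + 1)" using vT degree polys_mono[of l "k + 1"] by auto
  have p: "?p \<in> polys (k + 1)" by (rule linear_map_on_in[OF recon_linear[OF T] v])
  have Fh: "\<And>F. F \<in> elem_faces T \<Longrightarrow> F \<in> Fh" by (rule elem_faces_in_Fh)
  have nn: "0 \<le> inverse (diameter F) * s_face T F v v" if "F \<in> elem_faces T" for F
    using psd_nonneg[OF psd_s_face[OF T that] v] diameter_face_pos[OF Fh[OF that]] by simp
  have "0 \<le> s_elem T v v" "0 \<le> elem_vec_ip T (grad ?p) (grad ?p)"
    using psd_nonneg[OF psd_s_elem[OF T] v] psd_nonneg[OF psd_grad_form[OF T] p] by auto
  then have g0: "elem_vec_ip T (grad ?p) (grad ?p) = 0" and "s_elem T v v = 0"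
    using a0 by (auto simp: a_elem_def)
  then have "inverse (diameter F) * s_face T F v v = 0" if "F \<in> elem_faces T" for F
    using that nn sum_nonneg_eq_0_iff[OF finite_elem_faces, of T "\<lambda>F. inverse (diameter F) * s_face T F v v"]
    by (auto simp: s_elem_def)
  then have s0: "s_face T F v v = 0" if "F \<in> elem_faces T" for F
    using that diameter_face_pos[OF Fh[OF that]] by force
  obtain c0 where c0: "?p = (\<lambda>_. c0)" using grad_form_zero[OF T p g0] by blast
  have key: "face_ip F (snd v F) q = face_ip F (fst v) q" if F: "F \<in> elem_faces T" and q: "q \<in> polys k" for F q
  proof (cases stab)
    case Reconstruction_Stab
    \<comment> \<open>The constant \<open>?p\<close> lies in both polynomial spaces, so both
      projections act as the identity; on \<open>F\<close> the difference of the two terms is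
      \<open>fst v - snd v F\<close>.\<close>
    have dT: "delta_elem T v = ?p - fst v"
      unfolding delta_elem_def
      using elem_proj_id[OF T, of "?p - fst v" l] vT
      by (simp add: fun_diff_def c0 subspace_diff[OF subspace_polys const_in_polys vT, unfolded fun_diff_def])
    define r where "r = (\<lambda>x. if x \<in> F then c0 else 0) - snd v F"
    have r: "r \<in> polys_on k F"
      unfolding r_def using vF[OF F] restriction_in_polys_on[OF const_in_polys]
      by (intro subspace_diff subspace_polys_on) auto
    have dF: "delta_face T F v = r"
      unfolding delta_face_def
      by (rule face_proj_eq[OF Fh[OF F] r]) (simp add: r_def c0)
    have "(\<lambda>x. delta_face T F v x - delta_elem T v x) \<in> face_cont_funs F"
      using subspace_diff[OF subspace_face_cont_funs, of "delta_face T F v" F "delta_elem T v"]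
        linear_map_on_in[OF delta_face_linear[OF T F] v] linear_map_on_in[OF delta_elem_linear[OF T] v]
      by (auto simp: fun_diff_def intro: polys_on_face_cont polys_cont cont_face_cont)
    moreover have "face_ip F (\<lambda>x. delta_face T F v x - delta_elem T v x) (\<lambda>x. delta_face T F v x - delta_elem T v x) = 0"
      using s0[OF F, unfolded s_face_def] by (simp add: Reconstruction_Stab)
    ultimately have "delta_face T F v x - delta_elem T v x = 0" if "x \<in> F" for x
      by (rule face_ip_zero[OF Fh[OF F] _ _ that])
    then have "snd v F x = fst v x" if "x \<in> F" for x
      using that by (force simp: dF dT r_def c0)
    then show ?thesis by (rule face_ip_cong) auto
  next
    case Projection_Stab
    \<comment> \<open>Here \<open>fst v\<close> may have degree \<open>k + 1\<close>, so the trace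
      and \<open>snd v F\<close> agree only when tested with polynomials of degree
      \<open>k\<close>.\<close>
    let ?j = "\<lambda>x. fst v x - snd v F x"
    define q' where "q' = (\<lambda>x. if x \<in> F then q x else 0)"
    have q': "q' \<in> polys_on k F" using restriction_in_polys_on[OF q] by (simp add: q'_def)
    have vc: "fst v \<in> face_cont_funs F" "snd v F \<in> face_cont_funs F" "q \<in> face_cont_funs F"
      using vT vF[OF F] q by (auto intro: polys_on_face_cont polys_cont cont_face_cont)
    have j: "?j \<in> face_cont_funs F"
      using subspace_diff[OF subspace_face_cont_funs vc(1,2)] by (simp add: fun_diff_def)
    have "face_proj k F ?j = 0"
      using polys_on_zero[OF Fh[OF F]] linear_map_on_in[OF face_proj_linear[OF Fh[OF F]] j, of k] s0[OF F, unfolded s_face_def]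
      by (simp add: Projection_Stab)
    then have "face_ip F ?j q' = 0"
      using face_proj_ip[OF Fh[OF F] j q'] by (simp add: face_ip_def fun_apply)
    moreover have "face_ip F ?j q' = face_ip F ?j q"
      by (rule face_ip_cong) (simp_all add: q'_def)
    ultimately have "face_ip F (fst v - snd v F) q = 0" by (simp add: fun_diff_def)
    then show ?thesis using psd_diff_left[OF psd_face_ip[OF Fh[OF F]] vc] by simp
  qed
  \<comment> \<open>Since \<open>l \<le> k + 1\<close>, the normal derivative of
    \<open>fst v\<close> has degree at most \<open>k\<close> and \<open>key\<close> applies: Green's
    formula becomes the right-hand side of the reconstruction, tested with
    \<open>fst v\<close>.\<close>
  have "elem_vec_ip T (grad (fst v)) (grad (fst v)) = recon_rhs T v (fst v)"
    unfolding green[OF T vT vT] recon_rhs_def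
    by (intro arg_cong2[where f = "(+)"] sum.cong refl key[symmetric] normal_derivative_in_polys)
      (use vT1 in \<open>unfold Suc_eq_plus1\<close>)
  also have "\<dots> = 0"
    unfolding recon_eq[OF T v vT1, symmetric] by (rule psd_null[OF psd_grad_form[OF T] p g0 vT1])
  finally obtain c where c: "fst v = (\<lambda>_. c)" using grad_form_zero[OF T vT] by blast
  have "snd v F = (\<lambda>x. if x \<in> F then c else 0)" if F: "F \<in> elem_faces T" for F
  proof -
    let ?c = "\<lambda>x. if x \<in> F then c else 0"
    have cF: "?c \<in> polys_on k F" by (rule restriction_in_polys_on[OF const_in_polys])
    \<comment> \<open>With \<open>fst v\<close> constant, \<open>snd v F - ?c\<close> has degree
      \<open>k\<close> and can be tested with itself.\<close>
    have d: "snd v F - ?c \<in> polys_on k F"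
      using vF[OF F] cF by (intro subspace_diff subspace_polys_on)
    then obtain q where q: "q \<in> polys k" "snd v F - ?c = (\<lambda>x. if x \<in> F then q x else 0)"
      by (auto simp: polys_on_def)
    note B = psd_face_ip[OF Fh[OF F]] and pc = polys_on_subset_face_cont[of k F, THEN subsetD]
    have "face_ip F (snd v F - ?c) (snd v F - ?c)
        = face_ip F (snd v F) (snd v F - ?c) - face_ip F ?c (snd v F - ?c)"
      by (rule psd_diff_left[OF B pc[OF vF[OF F]] pc[OF cF] pc[OF d]])
    also have "\<dots> = face_ip F (snd v F) q - face_ip F (fst v) q"
      unfolding q(2) c by (intro arg_cong2[where f = "(-)"] face_ip_cong) auto
    also have "\<dots> = 0" using key[OF F q(1)] by simp
    finally have "snd v F - ?c = 0" by (rule polys_on_zero[OF Fh[OF F] d])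
    then show ?thesis by simp
  qed
  then show ?thesis using c by blast
qed

section \<open>The global form and its definiteness\<close>

lemma boundary_faces_subset: "boundary_faces \<subseteq> Fh"
  by (auto simp: boundary_faces_def)

lemma restr_linear: "T \<in> Th \<Longrightarrow> linear_map_on Uh (local_space T) (restr T)"
  unfolding linear_map_on_def restr_def restr_faces_def Uh_def local_space_def local_faces_def broken_def
  by (auto simp: fun_eq_iff fun_apply elem_faces_def)

lemma finite_dim_Uh: "finite_dim Uh"
  unfolding Uh_def
  by (intro finite_dim_Times finite_dim_broken finite_Th finite_Fh finite_dim_polys finite_dim_polys_on)

lemma subspace_Uh: "subspace Uh"
  by (rule finite_dim_subspace[OF finite_dim_Uh])

lemma psd_a_h: "psd_form Uh a_h"
  unfolding a_h_def[abs_def]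
  by (intro psd_form_sum subspace_Uh psd_form_pullback[OF subspace_Uh restr_linear psd_a_elem])

abbreviation "Uh0 \<equiv> Uh_bc (\<lambda>_ _. 0)"

lemma Uh0_subset: "Uh0 \<subseteq> Uh"
  by (auto simp: Uh_bc_def)

lemma Uh_bc_subset: "v \<in> Uh_bc \<mu> \<Longrightarrow> v \<in> Uh"
  by (simp add: Uh_bc_def)

lemma Uh_bc_comb: "u \<in> Uh_bc \<mu> \<Longrightarrow> v \<in> Uh_bc \<eta> \<Longrightarrow> c *\<^sub>R u + v \<in> Uh_bc (c *\<^sub>R \<mu> + \<eta>)"
  using subspace_comb[OF subspace_Uh] by (simp add: Uh_bc_def fun_apply)

lemma subspace_Uh0: "subspace Uh0"
proof (rule subspaceI_comb)
  show "0 \<in> Uh0" using subspace_0[OF subspace_Uh] by (simp add: Uh_bc_def zero_fun_def)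
  have "c *\<^sub>R (\<lambda>_ _. 0) + (\<lambda>_ _. 0) = (\<lambda>(_ :: 'a set) (_ :: 'a). 0 :: real)" for c
    by (simp add: fun_eq_iff fun_apply)
  then show "c *\<^sub>R u + v \<in> Uh0" if "u \<in> Uh0" "v \<in> Uh0" for u v c
    using Uh_bc_comb[OF that, of c] by (simp only:)
qed

lemma finite_dim_Uh0: "finite_dim Uh0"
  by (rule finite_dim_subset[OF finite_dim_Uh subspace_Uh0 Uh0_subset])

lemma psd_a_h0: "psd_form Uh0 a_h"
  by (rule psd_form_subset[OF psd_a_h subspace_Uh0 Uh0_subset])

text \<open>Just inside a non-exceptional point of the face, along the common normal, lie points of
  both elements.\<close>

lemma same_unit_normal:
  assumes "S \<in> Th" "T \<in> Th" "F \<in> elem_faces S" "F \<in> elem_faces T" "unit_normal S F = unit_normal T F"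
  shows "S = T"
proof -
  have F: "F \<in> Fh" using assms(3) by (rule elem_faces_in_Fh)
  obtain N where N: "N \<in> null_sets (face_lborel F)"
    "\<And>R x. R \<in> Th \<Longrightarrow> F \<in> elem_faces R \<Longrightarrow> x \<in> F - N \<Longrightarrow> crosses R (unit_normal R F) x"
    using exceptional_points[OF F] by blast
  obtain y where "y \<in> F" using mesh_face[OF F] by (auto simp: mesh_face_def)
  then obtain x where x: "x \<in> F - N"
    using face_not_null[OF mesh_face[OF F] _ zero_less_one N(1)] by blast
  have "\<forall>\<^sub>F t in at_right 0. x - t *\<^sub>R unit_normal T F \<in> S \<inter> T"
    using N(2)[OF assms(1,3) x] N(2)[OF assms(2,4) x] unfolding crosses_def by eventually_elim (simp add: assms(5))
  then obtain t where "x - t *\<^sub>R unit_normal T F \<in> S \<inter> T"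
    using eventually_happens'[OF trivial_limit_at_right_real] by blast
  then show ?thesis using elems_disjoint[OF assms(1,2)] by blast
qed

text \<open>By the divergence theorem, the sum of the volumes with weights \<open>c T ^ 2\<close> is a sum over faces, in
  which the contributions of the two sides of a face cancel.\<close>

lemma piecewise_constant_zero:
  fixes c :: "'a set \<Rightarrow> real"
  assumes face: "\<And>S T F. S \<in> Th \<Longrightarrow> T \<in> Th \<Longrightarrow> F \<in> elem_faces S \<Longrightarrow> F \<in> elem_faces T \<Longrightarrow> c S = c T"
    and bd: "\<And>T F. T \<in> Th \<Longrightarrow> F \<in> elem_faces T \<Longrightarrow> F \<in> boundary_faces \<Longrightarrow> c T = 0"
    and T: "T \<in> Th"
  shows "c T = 0"
proof -
  obtain i :: 'a where i: "i \<in> Basis" using nonempty_Basis by blast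
  define I where "I F = (LINT x:F|face_lborel F. x \<bullet> i)" for F
  let ?V = "\<lambda>T. elem_ip T (\<lambda>_. 1) (\<lambda>_. 1)"
  have "(\<Sum>T\<in>Th. (c T)\<^sup>2 * ?V T) = (\<Sum>T\<in>Th. \<Sum>F\<in>elem_faces T. (c T)\<^sup>2 * ((unit_normal T F \<bullet> i) * I F))"
    by (rule sum.cong[OF refl]) (simp add: elem_volume[OF _ i] I_def sum_distrib_left)
  also have "\<dots> = (\<Sum>T\<in>Th. \<Sum>F | F \<in> Fh \<and> F \<subseteq> frontier T. (c T)\<^sup>2 * ((unit_normal T F \<bullet> i) * I F))"
    by (simp add: elem_faces_def)
  also have "\<dots> = (\<Sum>F\<in>Fh. \<Sum>T | T \<in> Th \<and> F \<subseteq> frontier T. (c T)\<^sup>2 * ((unit_normal T F \<bullet> i) * I F))"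
    by (rule sum.swap_restrict[OF finite_Th finite_Fh])
  also have "\<dots> = 0"
  proof (rule sum.neutral, rule ballI)
    fix F assume F: "F \<in> Fh"
    let ?S = "{T. T \<in> Th \<and> F \<subseteq> frontier T}"
    have S: "T \<in> ?S \<longleftrightarrow> T \<in> Th \<and> F \<in> elem_faces T" for T using F by (auto simp: elem_faces_def)
    show "(\<Sum>T\<in>?S. (c T)\<^sup>2 * ((unit_normal T F \<bullet> i) * I F)) = 0"
    proof (cases "F \<in> boundary_faces")
      case True
      then show ?thesis using bd S by (intro sum.neutral) auto
    next
      case False
      show ?thesis
        using F
      proof (cases rule: face_cases)
        case (interior T1 T2)
        have n: "unit_normal T2 F = - unit_normal T1 F"
          using unit_normal_cases[OF interior(1,4)] unit_normal_cases[OF interior(2,5)]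
            same_unit_normal[OF interior(1,2,4,5)] interior(3) by auto
        \<comment> \<open>Only two unit normals are possible on a face, and each belongs to at most
          one element.\<close>
        have "?S = {T1, T2}"
        proof (intro set_eqI iffI)
          fix R assume R: "R \<in> ?S"
          then have "unit_normal R F = unit_normal T1 F \<or> unit_normal R F = unit_normal T2 F"
            using n S unit_normal_cases[of R F] unit_normal_cases[OF interior(1,4)] by auto
          then show "R \<in> {T1, T2}"
            using R S same_unit_normal[OF _ interior(1) _ interior(4)] same_unit_normal[OF _ interior(2) _ interior(5)]
            by blast
        qed (use interior S in auto)
        then show ?thesis
          using interior(3) n face[OF interior(1,2,4,5)] by simp
      next
        case (boundary R)
        then show ?thesis using False F by (auto simp: boundary_faces_def elem_faces_def)
      qed
    qed
  qed
  \<comment> \<open>Squared weights make every summand nonnegative, so the vanishing sum forces each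
    of them to vanish.\<close>
  finally have "(c T)\<^sup>2 * ?V T = 0"
    using T finite_Th less_imp_le[OF elem_volume_pos]
    by (subst (asm) sum_nonneg_eq_0_iff) auto
  then show ?thesis using elem_volume_pos[OF T] by simp
qed

lemma face_elem: "F \<in> Fh \<Longrightarrow> \<exists>T\<in>Th. F \<in> elem_faces T"
  by (rule face_cases) auto

lemma Uh_eqI:
  assumes "u \<in> Uh" "v \<in> Uh" "\<And>T. T \<in> Th \<Longrightarrow> fst u T = fst v T" "\<And>F. F \<in> Fh \<Longrightarrow> snd u F = snd v F"
  shows "u = v"
proof (rule prod_eqI)
  show "fst u = fst v"
  proof
    fix T show "fst u T = fst v T"
      using assms(1-3) by (cases "T \<in> Th") (auto simp: Uh_def broken_def)
  qed
  show "snd u = snd v"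
  proof
    fix F show "snd u F = snd v F"
      using assms(1,2,4) by (cases "F \<in> Fh") (auto simp: Uh_def broken_def)
  qed
qed

lemma a_h_zero:
  assumes v: "v \<in> Uh0" and a0: "a_h v v = 0"
  shows "v = 0"
proof -
  have vU: "v \<in> Uh" using v Uh0_subset by blast
  have loc: "restr T v \<in> local_space T" if "T \<in> Th" for T by (rule linear_map_on_in[OF restr_linear[OF that] vU])
  have "a_elem T (restr T v) (restr T v) = 0" if "T \<in> Th" for T
    using a0 that psd_nonneg[OF psd_a_elem loc] finite_Th unfolding a_h_def
    by (subst (asm) sum_nonneg_eq_0_iff) auto
  then have "\<forall>T\<in>Th. \<exists>c. fst v T = (\<lambda>_. c) \<and> (\<forall>F\<in>elem_faces T. snd v F = (\<lambda>x. if x \<in> F then c else 0))"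
    using a_elem_zero[OF _ loc] by (auto simp: restr_def restr_faces_def)
  from bchoice[OF this] obtain c where c: "\<forall>T\<in>Th. fst v T = (\<lambda>_. c T) \<and>
      (\<forall>F\<in>elem_faces T. snd v F = (\<lambda>x. if x \<in> F then c T else 0))" ..
  have val: "\<exists>x. snd v F x = c T" if TF: "T \<in> Th" "F \<in> elem_faces T" for T F
  proof -
    obtain x where "x \<in> F" using mesh_face[OF elem_faces_in_Fh[OF TF(2)]] by (auto simp: mesh_face_def)
    then show ?thesis using c TF by (intro exI[of _ x]) simp
  qed
  \<comment> \<open>Neighbouring constants agree through the common face polynomial, and boundary
    faces carry zero.\<close>
  have c0: "c T = 0" if "T \<in> Th" for T
  proof (rule piecewise_constant_zero[OF _ _ that])
    fix S T F assume ST: "S \<in> Th" "T \<in> Th" "F \<in> elem_faces S" "F \<in> elem_faces T"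
    obtain x where "x \<in> F" using mesh_face[OF elem_faces_in_Fh[OF ST(3)]] by (auto simp: mesh_face_def)
    moreover have "snd v F = (\<lambda>x. if x \<in> F then c S else 0)" using c ST(1,3) by blast
    moreover have "snd v F = (\<lambda>x. if x \<in> F then c T else 0)" using c ST(2,4) by blast
    ultimately show "c S = c T" by metis
  next
    fix T F assume "T \<in> Th" "F \<in> elem_faces T" "F \<in> boundary_faces"
    then show "c T = 0" using val[of T F] v by (auto simp: Uh_bc_def)
  qed
  show ?thesis
  proof (rule Uh_eqI[OF vU subspace_0[OF subspace_Uh]])
    show "fst v T = fst 0 T" if "T \<in> Th" for T
      using c c0 that by (simp add: fun_eq_iff fun_apply)
    show "snd v F = snd 0 F" if F: "F \<in> Fh" for F
    proof -
      obtain T where "T \<in> Th" "F \<in> elem_faces T" using face_elem[OF F] by blast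
      then show ?thesis using c c0 by (simp add: fun_eq_iff fun_apply)
    qed
  qed
qed

section \<open>Lifting of boundary data\<close>

lemma lift_faces_in: "\<eta> \<in> Pk_boundary \<Longrightarrow> lift_faces \<eta> \<in> broken Fh (polys_on k)"
  using boundary_faces_subset subspace_0[OF subspace_polys_on]
  by (auto simp: Pk_boundary_def broken_def lift_faces_def zero_fun_def)

text \<open>With zero face unknowns, \<open>a_elem_zero\<close> forces the constant on
  \<open>T\<close> to be zero, because \<open>T\<close> has at least one face; the local problem is
  then definite.\<close>

lemma Theta_elem_in:
  assumes T: "T \<in> Th" and v: "v \<in> local_faces T"
  shows "Theta_elem T v \<in> polys l"
proof -
  let ?e = "\<lambda>w :: 'a \<Rightarrow> real. (w, 0 :: 'a set \<Rightarrow> 'a \<Rightarrow> real)"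
  have e: "linear_map_on (polys l) (local_space T) ?e"
    using subspace_0[OF subspace_local_faces] by (simp add: linear_map_on_def local_space_def)
  note A = psd_a_elem[OF T]
  have B: "psd_form (polys l) (\<lambda>u w. a_elem T (?e u) (?e w))"
    by (rule psd_form_pullback[OF subspace_polys e A])
  have v': "(0, v) \<in> local_space T"
    using v by (simp add: local_space_def subspace_0 subspace_polys)
  have "linear_map_on (polys l) UNIV (\<lambda>w. - a_elem T (0, v) (?e w))"
    unfolding linear_map_on_def
    using psd_comb_right[OF A linear_map_on_in[OF e] linear_map_on_in[OF e] v'] by simp
  moreover have "u = 0" if u: "u \<in> polys l" "a_elem T (?e u) (?e u) = 0" for u
  proof -
    obtain c where c: "u = (\<lambda>_. c)" "\<forall>F\<in>elem_faces T. 0 = (\<lambda>x. if x \<in> F then c else 0)"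
      using a_elem_zero[OF T linear_map_on_in[OF e u(1)] u(2)] by (auto simp: fun_apply)
    obtain F where F: "F \<in> elem_faces T" using elem_faces_nonempty[OF T] by blast
    obtain x where "x \<in> F" using mesh_face[OF elem_faces_in_Fh[OF F]] by (auto simp: mesh_face_def)
    moreover have "0 = (\<lambda>x. if x \<in> F then c else 0)" using c(2) F by blast
    ultimately have "c = 0" by (metis zero_fun_apply)
    then show ?thesis using c(1) by (simp add: zero_fun_def)
  qed
  ultimately have "\<exists>!u. u \<in> polys l \<and> (\<forall>w\<in>polys l. a_elem T (?e u) (?e w) = - a_elem T (0, v) (?e w))"
    by (intro riesz_unique[OF finite_dim_polys B])
  from theI'[OF this] show ?thesis by (simp add: Theta_elem_def zero_fun_def)
qed

text \<open>Supplies a member of \<open>Uh_bc\<close> with the prescribed boundary data, both for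
  the existence of \<open>omega\<close> and for the rewriting of \<open>ell\<close>.\<close>

lemma lift_h_in:
  assumes "\<eta> \<in> Pk_boundary"
  shows "lift_h \<eta> \<in> Uh_bc \<eta>"
proof -
  have F: "lift_faces \<eta> \<in> broken Fh (polys_on k)" by (rule lift_faces_in[OF assms])
  have "Theta_elem T (restr_faces T (lift_faces \<eta>)) \<in> polys l" if "T \<in> Th" for T
    by (rule Theta_elem_in[OF that])
      (use F in \<open>auto simp: local_faces_def restr_faces_def broken_def elem_faces_def\<close>)
  then show ?thesis
    using F by (auto simp: lift_h_def Uh_bc_def Uh_def Theta_def broken_def lift_faces_def)
qed

section \<open>The star form\<close>

lemma piecewise_on_elem: "T \<in> Th \<Longrightarrow> x \<in> T \<Longrightarrow> piecewise v x = v T x"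
proof -
  assume T: "T \<in> Th" "x \<in> T"
  have "(\<Sum>S\<in>Th. indicator S x * v S x) = (\<Sum>S\<in>Th. if S = T then v S x else 0)"
    using T elems_disjoint by (intro sum.cong) (auto simp: indicator_def)
  then show ?thesis using T finite_Th by (simp add: piecewise_def)
qed

text \<open>Elements lie in \<open>\<Omega>\<close>, and off all elements both integrands are zero,
  so the identity already holds pointwise.\<close>

lemma elem_ip_piecewise:
  assumes f: "\<And>T. T \<in> Th \<Longrightarrow> f T \<in> cont_funs" and g: "\<And>T. T \<in> Th \<Longrightarrow> g T \<in> cont_funs"
  shows "elem_ip \<Omega> (piecewise f) (piecewise g) = (\<Sum>T\<in>Th. elem_ip T (f T) (g T))"
proof -
  have "indicator \<Omega> x *\<^sub>R (piecewise f x * piecewise g x) = (\<Sum>T\<in>Th. indicator T x *\<^sub>R (f T x * g T x))" for x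
  proof (cases "\<exists>T\<in>Th. x \<in> T")
    case True
    then obtain T where T: "T \<in> Th" "x \<in> T" by blast
    have "(\<Sum>S\<in>Th. indicator S x *\<^sub>R (f S x * g S x)) = piecewise (\<lambda>S x. f S x * g S x) x"
      by (simp add: piecewise_def)
    then show ?thesis
      using T elem_subset_domain[OF T(1)] by (auto simp: piecewise_on_elem)
  next
    case False
    then have "indicator T x = (0::real)" if "T \<in> Th" for T using that by (auto simp: indicator_def)
    then show ?thesis by (simp add: piecewise_def)
  qed
  then have "elem_ip \<Omega> (piecewise f) (piecewise g) = (\<integral>x. (\<Sum>T\<in>Th. indicator T x *\<^sub>R (f T x * g T x)) \<partial>lborel)"
    by (simp only: elem_ip_def set_lebesgue_integral_def)
  also have "\<dots> = (\<Sum>T\<in>Th. elem_ip T (f T) (g T))"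
    unfolding elem_ip_def set_lebesgue_integral_def
    using f g by (intro Bochner_Integration.integral_sum integrable_elem)
      (auto simp: cont_funs_def intro!: continuous_intros)
  finally show ?thesis .
qed

text \<open>On \<open>Uh\<close> this is \<open>star_form\<close> with the integral over
  \<open>\<Omega>\<close> split into elements, so that semidefiniteness can be checked term by
  term.\<close>

definition star_sum where
  "star_sum v w = (\<Sum>T\<in>Th. elem_ip T (fst v T) (fst w T)) +
     (\<Sum>T\<in>boundary_elems. \<Sum>F\<in>elem_faces T. diameter F *
        face_ip F (face_proj k F (\<lambda>x. fst v T x - snd v F x)) (face_proj k F (\<lambda>x. fst w T x - snd w F x)))"

lemma star_form_eq: "v \<in> Uh \<Longrightarrow> w \<in> Uh \<Longrightarrow> star_form v w = star_sum v w"
  unfolding star_form_def star_sum_def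
  by (subst elem_ip_piecewise) (use polys_subset_cont[of l] in \<open>auto simp: Uh_def broken_def\<close>)

lemma boundary_elems_subset: "boundary_elems \<subseteq> Th"
  by (auto simp: boundary_elems_def)

lemma psd_jump_form:
  assumes T: "T \<in> Th" and F: "F \<in> elem_faces T"
  shows "psd_form Uh (\<lambda>v w. face_ip F (face_proj k F (\<lambda>x. fst v T x - snd v F x))
    (face_proj k F (\<lambda>x. fst w T x - snd w F x)))"
proof -
  have "linear_map_on Uh (face_cont_funs F)
      (\<lambda>v. face_proj k F (\<lambda>x. fst (restr T v) x - snd (restr T v) F x))"
    by (rule linear_map_on_subset[OF _ polys_on_subset_face_cont])
      (rule linear_map_on_compose[OF restr_linear[OF T] jump_linear[OF F]])
  from psd_form_pullback[OF subspace_Uh this psd_face_ip[OF elem_faces_in_Fh[OF F]]] show ?thesis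
    using F by (simp add: restr_def restr_faces_def)
qed

lemma psd_elem_part: "T \<in> Th \<Longrightarrow> psd_form Uh (\<lambda>v w. elem_ip T (fst v T) (fst w T))"
  by (rule psd_form_pullback[OF subspace_Uh _ psd_elem_ip])
    (use polys_subset_cont[of l] in \<open>auto simp: linear_map_on_def Uh_def broken_def fun_apply\<close>)

lemma psd_star_sum: "psd_form Uh star_sum"
  unfolding star_sum_def[abs_def]
  by (intro psd_form_add psd_form_sum psd_form_scale subspace_Uh psd_jump_form psd_elem_part)
    (use boundary_elems_subset in \<open>auto intro: less_imp_le diameter_face_pos elem_faces_in_Fh\<close>)

lemma psd_star_form: "psd_form Uh star_form"
proof -
  have "star_form (c *\<^sub>R u + v) w = star_sum (c *\<^sub>R u + v) w" if "u \<in> Uh" "v \<in> Uh" "w \<in> Uh" for u v w c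
    by (rule star_form_eq) (use that in \<open>auto intro: subspace_comb subspace_Uh\<close>)
  then show ?thesis using psd_star_sum unfolding psd_form_def by (simp add: star_form_eq)
qed

lemma star_form_zero:
  assumes v: "v \<in> Uh" and s0: "star_form v v = 0" and F: "F \<in> boundary_faces"
  shows "snd v F = 0"
proof -
  let ?j = "\<lambda>T F. face_proj k F (\<lambda>x. fst v T x - snd v F x)"
  let ?E = "\<lambda>T. elem_ip T (fst v T) (fst v T)" and ?J = "\<lambda>T F. diameter F * face_ip F (?j T F) (?j T F)"
  have E: "0 \<le> ?E T" if "T \<in> Th" for T by (rule psd_nonneg[OF psd_elem_part[OF that] v])
  have J: "0 \<le> ?J T F" if "T \<in> Th" "F \<in> elem_faces T" for T F
    using psd_nonneg[OF psd_jump_form[OF that] v] diameter_face_pos[OF elem_faces_in_Fh[OF that(2)]] by simp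
  have JT: "0 \<le> (\<Sum>F\<in>elem_faces T. ?J T F)" if "T \<in> Th" for T by (rule sum_nonneg) (rule J[OF that])
  have "(\<Sum>T\<in>Th. ?E T) + (\<Sum>T\<in>boundary_elems. \<Sum>F\<in>elem_faces T. ?J T F) = 0"
    using s0 star_form_eq[OF v v] by (simp add: star_sum_def)
  moreover have "0 \<le> (\<Sum>T\<in>Th. ?E T)" by (rule sum_nonneg) (rule E)
  moreover have "0 \<le> (\<Sum>T\<in>boundary_elems. \<Sum>F\<in>elem_faces T. ?J T F)"
    by (rule sum_nonneg) (use JT boundary_elems_subset in blast)
  ultimately have Es: "(\<Sum>T\<in>Th. ?E T) = 0" and Js: "(\<Sum>T\<in>boundary_elems. \<Sum>F\<in>elem_faces T. ?J T F) = 0"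
    by linarith+
  obtain T where T: "T \<in> Th" "F \<in> elem_faces T"
    using F by (auto simp: boundary_faces_def elem_faces_def)
  then have TB: "T \<in> boundary_elems" using F by (auto simp: boundary_elems_def)
  note Fh = elem_faces_in_Fh[OF T(2)]
  have "?E T = 0" using Es E T(1) finite_Th by (subst (asm) sum_nonneg_eq_0_iff) auto
  moreover have "fst v T \<in> polys l" using v T(1) by (auto simp: Uh_def broken_def)
  ultimately have vT: "fst v T = 0" using elem_ip_polys_zero[OF T(1)] by blast
  have "finite boundary_elems" using boundary_elems_subset finite_Th by (rule finite_subset)
  then have "(\<Sum>F\<in>elem_faces T. ?J T F) = 0"
    using Js TB JT boundary_elems_subset by (subst (asm) sum_nonneg_eq_0_iff) auto
  then have "?J T F = 0"
    using J[OF T(1)] T(2) finite_elem_faces by (subst (asm) sum_nonneg_eq_0_iff) auto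
  then have j0: "face_ip F (?j T F) (?j T F) = 0" using diameter_face_pos[OF Fh] by simp
  have vF: "snd v F \<in> polys_on k F" using v Fh by (auto simp: Uh_def broken_def)
  have mF: "- snd v F \<in> polys_on k F" by (rule subspace_neg[OF subspace_polys_on vF])
  \<comment> \<open>The element part being zero, the jump is the face polynomial up to sign and is
    kept by the projection.\<close>
  have "?j T F = - snd v F"
    by (rule face_proj_eq[OF Fh mF]) (simp add: vT fun_apply)
  then have "- snd v F = 0" using polys_on_zero[OF Fh mF] j0 by simp
  then show ?thesis by simp
qed

section \<open>The boundary form\<close>

text \<open>After subtraction of the lifting, the problem lives on \<open>Uh0\<close>, where
  \<open>a_h\<close> is definite.\<close>

lemma omega_exists:
  assumes \<mu>: "\<mu> \<in> Pk_boundary"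
  shows "\<exists>!w. w \<in> Uh_bc \<mu> \<and> (\<forall>v\<in>Uh0. a_h w v = 0)"
proof -
  have L: "lift_h \<mu> \<in> Uh_bc \<mu>" by (rule lift_h_in[OF \<mu>])
  note LU = Uh_bc_subset[OF L]
  have "linear_map_on Uh0 UNIV (\<lambda>v. - a_h (lift_h \<mu>) v)"
    unfolding linear_map_on_def using psd_comb_right[OF psd_a_h _ _ LU] Uh_bc_subset by simp
  then have "\<exists>!u. u \<in> Uh0 \<and> (\<forall>v\<in>Uh0. a_h u v = - a_h (lift_h \<mu>) v)"
    by (intro riesz_unique[OF finite_dim_Uh0 psd_a_h0] a_h_zero)
  then obtain u where u: "u \<in> Uh0" "\<And>v. v \<in> Uh0 \<Longrightarrow> a_h u v = - a_h (lift_h \<mu>) v" by blast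
  have w: "u + lift_h \<mu> \<in> Uh_bc \<mu>"
    using Uh_bc_comb[OF u(1) L, of 1] by (simp add: zero_fun_def[symmetric])
  have w0: "a_h (u + lift_h \<mu>) v = 0" if "v \<in> Uh0" for v
    using psd_add_left[OF psd_a_h Uh_bc_subset[OF u(1)] LU Uh_bc_subset[OF that]] u(2)[OF that] by simp
  show ?thesis
  proof (rule ex1I[of _ "u + lift_h \<mu>"])
    fix w' assume w': "w' \<in> Uh_bc \<mu> \<and> (\<forall>v\<in>Uh0. a_h w' v = 0)"
    let ?d = "w' - (u + lift_h \<mu>)"
    have d: "?d \<in> Uh0"
      using Uh_bc_comb[OF w conjunct1[OF w'], of "-1"] by (simp add: zero_fun_def[symmetric] algebra_simps)
    have "a_h ?d ?d = 0"
      using psd_diff_left[OF psd_a_h Uh_bc_subset[OF conjunct1[OF w']] Uh_bc_subset[OF w] Uh_bc_subset[OF d]]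
        w' d w0[OF d] by simp
    then show "w' = u + lift_h \<mu>" using a_h_zero[OF d] by simp
  qed (use w w0 in blast)
qed

lemma psi_exists:
  assumes w: "w \<in> Uh"
  shows "\<exists>!p. p \<in> Uh0 \<and> (\<forall>v\<in>Uh0. a_h p v = star_form w v)"
proof (rule riesz_unique[OF finite_dim_Uh0 psd_a_h0])
  show "linear_map_on Uh0 UNIV (star_form w)"
    by (rule linear_map_on_ip[OF psd_star_form Uh0_subset w])
qed (rule a_h_zero)

text \<open>The system is triangular: the first equation determines \<open>omega\<close>, which then
  enters the right-hand side for \<open>psi\<close>.\<close>

lemma solution_exists:
  assumes \<mu>: "\<mu> \<in> Pk_boundary"
  shows "\<exists>!s. is_solution \<mu> s"
proof -
  obtain w where w: "w \<in> Uh_bc \<mu>" "\<forall>v\<in>Uh0. a_h w v = 0"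
    and w_unique: "\<And>w'. w' \<in> Uh_bc \<mu> \<Longrightarrow> \<forall>v\<in>Uh0. a_h w' v = 0 \<Longrightarrow> w' = w"
    using omega_exists[OF \<mu>] by blast
  obtain p where p: "p \<in> Uh0" "\<forall>v\<in>Uh0. a_h p v = star_form w v"
    and p_unique: "\<And>p'. p' \<in> Uh0 \<Longrightarrow> \<forall>v\<in>Uh0. a_h p' v = star_form w v \<Longrightarrow> p' = p"
    using psi_exists[OF Uh_bc_subset[OF w(1)]] by blast
  show ?thesis
  proof (rule ex1I[of _ "(w, p)"])
    show "is_solution \<mu> (w, p)" using w p by (simp add: is_solution_def)
    fix s assume s: "is_solution \<mu> s"
    obtain w' p' where [simp]: "s = (w', p')" by (cases s)
    have "w' = w" using s by (intro w_unique) (auto simp: is_solution_def)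
    moreover from this have "p' = p" using s by (intro p_unique) (auto simp: is_solution_def)
    ultimately show "s = (w, p)" by simp
  qed
qed

lemma omega_psi:
  assumes "\<mu> \<in> Pk_boundary"
  shows "is_solution \<mu> (omega \<mu>, psi \<mu>)"
  using theI'[OF solution_exists[OF assms]] by (simp add: omega_def psi_def)

lemma
  assumes "\<mu> \<in> Pk_boundary"
  shows omega_in: "omega \<mu> \<in> Uh_bc \<mu>" and psi_in: "psi \<mu> \<in> Uh0"
    and omega_orth: "v \<in> Uh0 \<Longrightarrow> a_h (omega \<mu>) v = 0"
    and psi_eq: "v \<in> Uh0 \<Longrightarrow> a_h (psi \<mu>) v = star_form (omega \<mu>) v"
  using omega_psi[OF assms] by (auto simp: is_solution_def)

lemma ell_eq_star_form:
  assumes \<mu>: "\<mu> \<in> Pk_boundary" and \<eta>: "\<eta> \<in> Pk_boundary"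
  shows "ell \<mu> \<eta> = star_form (omega \<mu>) (omega \<eta>)"
proof -
  let ?L = "lift_h \<eta>" and ?w = "omega \<eta>"
  have L: "?L \<in> Uh" and w: "?w \<in> Uh" and p: "psi \<mu> \<in> Uh" and m: "omega \<mu> \<in> Uh"
    using Uh_bc_subset lift_h_in[OF \<eta>] omega_in[OF \<eta>] psi_in[OF \<mu>] omega_in[OF \<mu>] by blast+
  have d: "?w - ?L \<in> Uh0"
    using Uh_bc_comb[OF lift_h_in[OF \<eta>] omega_in[OF \<eta>], of "-1"] by (simp add: zero_fun_def[symmetric])
  \<comment> \<open>\<open>psi \<mu>\<close> has zero boundary values and is thus an admissible test
    function for \<open>omega \<eta>\<close>; symmetry of \<open>a_h\<close> swaps the
    arguments.\<close>
  have "a_h (psi \<mu>) ?w = 0"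
    using psd_sym[OF psd_a_h p w] omega_orth[OF \<eta> psi_in[OF \<mu>]] by simp
  moreover have "a_h (psi \<mu>) (?w - ?L) = star_form (omega \<mu>) (?w - ?L)" by (rule psi_eq[OF \<mu> d])
  ultimately show ?thesis
    using psd_diff_right[OF psd_a_h w L p] psd_diff_right[OF psd_star_form w L m] by (simp add: ell_def)
qed

text \<open>The combination solves the problem for the combined data, so uniqueness gives linearity;
  bilinearity of \<open>ell\<close> rests on it.\<close>

lemma omega_comb:
  assumes \<mu>: "\<mu> \<in> Pk_boundary" and \<eta>: "\<eta> \<in> Pk_boundary"
  shows "c *\<^sub>R \<mu> + \<eta> \<in> Pk_boundary" "omega (c *\<^sub>R \<mu> + \<eta>) = c *\<^sub>R omega \<mu> + omega \<eta>"
proof -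
  show V: "c *\<^sub>R \<mu> + \<eta> \<in> Pk_boundary"
    using assms unfolding Pk_boundary_def
    by (intro subspace_comb subspace_broken subspace_polys_on)
  note w = Uh_bc_subset[OF omega_in[OF \<mu>]] Uh_bc_subset[OF omega_in[OF \<eta>]]
  have "a_h (c *\<^sub>R omega \<mu> + omega \<eta>) v = 0" if "v \<in> Uh0" for v
    using psd_comb_left[OF psd_a_h w Uh_bc_subset[OF that]] omega_orth[OF \<mu> that] omega_orth[OF \<eta> that] by simp
  then show "omega (c *\<^sub>R \<mu> + \<eta>) = c *\<^sub>R omega \<mu> + omega \<eta>"
    using omega_exists[OF V] omega_in[OF V] omega_orth[OF V] Uh_bc_comb[OF omega_in[OF \<mu>] omega_in[OF \<eta>], of c]
    by blast
qed

lemma ell_bilinear: "bilinear_form_on Pk_boundary ell"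
proof -
  have comb: "(\<lambda>X x. c * u X x + v X x) = c *\<^sub>R u + v" for c and u v :: "'a set \<Rightarrow> 'a \<Rightarrow> real"
    by (simp add: fun_eq_iff fun_apply)
  note w = Uh_bc_subset[OF omega_in]
  show ?thesis
    unfolding bilinear_form_on_def comb
    by (simp add: ell_eq_star_form omega_comb w psd_comb_left[OF psd_star_form] psd_comb_right[OF psd_star_form])
qed

lemma ell_sym: "\<mu> \<in> Pk_boundary \<Longrightarrow> \<eta> \<in> Pk_boundary \<Longrightarrow> ell \<mu> \<eta> = ell \<eta> \<mu>"
  by (simp add: ell_eq_star_form psd_sym[OF psd_star_form] Uh_bc_subset[OF omega_in])

lemma ell_pos:
  assumes \<mu>: "\<mu> \<in> Pk_boundary" and ne: "\<mu> \<noteq> (\<lambda>_ _. 0)"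
  shows "0 < ell \<mu> \<mu>"
proof (rule ccontr)
  assume "\<not> 0 < ell \<mu> \<mu>"
  note w = Uh_bc_subset[OF omega_in[OF \<mu>]]
  have 0: "star_form (omega \<mu>) (omega \<mu>) = 0"
    using psd_nonneg[OF psd_star_form w] \<open>\<not> 0 < ell \<mu> \<mu>\<close> by (simp add: ell_eq_star_form[OF \<mu> \<mu>])
  have "\<mu> F = (\<lambda>_. 0)" for F
  proof (cases "F \<in> boundary_faces")
    case True
    then have "snd (omega \<mu>) F = \<mu> F" using omega_in[OF \<mu>] by (simp add: Uh_bc_def)
    then show ?thesis using star_form_zero[OF w 0 True] by (simp add: zero_fun_def)
  next
    case False
    then show ?thesis using \<mu> by (simp add: Pk_boundary_def broken_def)
  qed
  then show False using ne by (simp add: fun_eq_iff)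
qed

end

theorem theorem1:
  fixes \<Omega> :: "'a::euclidean_space set"
    and Th Fh :: "'a set set"
    and k l :: nat
    and stab :: stabilization
  assumes dim: "DIM('a) \<in> {2, 3}"
    and domain: "open_polytope \<Omega>" "connected \<Omega>"
    and mesh: "polytopal_mesh \<Omega> Th Fh"
    and degree: "l \<in> {k, k + 1}"
    and variant: "stab = Projection_Stab \<longrightarrow> l = k + 1"
  defines "V \<equiv> hho.Pk_boundary \<Omega> Th Fh k"
    and "\<L> \<equiv> hho.ell \<Omega> Th Fh k l stab"
  shows "(\<forall>\<mu>\<in>V. \<exists>!s. hho.is_solution \<Omega> Th Fh k l stab \<mu> s) \<and>
         bilinear_form_on V \<L> \<and>
         (\<forall>\<mu>\<in>V. \<forall>\<eta>\<in>V. \<L> \<mu> \<eta> = \<L> \<eta> \<mu>) \<and>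
         (\<forall>\<mu>\<in>V. \<mu> \<noteq> (\<lambda>_ _. 0) \<longrightarrow> \<L> \<mu> \<mu> > 0)"
proof -
  interpret hho_mesh \<Omega> Th Fh k l stab
    by standard (use dim domain mesh degree in auto)
  show ?thesis
    unfolding V_def \<L>_def using solution_exists ell_bilinear ell_sym ell_pos by blast
qed

end
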